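(* Suppose every algebra in the class $\mathcal{C}$ (a class of unital $C^*$-algebras closed under isomorphism) has real rank zero. Then every separable unital commutative $C^*$-algebra is $\mathcal{C}$-tracially stable.
   Context: A unital $C^*$-algebra has real rank zero if each of its self-adjoint elements can be approximated in norm by self-adjoint elements with finite spectrum. If $\rho$ is a tracial state on a unital $C^*$-algebra, put $\|x\|_{2,\rho}=\rho(x^*x)^{1/2}$. An ultrafilter $\alpha$ on an infinite set $I$ is nontrivial if there is a sequence $\{E_n\}$ in $\alpha$ with $\bigcap_n E_n=\varnothing$. Given unital $C^*$-algebras $\mathcal{A}_i$ with tracial states $\rho_i$ ($i\in I$), the tracial ultraproduct $\prod_{i\in I}^{\alpha}(\mathcal{A}_i,\rho_i)$ is the $C^*$-product $\prod_{i\in I}\mathcal{A}_i$ (bounded families) modulo the ideal of all $\{a_i\}$ with $\lim_{i\to\alpha}\|a_i\|_{2,\rho_i}=0$; the coset of $\{a_i\}$ is denoted $\{a_i\}_\alpha$. A unital $*$-homomorphism $\pi:\mathcal{A}\to\prod_{i\in I}^{\alpha}(\mathcal{A}_i,\rho_i)$ is approximately liftable if there are $E\in\alpha$ and, for every $i\in E$, a unital $*$-homomorphism $\pi_i:\mathcal{A}\to\mathcal{A}_i$ such that $\pi(a)=\{\pi_i(a)\}_\alpha$ for every $a\in\mathcal{A}$ (where $\pi_i(a)=0$ for $i\notin E$). A separable unital $C^*$-algebra $\mathcal{A}$ is $\mathcal{C}$-tracially stable if every unital $*$-homomorphism from $\mathcal{A}$ into any tracial ultraproduct $\prod_{i\in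 I}^{\alpha}(\mathcal{A}_i,\rho_i)$, with all $\mathcal{A}_i\in\mathcal{C}$, $\rho_i$ any tracial state on $\mathcal{A}_i$, and $\alpha$ any nontrivial ultrafilter, is approximately liftable. *)

theory Defs
  imports
    "HOL-Analysis.Analysis"
    "HOL-Algebra.Algebra"
    "HOL-Algebra.Algebraic_Closure_Type"
begin

section \<open>Unital C*-algebras on a carrier set\<close>

record 'a cstar = "(complex, 'a) module" +
  adj :: "'a \<Rightarrow> 'a"
  cnorm :: "'a \<Rightarrow> real"

text \<open>
  The value \<open>0\<close> off the carrier is there only because \<^locale>\<open>Metric_space\<close> requires
  a metric to be symmetric and nonnegative on the whole type.
\<close>

definition cdist :: "'a cstar \<Rightarrow> 'a \<Rightarrow> 'a \<Rightarrow> real"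
  where "cdist A x y =
    (if x \<in> carrier A \<and> y \<in> carrier A then cnorm A (x \<ominus>\<^bsub>A\<^esub> y) else 0)"

text \<open>The zero algebra is not excluded; it carries no tracial state.\<close>

locale unital_cstar_algebra =
  A?: Ring.ring A + Module.module "ring_of_type_algebra :: complex ring" A
  for A :: "'a cstar" (structure) +
  assumes smult_mult_left:
      "\<lbrakk>x \<in> carrier A; y \<in> carrier A\<rbrakk> \<Longrightarrow> (c \<odot> x) \<otimes> y = c \<odot> (x \<otimes> y)"
    and smult_mult_right:
      "\<lbrakk>x \<in> carrier A; y \<in> carrier A\<rbrakk> \<Longrightarrow> x \<otimes> (c \<odot> y) = c \<odot> (x \<otimes> y)"
    and adj_closed: "x \<in> carrier A \<Longrightarrow> adj A x \<in> carrier A"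
    and adj_adj: "x \<in> carrier A \<Longrightarrow> adj A (adj A x) = x"
    and adj_add:
      "\<lbrakk>x \<in> carrier A; y \<in> carrier A\<rbrakk> \<Longrightarrow> adj A (x \<oplus> y) = adj A x \<oplus> adj A y"
    and adj_smult: "x \<in> carrier A \<Longrightarrow> adj A (c \<odot> x) = cnj c \<odot> adj A x"
    and adj_mult:
      "\<lbrakk>x \<in> carrier A; y \<in> carrier A\<rbrakk> \<Longrightarrow> adj A (x \<otimes> y) = adj A y \<otimes> adj A x"
    and cnorm_nonneg: "x \<in> carrier A \<Longrightarrow> 0 \<le> cnorm A x"
    and cnorm_eq_0: "x \<in> carrier A \<Longrightarrow> cnorm A x = 0 \<longleftrightarrow> x = \<zero>"
    and cnorm_smult: "x \<in> carrier A \<Longrightarrow> cnorm A (c \<odot> x) = cmod c * cnorm A x"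
    and cnorm_triangle:
      "\<lbrakk>x \<in> carrier A; y \<in> carrier A\<rbrakk> \<Longrightarrow> cnorm A (x \<oplus> y) \<le> cnorm A x + cnorm A y"
    and cnorm_mult:
      "\<lbrakk>x \<in> carrier A; y \<in> carrier A\<rbrakk> \<Longrightarrow> cnorm A (x \<otimes> y) \<le> cnorm A x * cnorm A y"
    and cstar_identity: "x \<in> carrier A \<Longrightarrow> cnorm A (adj A x \<otimes> x) = (cnorm A x)\<^sup>2"
    and complete: "Metric_space.mcomplete (carrier A) (cdist A)"

lemma (in unital_cstar_algebra) cnorm_a_inv:
  assumes x: "x \<in> carrier A"
  shows "cnorm A (\<ominus> x) = cnorm A x"
proof -
  have m1: "(- 1 :: complex) \<in> carrier (ring_of_type_algebra :: complex ring)"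
    and p1: "(1 :: complex) \<in> carrier (ring_of_type_algebra :: complex ring)"
    by (simp_all add: ring_of_type_algebra_def)
  have one: "1 \<odot> x = x"
    using smult_one[OF x] by (simp add: ring_of_type_algebra_def)
  have closed: "- 1 \<odot> x \<in> carrier A"
    using smult_closed[OF m1 x] .
  have "0 \<odot> x = - 1 \<odot> x \<oplus> 1 \<odot> x"
    using smult_l_distr[OF m1 p1 x] by (simp add: ring_of_type_algebra_def)
  moreover have "0 \<odot> x = \<zero>"
    using smult_l_null[OF x] by (simp add: ring_of_type_algebra_def)
  ultimately have "- 1 \<odot> x \<oplus> x = \<zero>"
    by (simp add: one)
  then have "\<ominus> x = - 1 \<odot> x"
    using closed x A.minus_equality by blast
  then show ?thesis
    using cnorm_smult[OF x, of "- 1"] by simp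
qed

lemma (in unital_cstar_algebra) Metric_space_cdist:
  "Metric_space (carrier A) (cdist A)"
proof
  fix x y z
  show "0 \<le> cdist A x y"
    by (simp add: cdist_def cnorm_nonneg)
  show "cdist A x y = cdist A y x"
  proof (cases "x \<in> carrier A \<and> y \<in> carrier A")
    case True
    then have "\<ominus> (x \<ominus> y) = y \<ominus> x"
      by (simp add: a_minus_def A.minus_add A.a_comm)
    then show ?thesis
      using True cnorm_a_inv[of "x \<ominus> y"] by (simp add: cdist_def)
  qed (auto simp: cdist_def)
  show "cdist A x y = 0 \<longleftrightarrow> x = y" if "x \<in> carrier A" "y \<in> carrier A"
    using that by (simp add: cdist_def cnorm_eq_0)
  show "cdist A x z \<le> cdist A x y + cdist A y z"
    if "x \<in> carrier A" "y \<in> carrier A" "z \<in> carrier A"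
  proof -
    have "x \<ominus> z = (x \<ominus> y) \<oplus> (y \<ominus> z)"
      using that by (simp add: a_minus_def A.a_assoc A.r_neg1)
    then show ?thesis
      using that cnorm_triangle[of "x \<ominus> y" "y \<ominus> z"] by (simp add: cdist_def)
  qed
qed

definition separable_cstar :: "'a cstar \<Rightarrow> bool"
  where "separable_cstar A \<longleftrightarrow>
    separable_space (Metric_space.mtopology (carrier A) (cdist A))"

definition self_adjoint :: "'a cstar \<Rightarrow> 'a \<Rightarrow> bool"
  where "self_adjoint A x \<longleftrightarrow> x \<in> carrier A \<and> adj A x = x"

definition spectrum :: "'a cstar \<Rightarrow> 'a \<Rightarrow> complex set"
  where "spectrum A x = {c. (c \<odot>\<^bsub>A\<^esub> \<one>\<^bsub>A\<^esub>) \<ominus>\<^bsub>A\<^esub> x \<notin> Units A}"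

definition real_rank_zero :: "'a cstar \<Rightarrow> bool"
  where "real_rank_zero A \<longleftrightarrow>
    (\<forall>x. self_adjoint A x \<longrightarrow>
      (\<forall>\<epsilon>>0. \<exists>y. self_adjoint A y \<and> finite (spectrum A y) \<and> cnorm A (x \<ominus>\<^bsub>A\<^esub> y) < \<epsilon>))"

text \<open>\<^const>\<open>ring_hom\<close> already includes preservation of the unit.\<close>

definition unital_star_hom :: "'a cstar \<Rightarrow> 'b cstar \<Rightarrow> ('a \<Rightarrow> 'b) \<Rightarrow> bool"
  where "unital_star_hom A B \<phi> \<longleftrightarrow>
    \<phi> \<in> ring_hom A B \<and>
    (\<forall>c. \<forall>x\<in>carrier A. \<phi> (c \<odot>\<^bsub>A\<^esub> x) = c \<odot>\<^bsub>B\<^esub> \<phi> x) \<and>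
    (\<forall>x\<in>carrier A. \<phi> (adj A x) = adj B (\<phi> x))"

definition cstar_isomorphic :: "'a cstar \<Rightarrow> 'b cstar \<Rightarrow> bool"
  where "cstar_isomorphic A B \<longleftrightarrow>
    (\<exists>\<phi>. unital_star_hom A B \<phi> \<and> bij_betw \<phi> (carrier A) (carrier B))"

definition tracial_state :: "'a cstar \<Rightarrow> ('a \<Rightarrow> complex) \<Rightarrow> bool"
  where "tracial_state A \<rho> \<longleftrightarrow>
    (\<forall>x\<in>carrier A. \<forall>y\<in>carrier A. \<rho> (x \<oplus>\<^bsub>A\<^esub> y) = \<rho> x + \<rho> y) \<and>
    (\<forall>c. \<forall>x\<in>carrier A. \<rho> (c \<odot>\<^bsub>A\<^esub> x) = c * \<rho> x) \<and>
    (\<forall>x\<in>carrier A. \<rho> (adj A x \<otimes>\<^bsub>A\<^esub> x) \<in> \<real>\<^sub>\<ge>\<^sub>0) \<and>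
    \<rho> \<one>\<^bsub>A\<^esub> = 1 \<and>
    (\<forall>x\<in>carrier A. \<forall>y\<in>carrier A. \<rho> (x \<otimes>\<^bsub>A\<^esub> y) = \<rho> (y \<otimes>\<^bsub>A\<^esub> x))"

definition norm2 :: "'a cstar \<Rightarrow> ('a \<Rightarrow> complex) \<Rightarrow> 'a \<Rightarrow> real"
  where "norm2 A \<rho> x = sqrt (Re (\<rho> (adj A x \<otimes>\<^bsub>A\<^esub> x)))"


section \<open>Ultrafilters\<close>

text \<open>
  An ultrafilter on the set \<open>I\<close> is represented by a filter on the ambient type that
  contains \<open>I\<close>; a set \<open>E \<subseteq> I\<close> belongs to it iff \<open>\<forall>\<^sub>F i in \<alpha>. i \<in> E\<close>.
\<close>

definition ultrafilter_on :: "'i set \<Rightarrow> 'i filter \<Rightarrow> bool"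
  where "ultrafilter_on I \<alpha> \<longleftrightarrow>
    \<alpha> \<le> principal I \<and> \<alpha> \<noteq> bot \<and>
    (\<forall>E\<subseteq>I. (\<forall>\<^sub>F i in \<alpha>. i \<in> E) \<or> (\<forall>\<^sub>F i in \<alpha>. i \<in> I - E))"

definition nontrivial_ultrafilter_on :: "'i set \<Rightarrow> 'i filter \<Rightarrow> bool"
  where "nontrivial_ultrafilter_on I \<alpha> \<longleftrightarrow>
    ultrafilter_on I \<alpha> \<and>
    (\<exists>E :: nat \<Rightarrow> 'i set. (\<forall>n. E n \<subseteq> I \<and> (\<forall>\<^sub>F i in \<alpha>. i \<in> E n)) \<and> (\<Inter>n. E n) = {})"


section \<open>Tracial ultraproducts\<close>

definition cstar_product :: "'i set \<Rightarrow> ('i \<Rightarrow> 'b cstar) \<Rightarrow> ('i \<Rightarrow> 'b) cstar"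
  where "cstar_product I \<A> =
    \<lparr>carrier = {a \<in> (\<Pi>\<^sub>E i\<in>I. carrier (\<A> i)). bdd_above ((\<lambda>i. cnorm (\<A> i) (a i)) ` I)},
     mult = (\<lambda>a b. \<lambda>i\<in>I. a i \<otimes>\<^bsub>\<A> i\<^esub> b i),
     one = (\<lambda>i\<in>I. \<one>\<^bsub>\<A> i\<^esub>),
     ring.zero = (\<lambda>i\<in>I. \<zero>\<^bsub>\<A> i\<^esub>),
     add = (\<lambda>a b. \<lambda>i\<in>I. a i \<oplus>\<^bsub>\<A> i\<^esub> b i),
     smult = (\<lambda>c a. \<lambda>i\<in>I. c \<odot>\<^bsub>\<A> i\<^esub> a i),
     adj = (\<lambda>a. \<lambda>i\<in>I. adj (\<A> i) (a i)),
     cnorm = (\<lambda>a. SUP i\<in>I. cnorm (\<A> i) (a i))\<rparr>"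

definition cstar_quotient :: "'a cstar \<Rightarrow> 'a set \<Rightarrow> 'a set cstar"
  where "cstar_quotient A J =
    \<lparr>carrier = carrier (A Quot J),
     mult = mult (A Quot J),
     one = one (A Quot J),
     ring.zero = ring.zero (A Quot J),
     add = add (A Quot J),
     smult = (\<lambda>c S. \<Union>x\<in>S. J +>\<^bsub>A\<^esub> (c \<odot>\<^bsub>A\<^esub> x)),
     adj = (\<lambda>S. \<Union>x\<in>S. J +>\<^bsub>A\<^esub> adj A x),
     cnorm = (\<lambda>S. INF x\<in>S. cnorm A x)\<rparr>"

definition trace_null_ideal ::
    "'i set \<Rightarrow> 'i filter \<Rightarrow> ('i \<Rightarrow> 'b cstar) \<Rightarrow> ('i \<Rightarrow> 'b \<Rightarrow> complex) \<Rightarrow> ('i \<Rightarrow> 'b) set"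
  where "trace_null_ideal I \<alpha> \<A> \<rho> =
    {a \<in> carrier (cstar_product I \<A>). ((\<lambda>i. norm2 (\<A> i) (\<rho> i) (a i)) \<longlongrightarrow> 0) \<alpha>}"

definition tracial_ultraproduct ::
    "'i set \<Rightarrow> 'i filter \<Rightarrow> ('i \<Rightarrow> 'b cstar) \<Rightarrow> ('i \<Rightarrow> 'b \<Rightarrow> complex) \<Rightarrow> ('i \<Rightarrow> 'b) set cstar"
  where "tracial_ultraproduct I \<alpha> \<A> \<rho> =
    cstar_quotient (cstar_product I \<A>) (trace_null_ideal I \<alpha> \<A> \<rho>)"

definition ultraproduct_coset ::
    "'i set \<Rightarrow> 'i filter \<Rightarrow> ('i \<Rightarrow> 'b cstar) \<Rightarrow> ('i \<Rightarrow> 'b \<Rightarrow> complex) \<Rightarrow> ('i \<Rightarrow> 'b) \<Rightarrow> ('i \<Rightarrow> 'b) set"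
  where "ultraproduct_coset I \<alpha> \<A> \<rho> a =
    trace_null_ideal I \<alpha> \<A> \<rho> +>\<^bsub>cstar_product I \<A>\<^esub> restrict a I"


section \<open>Tracial stability\<close>

definition approximately_liftable ::
    "'a cstar \<Rightarrow> 'i set \<Rightarrow> 'i filter \<Rightarrow> ('i \<Rightarrow> 'b cstar) \<Rightarrow> ('i \<Rightarrow> 'b \<Rightarrow> complex) \<Rightarrow>
      ('a \<Rightarrow> ('i \<Rightarrow> 'b) set) \<Rightarrow> bool"
  where "approximately_liftable A I \<alpha> \<A> \<rho> \<pi> \<longleftrightarrow>
    (\<exists>E \<phi>. E \<subseteq> I \<and> (\<forall>\<^sub>F i in \<alpha>. i \<in> E) \<and>
      (\<forall>i\<in>E. unital_star_hom A (\<A> i) (\<phi> i)) \<and>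
      (\<forall>a\<in>carrier A.
        \<pi> a = ultraproduct_coset I \<alpha> \<A> \<rho> (\<lambda>i. if i \<in> E then \<phi> i a else \<zero>\<^bsub>\<A> i\<^esub>)))"

text \<open>
  HOL cannot quantify over types inside a formula.  The index sets of the ultraproducts
  are therefore the infinite subsets of a type \<open>'i\<close> passed as a parameter, and the class
  \<open>\<C>\<close> consists of algebras whose carriers are subsets of a type \<open>'b\<close>.  A statement
  polymorphic in \<open>'i\<close> and \<open>'b\<close> covers all index sets and all families of algebras.
\<close>

definition tracially_stable :: "'i itself \<Rightarrow> 'b cstar set \<Rightarrow> 'a cstar \<Rightarrow> bool"
  where "tracially_stable (_ :: 'i itself) \<C> A \<longleftrightarrow>
    (\<forall>(I :: 'i set) \<alpha> \<A> \<rho> \<pi>.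
      infinite I \<longrightarrow>
      nontrivial_ultrafilter_on I \<alpha> \<longrightarrow>
      (\<forall>i\<in>I. \<A> i \<in> \<C> \<and> tracial_state (\<A> i) (\<rho> i)) \<longrightarrow>
      unital_star_hom A (tracial_ultraproduct I \<alpha> \<A> \<rho>) \<pi> \<longrightarrow>
      approximately_liftable A I \<alpha> \<A> \<rho> \<pi>)"

end

theory Submission
  imports Defs
begin

text \<open>
  Let \<open>\<pi>\<close> map the separable commutative algebra \<open>A\<close> into a tracial ultraproduct. Its limit
  trace pulls back to a state \<open>\<omega>\<close> of \<open>A\<close>, that is, to a measure on the space of characters.
  Two points make the lifting problem one-dimensional and finite.

  \<^emph>\<open>One self-adjoint element almost generates.\<close> Given \<open>a\<^sub>1, \<dots>, a\<^sub>r \<in> A\<close>, choose finitely many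
  characters \<open>\<xi>\<^sub>0, \<dots>, \<xi>\<^bsub>n-1\<^esub>\<close> such that every character is close to one of them on these
  elements. The cells so obtained can be cut apart by continuous functions whose transition
  zones have small \<open>\<omega>\<close>-mass: of many disjoint candidate zones, one is small
  (\<open>soft_step\<close>). Hence some self-adjoint \<open>x \<in> A\<close> takes, up to small mass, a value near \<open>l\<close>
  on the cell of \<open>\<xi>\<^sub>l\<close> (\<open>separating_element\<close>). Working with the single element \<open>x\<close> avoids
  having to make approximately commuting elements of the algebras \<open>\<A> i\<close> commute.

  \<^emph>\<open>A finite spectrum carries exact homomorphisms.\<close> Real rank zero lifts \<open>x\<close> to self-adjoint
  elements \<open>y\<^sub>i\<close> with finite spectrum (\<open>finite_spectrum_lift\<close>), and each of these has a
  functional calculus \<open>\<Phi>\<^sub>i\<close> on all functions on its spectrum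
  (\<open>finite_spectrum_calculus\<close>). Rounding a spectral value \<open>t\<close> to an index \<open>l(t)\<close>, the
  formula \<open>\<psi>\<^sub>i(a) = \<Phi>\<^sub>i(t \<mapsto> \<xi>\<^bsub>l(t)\<^esub>(a))\<close> is an exact unital *-homomorphism from \<open>A\<close> to \<open>\<A> i\<close>.
  Because the trace sees only the compressions to the spectral projections, its distance from
  \<open>\<pi>\<close> on the \<open>a\<^sub>j\<close>, in trace norm, is an integral over the spectrum of \<open>y\<^sub>i\<close>. Once the
  integrand is dominated by polynomials, the integral converges along the ultrafilter to one
  over the characters of \<open>A\<close>, which is small by the choice of \<open>x\<close>
  (\<open>approximate_lift\<close>). A diagonal argument over a dense sequence of \<open>A\<close>, possible since the
  ultrafilter is countably incomplete, then gives one family of homomorphisms for all of \<open>A\<close>.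

  The facts about C*-algebras that this requires are derived from two devices: square roots of
  \<open>1 - h\<close> for self-adjoint \<open>h\<close> with \<open>\<parallel>h\<parallel> < 1\<close>, found as fixed points of a contraction, and the
  inequality \<open>\<parallel>u\<^sup>2\<parallel> \<le> \<parallel>u\<^sup>2 + v\<^sup>2\<parallel>\<close> for commuting self-adjoint \<open>u\<close> and \<open>v\<close>. They yield the bound
  on positive functionals, the polynomial relation satisfied by an element with finite
  spectrum, and the multiplicativity of extreme states. The last of these supplies enough
  characters: an extreme state minimising \<open>Re \<phi> b\<close> exists by compactness, so inequalities between
  elements of \<open>A\<close> that hold at all characters hold under \<open>\<omega>\<close>.
\<close>


section \<open>Square roots and invertible elements\<close>

text \<open>
  Banach's fixed point theorem, with closedness of \<open>S\<close> expressed by approximation, the form in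
  which it is verified below.
\<close>

lemma (in Metric_space) contraction_fixed_point:
  assumes "mcomplete" and SM: "S \<subseteq> M" and "S \<noteq> {}"
    and closed: "\<And>l. \<lbrakk>l \<in> M; \<And>e. e > 0 \<Longrightarrow> \<exists>x\<in>S. d l x < e\<rbrakk> \<Longrightarrow> l \<in> S"
    and fS: "\<And>x. x \<in> S \<Longrightarrow> f x \<in> S" and k: "0 \<le> k" "k < 1"
    and contr: "\<And>x y. \<lbrakk>x \<in> S; y \<in> S\<rbrakk> \<Longrightarrow> d (f x) (f y) \<le> k * d x y"
  obtains x where "x \<in> S" "f x = x"
proof -
  obtain x0 where x0: "x0 \<in> S" using \<open>S \<noteq> {}\<close> by blast
  define \<sigma> where "\<sigma> n = (f ^^ n) x0" for n
  have \<sigma>S: "\<sigma> n \<in> S" for n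
    by (induction n) (auto simp: \<sigma>_def x0 fS)
  have \<sigma>Suc: "\<sigma> (Suc n) = f (\<sigma> n)" for n by (simp add: \<sigma>_def)
  have \<sigma>M: "\<sigma> n \<in> M" for n using \<sigma>S SM by blast
  define D where "D = d x0 (f x0) / (1 - k)"
  have D0: "D \<ge> 0" using k by (simp add: D_def)
  have x0M: "x0 \<in> M" "f x0 \<in> M" using x0 fS SM by auto
  have bound0: "d x0 (\<sigma> m) \<le> D" for m
  proof (induction m)
    case 0
    then show ?case using D0 x0M by (simp add: \<sigma>_def)
  next
    case (Suc m)
    have "d x0 (\<sigma> (Suc m)) \<le> d x0 (f x0) + d (f x0) (f (\<sigma> m))"
      unfolding \<sigma>Suc using x0M \<sigma>M[of "Suc m"] by (intro triangle) (auto simp: \<sigma>Suc)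
    also have "\<dots> \<le> d x0 (f x0) + k * D"
      using contr[OF x0 \<sigma>S, of m] mult_left_mono[OF Suc k(1)] by linarith
    also have "\<dots> = D" using k by (simp add: D_def field_simps)
    finally show ?case .
  qed
  have bound: "d (\<sigma> n) (\<sigma> (n + m)) \<le> k ^ n * D" for n m
  proof (induction n)
    case 0
    then show ?case using bound0 by (simp add: \<sigma>_def)
  next
    case (Suc n)
    have "d (\<sigma> (Suc n)) (\<sigma> (Suc n + m)) \<le> k * d (\<sigma> n) (\<sigma> (n + m))"
      using contr[OF \<sigma>S \<sigma>S] by (simp add: \<sigma>Suc)
    also have "\<dots> \<le> k ^ Suc n * D"
      using mult_left_mono[OF Suc k(1)] by (simp add: mult_ac)
    finally show ?case .
  qed
  have lim0: "(\<lambda>n. k ^ n * D) \<longlonglongrightarrow> 0"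
    using LIMSEQ_power_zero[of k] k tendsto_mult_left_zero by fastforce
  have "MCauchy \<sigma>"
    unfolding MCauchy_def
  proof (intro conjI allI impI)
    show "range \<sigma> \<subseteq> M" using \<sigma>M by blast
    fix e :: real assume "e > 0"
    then have "\<forall>\<^sub>F n in sequentially. k ^ n * D < e"
      using lim0 order_tendstoD(2) by blast
    then obtain N where N: "\<And>n. n \<ge> N \<Longrightarrow> k ^ n * D < e"
      by (auto simp: eventually_sequentially)
    have "d (\<sigma> n) (\<sigma> n') < e" if "N \<le> n" "n \<le> n'" for n n'
      using bound[of n "n' - n"] N[of n] that by simp
    note lt = this
    have "d (\<sigma> n) (\<sigma> n') < e" if "N \<le> n" "N \<le> n'" for n n'
      using that lt[of n n'] lt[of n' n] commute[of "\<sigma> n" "\<sigma> n'"]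
      by (cases "n \<le> n'") auto
    then show "\<exists>N. \<forall>n n'. N \<le> n \<longrightarrow> N \<le> n' \<longrightarrow> d (\<sigma> n) (\<sigma> n') < e"
      by blast
  qed
  then obtain l where l: "limitin mtopology \<sigma> l sequentially"
    using \<open>mcomplete\<close> unfolding mcomplete_def by blast
  have lM: "l \<in> M" using l limitin_mspace by blast
  have ev: "\<forall>\<^sub>F n in sequentially. d (\<sigma> n) l < e" if "e > 0" for e
    using l that by (auto simp: limitin_metric elim!: allE[of _ e] eventually_mono)
  have lS: "l \<in> S"
  proof (rule closed[OF lM])
    fix e :: real assume "e > 0"
    from ev[OF this] obtain n where "d (\<sigma> n) l < e"
      by (auto simp: eventually_sequentially)
    then have "d l (\<sigma> n) < e" by (simp add: commute)
    then show "\<exists>x\<in>S. d l x < e" using \<sigma>S by blast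
  qed
  have flM: "f l \<in> M" using fS lS SM by blast
  have "d (f l) l \<le> 2 * e" if e: "e > 0" for e
  proof -
    obtain N where N: "\<And>n. n \<ge> N \<Longrightarrow> d (\<sigma> n) l < e"
      using ev[OF e] unfolding eventually_sequentially by blast
    have "d (f l) l \<le> d (f l) (\<sigma> (Suc N)) + d (\<sigma> (Suc N)) l"
      using flM lM \<sigma>M by (intro triangle) auto
    also have "d (f l) (\<sigma> (Suc N)) \<le> k * d l (\<sigma> N)"
      using contr[OF lS \<sigma>S] by (simp add: \<sigma>Suc)
    also have "\<dots> \<le> 1 * d l (\<sigma> N)" using k by (intro mult_right_mono) auto
    finally show ?thesis using N[of N] N[of "Suc N"] commute[of l] by auto
  qed
  from this[of "e / 2" for e] have "d (f l) l \<le> 0 + e" if "e > 0" for e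
    using that by simp
  then have "d (f l) l \<le> 0" by (rule field_le_epsilon)
  then have "f l = l" using nonneg[of "f l" l] zero[OF flM lM] by simp
  with lS show ?thesis using that by blast
qed

context unital_cstar_algebra
begin

lemma smult_closed' [simp, intro]: "x \<in> carrier A \<Longrightarrow> c \<odot> x \<in> carrier A"
  using smult_closed[of c x] by (simp add: ring_of_type_algebra_def)

lemma smult_add_left: "x \<in> carrier A \<Longrightarrow> (a + b) \<odot> x = a \<odot> x \<oplus> b \<odot> x"
  using smult_l_distr[of a b x] by (simp add: ring_of_type_algebra_def)

lemma smult_add_right:
  "\<lbrakk>x \<in> carrier A; y \<in> carrier A\<rbrakk> \<Longrightarrow> a \<odot> (x \<oplus> y) = a \<odot> x \<oplus> a \<odot> y"
  using smult_r_distr[of a x y] by (simp add: ring_of_type_algebra_def)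

lemma smult_smult: "x \<in> carrier A \<Longrightarrow> a \<odot> (b \<odot> x) = (a * b) \<odot> x"
  using smult_assoc1[of a b x] by (simp add: ring_of_type_algebra_def)

lemma smult_1 [simp]: "x \<in> carrier A \<Longrightarrow> 1 \<odot> x = x"
  using smult_one[of x] by (simp add: ring_of_type_algebra_def)

lemma smult_0 [simp]: "x \<in> carrier A \<Longrightarrow> 0 \<odot> x = \<zero>"
  using smult_l_null[of x] by (simp add: ring_of_type_algebra_def)

lemma smult_zero_right [simp]: "c \<odot> \<zero> = \<zero>"
  using smult_r_null[of c] by (simp add: ring_of_type_algebra_def)

lemma add_cancel:
  assumes "x \<in> carrier A" "y \<in> carrier A" "z \<in> carrier A"
  shows "x \<oplus> (y \<oplus> \<ominus> x) = y" "x \<oplus> (y \<oplus> (\<ominus> x \<oplus> z)) = y \<oplus> z"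
    "\<ominus> x \<oplus> (y \<oplus> x) = y" "\<ominus> x \<oplus> (y \<oplus> (x \<oplus> z)) = y \<oplus> z"
proof -
  show 1: "x \<oplus> (y \<oplus> \<ominus> x) = y" "\<ominus> x \<oplus> (y \<oplus> x) = y"
    using assms A.a_comm[of y "\<ominus> x"] A.a_comm[of y x] A.r_neg1 A.r_neg2 by auto
  show "x \<oplus> (y \<oplus> (\<ominus> x \<oplus> z)) = y \<oplus> z" "\<ominus> x \<oplus> (y \<oplus> (x \<oplus> z)) = y \<oplus> z"
    using assms A.a_lcomm[of y "\<ominus> x" z] A.a_lcomm[of y x z] A.r_neg1 A.r_neg2 by auto
qed

lemma minus_eq_smult: "x \<in> carrier A \<Longrightarrow> \<ominus> x = (- 1) \<odot> x"
  using smult_add_left[of x "- 1" 1] by (intro A.minus_equality) auto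

lemma smult_minus_right: "x \<in> carrier A \<Longrightarrow> c \<odot> (\<ominus> x) = (- c) \<odot> x"
  by (simp add: minus_eq_smult smult_smult)

lemma smult_minus_left: "x \<in> carrier A \<Longrightarrow> (- c) \<odot> x = \<ominus> (c \<odot> x)"
  by (simp add: minus_eq_smult smult_smult)

lemma smult_diff_left: "x \<in> carrier A \<Longrightarrow> (a - b) \<odot> x = a \<odot> x \<ominus> b \<odot> x"
  using smult_add_left[of x a "- b"] by (simp add: smult_minus_left a_minus_def)

lemma smult_diff_right:
  "\<lbrakk>x \<in> carrier A; y \<in> carrier A\<rbrakk> \<Longrightarrow> a \<odot> (x \<ominus> y) = a \<odot> x \<ominus> a \<odot> y"
  by (simp add: a_minus_def smult_add_right smult_minus_right smult_minus_left)

declare adj_closed [simp, intro] adj_adj [simp]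

lemma adj_zero [simp]: "adj A \<zero> = \<zero>"
  using adj_smult[of \<zero> 0] by simp

lemma adj_one [simp]: "adj A \<one> = \<one>"
  using adj_mult[of "adj A \<one>" \<one>] by simp

lemma adj_uminus: "x \<in> carrier A \<Longrightarrow> adj A (\<ominus> x) = \<ominus> adj A x"
  by (simp add: minus_eq_smult adj_smult)

lemma adj_diff: "\<lbrakk>x \<in> carrier A; y \<in> carrier A\<rbrakk> \<Longrightarrow> adj A (x \<ominus> y) = adj A x \<ominus> adj A y"
  by (simp add: a_minus_def adj_add adj_uminus)

lemmas adj_simps = adj_add adj_mult adj_smult adj_uminus adj_diff

lemmas smult_simps = smult_smult smult_mult_left smult_mult_right

lemma cnorm_zero [simp]: "cnorm A \<zero> = 0"
  by (simp add: cnorm_eq_0)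

lemma cnorm_diff_le:
  "\<lbrakk>x \<in> carrier A; y \<in> carrier A\<rbrakk> \<Longrightarrow> cnorm A (x \<ominus> y) \<le> cnorm A x + cnorm A y"
  using cnorm_triangle[of x "\<ominus> y"] by (simp add: a_minus_def cnorm_a_inv)

lemma cnorm_diff_commute:
  "\<lbrakk>x \<in> carrier A; y \<in> carrier A\<rbrakk> \<Longrightarrow> cnorm A (x \<ominus> y) = cnorm A (y \<ominus> x)"
  using cnorm_a_inv[of "x \<ominus> y"] by (simp add: A.ring_simprules)

lemma cnorm_diff_triangle:
  assumes "x \<in> carrier A" "y \<in> carrier A" "z \<in> carrier A"
  shows "cnorm A (x \<ominus> z) \<le> cnorm A (x \<ominus> y) + cnorm A (y \<ominus> z)"
proof -
  have "x \<ominus> z = (x \<ominus> y) \<oplus> (y \<ominus> z)" using assms by (simp add: A.ring_simprules)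
  then show ?thesis using cnorm_triangle[of "x \<ominus> y" "y \<ominus> z"] assms by simp
qed

lemma cnorm_adj: assumes "x \<in> carrier A" shows "cnorm A (adj A x) = cnorm A x"
proof -
  have le: "cnorm A y \<le> cnorm A (adj A y)" if y: "y \<in> carrier A" for y
  proof (cases "cnorm A y = 0")
    case True
    then show ?thesis using y by (simp add: cnorm_nonneg)
  next
    case False
    have "cnorm A y * cnorm A y \<le> cnorm A (adj A y) * cnorm A y"
      using cstar_identity[OF y] cnorm_mult[of "adj A y" y] y by (simp add: power2_eq_square)
    then show ?thesis using False cnorm_nonneg[OF y] by simp
  qed
  show ?thesis using le[OF assms] le[of "adj A x"] assms by simp
qed

lemma cnorm_sq: "\<lbrakk>x \<in> carrier A; adj A x = x\<rbrakk> \<Longrightarrow> cnorm A (x \<otimes> x) = (cnorm A x)\<^sup>2"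
  using cstar_identity[of x] by simp

lemma cnorm_one_le: "cnorm A \<one> \<le> 1"
proof -
  have "cnorm A \<one> = (cnorm A \<one>)\<^sup>2" using cnorm_sq[of \<one>] by simp
  then have "cnorm A \<one> * (cnorm A \<one> - 1) = 0" by (simp add: power2_eq_square algebra_simps)
  then show ?thesis by auto
qed

lemma cnorm_smult_one_le: "cnorm A (c \<odot> \<one>) \<le> cmod c"
  using cnorm_one_le mult_left_mono[of "cnorm A \<one>" 1 "cmod c"] by (simp add: cnorm_smult)

lemma eq_if_cnorm_diff_small:
  assumes "x \<in> carrier A" "y \<in> carrier A" and "\<And>e. e > 0 \<Longrightarrow> cnorm A (x \<ominus> y) \<le> C * e"
  shows "x = y"
proof (rule ccontr)
  assume "x \<noteq> y"
  then have n: "cnorm A (x \<ominus> y) > 0"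
    using cnorm_nonneg[of "x \<ominus> y"] cnorm_eq_0[of "x \<ominus> y"] assms by auto
  define e where "e = cnorm A (x \<ominus> y) / (2 * (\<bar>C\<bar> + 1))"
  have e: "e > 0" using n by (simp add: e_def)
  have "cnorm A (x \<ominus> y) \<le> C * e" using assms(3) e by blast
  also have "\<dots> \<le> (\<bar>C\<bar> + 1) * e" using e by (intro mult_right_mono) auto
  also have "\<dots> = cnorm A (x \<ominus> y) / 2"
    unfolding e_def by (simp add: field_simps add_eq_0_iff)
  finally show False using n by simp
qed

lemma contraction_fixed_point:
  assumes "S \<subseteq> carrier A" "S \<noteq> {}"
    and closed: "\<And>l. \<lbrakk>l \<in> carrier A; \<And>e. e > 0 \<Longrightarrow> \<exists>x\<in>S. cnorm A (l \<ominus> x) < e\<rbrakk> \<Longrightarrow> l \<in> S"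
    and fS: "\<And>x. x \<in> S \<Longrightarrow> f x \<in> S" and k: "0 \<le> k" "k < 1"
    and contr: "\<And>x y. \<lbrakk>x \<in> S; y \<in> S\<rbrakk> \<Longrightarrow> cnorm A (f x \<ominus> f y) \<le> k * cnorm A (x \<ominus> y)"
  obtains x where "x \<in> S" "f x = x"
proof -
  interpret Metric_space "carrier A" "cdist A" by (rule Metric_space_cdist)
  have cd: "cdist A x y = cnorm A (x \<ominus> y)" if "x \<in> carrier A" "y \<in> carrier A" for x y
    using that by (simp add: cdist_def)
  show ?thesis
  proof (rule contraction_fixed_point[OF complete assms(1,2), of f k])
    show "l \<in> S" if "l \<in> carrier A" "\<And>e. e > 0 \<Longrightarrow> \<exists>x\<in>S. cdist A l x < e" for l
    proof (rule closed[OF that(1)])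
      fix e :: real assume "e > 0"
      from that(2)[OF this] show "\<exists>x\<in>S. cnorm A (l \<ominus> x) < e"
        using cd that(1) assms(1) by (metis subsetD)
    qed
    show "cdist A (f x) (f y) \<le> k * cdist A x y" if "x \<in> S" "y \<in> S" for x y
      using contr[OF that] that assms(1) fS cd by (metis subsetD)
  qed (use fS k that in auto)
qed

text \<open>
  A fragment of the continuous functional calculus. With \<open>s = 1 - y\<close> the equation \<open>s\<^sup>2 = 1 - h\<close>
  reads \<open>y = (h + y\<^sup>2) / 2\<close>, and the right-hand side is a contraction of the ball of
  radius \<open>1 - sqrt (1 - \<parallel>h\<parallel>)\<close>. Since the commutation relations define a closed subset, the
  fixed point also inherits everything that \<open>h\<close> commutes with.
\<close>

lemma sqrt_one_minus:
  assumes h: "h \<in> carrier A" "adj A h = h" "cnorm A h < 1"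
  obtains s where "s \<in> carrier A" "adj A s = s" "s \<otimes> s = \<one> \<ominus> h"
    "\<And>z. \<lbrakk>z \<in> carrier A; z \<otimes> h = h \<otimes> z\<rbrakk> \<Longrightarrow> z \<otimes> s = s \<otimes> z"
proof -
  \<comment> \<open>The smaller root of \<open>q = (\<parallel>h\<parallel> + q\<^sup>2) / 2\<close>, so that \<open>f\<close> below preserves the ball of radius \<open>q\<close>.\<close>
  define q where "q = 1 - sqrt (1 - cnorm A h)"
  have h0: "0 \<le> cnorm A h" using h cnorm_nonneg by blast
  have q: "0 \<le> q" "q < 1" using h h0 by (auto simp: q_def)
  have qeq: "(cnorm A h + q * q) / 2 = q"
    using h(3) by (simp add: q_def algebra_simps)
  define S where "S = {y \<in> carrier A. cnorm A y \<le> q \<and> adj A y = y \<and>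
      (\<forall>z\<in>carrier A. z \<otimes> h = h \<otimes> z \<longrightarrow> z \<otimes> y = y \<otimes> z)}"
  define f where "f y = (1/2) \<odot> (h \<oplus> y \<otimes> y)" for y
  have SA: "S \<subseteq> carrier A" by (auto simp: S_def)
  have "\<zero> \<in> S" using q by (simp add: S_def)
  have closed: "l \<in> S"
    if l: "l \<in> carrier A" and near: "\<And>e. e > 0 \<Longrightarrow> \<exists>x\<in>S. cnorm A (l \<ominus> x) < e" for l
  proof -
    have "cnorm A l \<le> q"
    proof (rule field_le_epsilon)
      fix e :: real assume "e > 0"
      then obtain x where x: "x \<in> S" "cnorm A (l \<ominus> x) < e" using near by blast
      then have "cnorm A ((l \<ominus> x) \<oplus> x) \<le> e + q"
        using cnorm_triangle[of "l \<ominus> x" x] l by (auto simp: S_def)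
      moreover have "(l \<ominus> x) \<oplus> x = l" using x l SA by (auto simp: A.ring_simprules)
      ultimately show "cnorm A l \<le> q + e" by simp
    qed
    moreover have "adj A l = l"
    proof (rule eq_if_cnorm_diff_small[where C = 2])
      fix e :: real assume "e > 0"
      then obtain x where x: "x \<in> S" "cnorm A (l \<ominus> x) < e" using near by blast
      then have xA: "x \<in> carrier A" "adj A x = x" by (auto simp: S_def)
      have "cnorm A (adj A l \<ominus> x) = cnorm A (l \<ominus> x)"
        using cnorm_adj[of "l \<ominus> x"] l xA by (simp add: adj_diff)
      then show "cnorm A (adj A l \<ominus> l) \<le> 2 * e"
        using cnorm_diff_triangle[of "adj A l" x l] cnorm_diff_commute[of x l] l xA x(2) by simp
    qed (use l in auto)
    moreover have "z \<otimes> l = l \<otimes> z" if z: "z \<in> carrier A" "z \<otimes> h = h \<otimes> z" for z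
    proof (rule eq_if_cnorm_diff_small[where C = "2 * cnorm A z"])
      fix e :: real assume "e > 0"
      then obtain x where x: "x \<in> S" "cnorm A (l \<ominus> x) < e" using near by blast
      then have xA: "x \<in> carrier A" "z \<otimes> x = x \<otimes> z" using z by (auto simp: S_def)
      have eq: "z \<otimes> l \<ominus> l \<otimes> z = z \<otimes> (l \<ominus> x) \<ominus> (l \<ominus> x) \<otimes> z"
        using xA l z by (simp add: A.ring_simprules add_cancel)
      have "cnorm A (z \<otimes> (l \<ominus> x)) \<le> cnorm A z * e" "cnorm A ((l \<ominus> x) \<otimes> z) \<le> cnorm A z * e"
        using cnorm_mult[of z "l \<ominus> x"] cnorm_mult[of "l \<ominus> x" z] x(2) l z xA
          mult_left_mono[of "cnorm A (l \<ominus> x)" e "cnorm A z"] cnorm_nonneg[of z]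
        by (auto simp: mult.commute)
      then show "cnorm A (z \<otimes> l \<ominus> l \<otimes> z) \<le> 2 * cnorm A z * e"
        unfolding eq using cnorm_diff_le[of "z \<otimes> (l \<ominus> x)" "(l \<ominus> x) \<otimes> z"] l z xA by simp
    qed (use l z in auto)
    ultimately show ?thesis using l by (simp add: S_def)
  qed
  have fS: "f y \<in> S" if y: "y \<in> S" for y
  proof -
    have yA: "y \<in> carrier A" "cnorm A y \<le> q" "adj A y = y" using y by (auto simp: S_def)
    have "cnorm A (h \<oplus> y \<otimes> y) \<le> cnorm A h + q * q"
      using cnorm_triangle[of h "y \<otimes> y"] cnorm_mult[of y y] yA h
        mult_mono[of "cnorm A y" q "cnorm A y" q] cnorm_nonneg[of y] q by fastforce
    then have "cnorm A (f y) \<le> q"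
      using yA h qeq by (simp add: f_def cnorm_smult)
    moreover have "adj A (f y) = f y" using yA h by (simp add: f_def adj_simps)
    moreover have "z \<otimes> f y = f y \<otimes> z" if z: "z \<in> carrier A" "z \<otimes> h = h \<otimes> z" for z
    proof -
      have "z \<otimes> y = y \<otimes> z" using y z by (auto simp: S_def)
      then have "z \<otimes> (y \<otimes> y) = (y \<otimes> y) \<otimes> z"
        using yA z by (metis A.m_assoc)
      then show ?thesis using yA z h
        by (simp add: f_def smult_simps A.l_distr A.r_distr)
    qed
    ultimately show ?thesis using yA h by (simp add: S_def f_def)
  qed
  have contr: "cnorm A (f x \<ominus> f y) \<le> q * cnorm A (x \<ominus> y)" if x: "x \<in> S" and y: "y \<in> S" for x y
  proof -
    have xy: "x \<in> carrier A" "y \<in> carrier A" "cnorm A x \<le> q" "cnorm A y \<le> q"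
      using x y by (auto simp: S_def)
    have "x \<otimes> x \<ominus> y \<otimes> y = (1/2) \<odot> ((x \<otimes> x \<ominus> y \<otimes> y) \<oplus> (x \<otimes> x \<ominus> y \<otimes> y))"
      using smult_add_left[of "x \<otimes> x \<ominus> y \<otimes> y" "1/2" "1/2"] xy by (simp add: smult_add_right)
    also have "(x \<otimes> x \<ominus> y \<otimes> y) \<oplus> (x \<otimes> x \<ominus> y \<otimes> y)
        = (x \<ominus> y) \<otimes> (x \<oplus> y) \<oplus> (x \<oplus> y) \<otimes> (x \<ominus> y)"
      using xy by (simp add: A.ring_simprules)
    finally have "f x \<ominus> f y = (1/4) \<odot> ((x \<ominus> y) \<otimes> (x \<oplus> y) \<oplus> (x \<oplus> y) \<otimes> (x \<ominus> y))"
    proof -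
      assume *: "x \<otimes> x \<ominus> y \<otimes> y =
        (1/2) \<odot> ((x \<ominus> y) \<otimes> (x \<oplus> y) \<oplus> (x \<oplus> y) \<otimes> (x \<ominus> y))"
      have "f x \<ominus> f y = (1/2) \<odot> ((h \<oplus> x \<otimes> x) \<ominus> (h \<oplus> y \<otimes> y))"
        using xy h by (simp add: f_def smult_diff_right)
      also have "(h \<oplus> x \<otimes> x) \<ominus> (h \<oplus> y \<otimes> y) = x \<otimes> x \<ominus> y \<otimes> y"
        using xy h by (simp add: A.ring_simprules)
      finally show ?thesis unfolding * using xy by (simp add: smult_smult)
    qed
    moreover have "cnorm A ((x \<ominus> y) \<otimes> (x \<oplus> y)) \<le> cnorm A (x \<ominus> y) * (2 * q)"
      using cnorm_mult[of "x \<ominus> y" "x \<oplus> y"] cnorm_triangle[of x y] xy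
        mult_left_mono[of "cnorm A (x \<oplus> y)" "2 * q" "cnorm A (x \<ominus> y)"] cnorm_nonneg[of "x \<ominus> y"]
      by simp
    moreover have "cnorm A ((x \<oplus> y) \<otimes> (x \<ominus> y)) \<le> cnorm A (x \<ominus> y) * (2 * q)"
      using cnorm_mult[of "x \<oplus> y" "x \<ominus> y"] cnorm_triangle[of x y] xy
        mult_left_mono[of "cnorm A (x \<oplus> y)" "2 * q" "cnorm A (x \<ominus> y)"] cnorm_nonneg[of "x \<ominus> y"]
      by (simp add: mult.commute)
    ultimately show ?thesis
      using cnorm_triangle[of "(x \<ominus> y) \<otimes> (x \<oplus> y)" "(x \<oplus> y) \<otimes> (x \<ominus> y)"] xy
      by (simp add: cnorm_smult norm_divide mult_ac)
  qed
  obtain y where y: "y \<in> S" "f y = y"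
    using contraction_fixed_point[OF SA _ closed fS q contr] \<open>\<zero> \<in> S\<close> by blast
  then have yA: "y \<in> carrier A" "adj A y = y" by (auto simp: S_def)
  define s where "s = \<one> \<ominus> y"
  have yy: "y \<oplus> y = h \<oplus> y \<otimes> y"
  proof -
    have "y \<oplus> y = 2 \<odot> y" using smult_add_left[of y 1 1] yA by simp
    also have "\<dots> = 2 \<odot> f y" using y by simp
    also have "\<dots> = h \<oplus> y \<otimes> y" using yA h by (simp add: f_def smult_smult)
    finally show ?thesis .
  qed
  have "s \<otimes> s = \<one> \<ominus> (y \<oplus> y) \<oplus> y \<otimes> y"
    using yA by (simp add: s_def A.ring_simprules)
  also have "\<dots> = \<one> \<ominus> h" unfolding yy using yA h by (simp add: A.ring_simprules)
  finally have ss: "s \<otimes> s = \<one> \<ominus> h" .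
  show ?thesis
  proof
    show "s \<in> carrier A" "adj A s = s" using yA by (auto simp: s_def adj_simps)
    show "z \<otimes> s = s \<otimes> z" if "z \<in> carrier A" "z \<otimes> h = h \<otimes> z" for z
    proof -
      have "z \<otimes> y = y \<otimes> z" using y that by (auto simp: S_def)
      then show ?thesis using that yA by (simp add: s_def A.ring_simprules)
    qed
  qed (rule ss)
qed

text \<open>The Neumann series, again as a fixed point.\<close>

lemma one_minus_Units:
  assumes h: "h \<in> carrier A" "cnorm A h < 1"
  shows "\<one> \<ominus> h \<in> Units A"
proof -
  have h0: "0 \<le> cnorm A h" using h cnorm_nonneg by blast
  obtain x where x: "x \<in> carrier A" "\<one> \<oplus> h \<otimes> x = x"
  proof (rule contraction_fixed_point[of "carrier A" "\<lambda>x. \<one> \<oplus> h \<otimes> x" "cnorm A h"])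
    fix x y assume xy: "x \<in> carrier A" "y \<in> carrier A"
    have "(\<one> \<oplus> h \<otimes> x) \<ominus> (\<one> \<oplus> h \<otimes> y) = h \<otimes> (x \<ominus> y)"
      using xy h by (simp add: A.ring_simprules add_cancel)
    then show "cnorm A ((\<one> \<oplus> h \<otimes> x) \<ominus> (\<one> \<oplus> h \<otimes> y)) \<le> cnorm A h * cnorm A (x \<ominus> y)"
      using cnorm_mult[of h "x \<ominus> y"] xy h by simp
  qed (use h h0 in auto)
  obtain y where y: "y \<in> carrier A" "\<one> \<oplus> y \<otimes> h = y"
  proof (rule contraction_fixed_point[of "carrier A" "\<lambda>y. \<one> \<oplus> y \<otimes> h" "cnorm A h"])
    fix x y assume xy: "x \<in> carrier A" "y \<in> carrier A"
    have "(\<one> \<oplus> x \<otimes> h) \<ominus> (\<one> \<oplus> y \<otimes> h) = (x \<ominus> y) \<otimes> h"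
      using xy h by (simp add: A.ring_simprules add_cancel)
    then show "cnorm A ((\<one> \<oplus> x \<otimes> h) \<ominus> (\<one> \<oplus> y \<otimes> h)) \<le> cnorm A h * cnorm A (x \<ominus> y)"
      using cnorm_mult[of "x \<ominus> y" h] xy h by (simp add: mult.commute)
  qed (use h h0 in auto)
  have 1: "(\<one> \<ominus> h) \<otimes> x = \<one>"
  proof -
    have "(\<one> \<ominus> h) \<otimes> x = x \<ominus> h \<otimes> x" using x h by (simp add: A.ring_simprules)
    also have "\<dots> = (\<one> \<oplus> h \<otimes> x) \<ominus> h \<otimes> x" using x by simp
    also have "\<dots> = \<one>" using x(1) h by (simp add: A.ring_simprules)
    finally show ?thesis .
  qed
  have 2: "y \<otimes> (\<one> \<ominus> h) = \<one>"
  proof -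
    have "y \<otimes> (\<one> \<ominus> h) = y \<ominus> y \<otimes> h" using y h by (simp add: A.ring_simprules)
    also have "\<dots> = (\<one> \<oplus> y \<otimes> h) \<ominus> y \<otimes> h" using y by simp
    also have "\<dots> = \<one>" using y(1) h by (simp add: A.ring_simprules)
    finally show ?thesis .
  qed
  have "y = y \<otimes> ((\<one> \<ominus> h) \<otimes> x)" using 1 y by simp
  also have "\<dots> = (y \<otimes> (\<one> \<ominus> h)) \<otimes> x" using x(1) y(1) h(1) by (simp only: A.m_assoc A.minus_closed A.one_closed)
  also have "\<dots> = x" using 2 x by simp
  finally have "y = x" .
  then show ?thesis using 1 2 x h by (auto simp: Units_def)
qed

lemma smult_Units: "\<lbrakk>x \<in> Units A; c \<noteq> 0\<rbrakk> \<Longrightarrow> c \<odot> x \<in> Units A"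
proof -
  assume x: "x \<in> Units A" and c: "c \<noteq> 0"
  then obtain y where y: "x \<in> carrier A" "y \<in> carrier A" "y \<otimes> x = \<one>" "x \<otimes> y = \<one>"
    by (auto simp: Units_def)
  have "((1/c) \<odot> y) \<otimes> (c \<odot> x) = \<one>" "(c \<odot> x) \<otimes> ((1/c) \<odot> y) = \<one>"
    using y c by (simp_all add: smult_simps)
  then show ?thesis using y unfolding Units_def by auto
qed

lemma smult_one_diff_Units:
  assumes h: "h \<in> carrier A" "cnorm A h < cmod c"
  shows "c \<odot> \<one> \<ominus> h \<in> Units A"
proof -
  have c: "c \<noteq> 0" using h cnorm_nonneg[of h] by auto
  have "cnorm A ((1/c) \<odot> h) < 1"
    using h c by (simp add: cnorm_smult norm_divide field_simps)
  then have "c \<odot> (\<one> \<ominus> (1/c) \<odot> h) \<in> Units A"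
    using one_minus_Units h smult_Units c by auto
  then show ?thesis using h c by (simp add: smult_diff_right smult_smult)
qed

text \<open>
  By the C*-identity \<open>\<parallel>u \<plusminus> \<i> v\<parallel>\<^sup>2 = \<parallel>u\<^sup>2 + v\<^sup>2\<parallel>\<close>, and \<open>u\<close> is the mean of \<open>u + \<i> v\<close> and
  \<open>u - \<i> v\<close>.
\<close>

lemma cnorm_square_le_sum:
  assumes u: "u \<in> carrier A" "adj A u = u" and v: "v \<in> carrier A" "adj A v = v"
    and comm: "u \<otimes> v = v \<otimes> u"
  shows "cnorm A (u \<otimes> u) \<le> cnorm A (u \<otimes> u \<oplus> v \<otimes> v)"
proof -
  define N where "N = cnorm A (u \<otimes> u \<oplus> v \<otimes> v)"
  have N: "(cnorm A (u \<oplus> c \<odot> v))\<^sup>2 = N" if c: "c = \<i> \<or> c = - \<i>" for c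
  proof -
    have cc: "cnj c * c = 1" "c * c = - 1" "cnj c = - c" using c by auto
    have "adj A (u \<oplus> c \<odot> v) \<otimes> (u \<oplus> c \<odot> v) = (u \<oplus> cnj c \<odot> v) \<otimes> (u \<oplus> c \<odot> v)"
      using u v by (simp add: adj_simps)
    also have "\<dots> = u \<otimes> u \<oplus> c \<odot> (u \<otimes> v) \<oplus> (cnj c \<odot> (v \<otimes> u) \<oplus> (cnj c * c) \<odot> (v \<otimes> v))"
      using u v by (simp add: A.l_distr A.r_distr smult_simps smult_add_right A.a_ac mult.commute)
    also have "\<dots> = u \<otimes> u \<oplus> v \<otimes> v"
      using u v unfolding cc(1) comm unfolding cc(3) by (simp add: smult_minus_left A.ring_simprules)
    finally show ?thesis using cstar_identity[of "u \<oplus> c \<odot> v"] u v by (simp add: N_def)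
  qed
  have N0: "N \<ge> 0" using u v by (simp add: N_def cnorm_nonneg)
  have "cnorm A (u \<oplus> \<i> \<odot> v) = sqrt N" "cnorm A (u \<oplus> (-\<i>) \<odot> v) = sqrt N"
    using N[of \<i>] N[of "-\<i>"] u v by (auto simp: real_sqrt_unique cnorm_nonneg)
  moreover have "2 \<odot> u = (u \<oplus> \<i> \<odot> v) \<oplus> (u \<oplus> (-\<i>) \<odot> v)"
    using u v smult_add_left[of u 1 1] by (simp add: smult_minus_left A.ring_simprules)
  ultimately have "2 * cnorm A u \<le> sqrt N + sqrt N"
    using cnorm_triangle[of "u \<oplus> \<i> \<odot> v" "u \<oplus> (-\<i>) \<odot> v"] cnorm_smult[of u 2] u v by simp
  then have "cnorm A u \<le> sqrt N" by simp
  then have "(cnorm A u)\<^sup>2 \<le> N" using cnorm_nonneg[OF u(1)] N0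
    by (metis power_mono real_sqrt_pow2)
  then show ?thesis using cnorm_sq[OF u] by (simp add: N_def)
qed

text \<open>With \<open>s\<^sup>2 = 1 - z\<^sup>2\<close> this is \<open>\<parallel>s\<^sup>2\<parallel> \<le> \<parallel>s\<^sup>2 + z\<^sup>2\<parallel>\<close>.\<close>

lemma cnorm_one_minus_square_le:
  assumes z: "z \<in> carrier A" "adj A z = z" "cnorm A z < 1"
  shows "cnorm A (\<one> \<ominus> z \<otimes> z) \<le> 1"
proof -
  have "cnorm A (z \<otimes> z) < 1"
    using cnorm_sq[OF z(1,2)] z cnorm_nonneg[OF z(1)] by (simp add: power_less_one_iff)
  moreover have "z \<otimes> z \<in> carrier A" "adj A (z \<otimes> z) = z \<otimes> z" using z by (auto simp: adj_simps)
  ultimately obtain s where s: "s \<in> carrier A" "adj A s = s" "s \<otimes> s = \<one> \<ominus> z \<otimes> z"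
     "\<And>x. \<lbrakk>x \<in> carrier A; x \<otimes> (z \<otimes> z) = (z \<otimes> z) \<otimes> x\<rbrakk> \<Longrightarrow> x \<otimes> s = s \<otimes> x"
    using sqrt_one_minus[of "z \<otimes> z"] by metis
  have "s \<otimes> z = z \<otimes> s" using s(4)[OF z(1)] z by (simp add: A.m_assoc)
  then have "cnorm A (s \<otimes> s) \<le> cnorm A (s \<otimes> s \<oplus> z \<otimes> z)"
    using s(1-3) z(1,2) by (intro cnorm_square_le_sum) auto
  also have "s \<otimes> s \<oplus> z \<otimes> z = \<one>" using s(1-3) z(1,2) by (simp add: A.ring_simprules)
  finally show ?thesis using s(3) cnorm_one_le by simp
qed

text \<open>
  For \<open>r > \<parallel>x\<parallel>\<close> the element \<open>r\<^sup>2 - x\<^sup>2\<close> has norm at most \<open>r\<^sup>2\<close>, so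
  \<open>b + x\<^sup>2 = (r\<^sup>2 + b) - (r\<^sup>2 - x\<^sup>2)\<close> is within reach of the Neumann series.
\<close>

lemma square_plus_pos_Units:
  assumes x: "x \<in> carrier A" "adj A x = x" and b: "b > 0"
  shows "complex_of_real b \<odot> \<one> \<oplus> x \<otimes> x \<in> Units A"
proof -
  define r where "r = cnorm A x + 1"
  have r: "r > 0" using cnorm_nonneg[OF x(1)] by (simp add: r_def)
  define z where "z = complex_of_real (1/r) \<odot> x"
  have z: "z \<in> carrier A" "adj A z = z" using x by (auto simp: z_def adj_simps)
  have "cnorm A z < 1" using r x by (simp add: z_def cnorm_smult norm_divide r_def)
  then have "cnorm A (\<one> \<ominus> z \<otimes> z) \<le> 1" using cnorm_one_minus_square_le z by blast
  define w where "w = complex_of_real (r^2) \<odot> (\<one> \<ominus> z \<otimes> z)"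
  have w: "w \<in> carrier A" "cnorm A w \<le> r^2"
    using \<open>cnorm A (\<one> \<ominus> z \<otimes> z) \<le> 1\<close> z r mult_left_mono[of "cnorm A (\<one> \<ominus> z \<otimes> z)" 1 "r^2"]
    by (auto simp: w_def cnorm_smult norm_power)
  have "complex_of_real (r^2 + b) \<odot> \<one> \<ominus> w \<in> Units A"
    by (rule smult_one_diff_Units) (use w b in \<open>auto simp del: of_real_add of_real_power\<close>)
  also have "complex_of_real (r^2 + b) \<odot> \<one> \<ominus> w = complex_of_real b \<odot> \<one> \<oplus> x \<otimes> x"
  proof -
    have zz: "complex_of_real (r^2) \<odot> (z \<otimes> z) = x \<otimes> x"
      using x r by (simp add: z_def smult_simps power2_eq_square)
    have w': "w = complex_of_real (r^2) \<odot> \<one> \<ominus> x \<otimes> x"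
      unfolding w_def zz[symmetric] using z by (intro smult_diff_right) auto
    have "complex_of_real (r^2 + b) \<odot> \<one> = complex_of_real (r^2) \<odot> \<one> \<oplus> complex_of_real b \<odot> \<one>"
      by (simp add: smult_add_left)
    then show ?thesis unfolding w' using x by (simp only: A.ring_simprules smult_closed' A.one_closed)
  qed
  finally show ?thesis .
qed

lemma Units_inverse_commutes:
  assumes "d \<in> carrier A" "e \<in> carrier A" "e \<otimes> d = \<one>" "d \<otimes> e = \<one>" "x \<in> carrier A" "x \<otimes> d = d \<otimes> x"
  shows "x \<otimes> e = e \<otimes> x"
proof -
  have "x \<otimes> e = (e \<otimes> d) \<otimes> (x \<otimes> e)" using assms(1-5) by simp
  also have "\<dots> = e \<otimes> ((d \<otimes> x) \<otimes> e)" using assms(1,2,5) by (simp add: A.m_assoc)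
  also have "\<dots> = e \<otimes> ((x \<otimes> d) \<otimes> e)" by (simp only: assms(6))
  also have "\<dots> = e \<otimes> (x \<otimes> (d \<otimes> e))" using assms(1,2,5) by (simp only: A.m_assoc A.m_closed)
  also have "\<dots> = e \<otimes> x" using assms(1-5) by simp
  finally show ?thesis .
qed

text \<open>
  If \<open>1 - z\<^sup>2\<close> had an inverse \<open>e\<close>, and \<open>C\<close> were a bound on its norm, then multiplying the
  positive element \<open>C - e\<close> by \<open>1 - z\<^sup>2\<close> would give \<open>z\<^sup>2 \<le> 1 - 1 / C\<close>, contradicting
  \<open>\<parallel>z\<^sup>2\<parallel> = 1\<close>. So the spectrum of \<open>z\<close> contains \<open>1\<close> or \<open>-1\<close>. As
  square roots are available only strictly inside the unit ball, \<open>1 - z\<^sup>2\<close> is replaced by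
  \<open>1 - r z\<^sup>2\<close> with \<open>r = 1 - t\<close> close to \<open>1\<close>.
\<close>

lemma one_minus_square_not_Units:
  assumes z: "z \<in> carrier A" "adj A z = z" "cnorm A z = 1"
  shows "\<one> \<ominus> z \<otimes> z \<notin> Units A"
proof
  define w where "w = z \<otimes> z"
  have w: "w \<in> carrier A" "adj A w = w" "cnorm A w = 1"
    using z cnorm_sq[OF z(1,2)] by (auto simp: w_def adj_simps)
  assume "\<one> \<ominus> z \<otimes> z \<in> Units A"
  then obtain e where e: "e \<in> carrier A" "e \<otimes> (\<one> \<ominus> w) = \<one>" "(\<one> \<ominus> w) \<otimes> e = \<one>"
    by (auto simp: Units_def w_def)
  have ae: "adj A e = e"
  proof -
    have "adj A ((\<one> \<ominus> w) \<otimes> e) = adj A e \<otimes> (\<one> \<ominus> w)"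
      using adj_mult[of "\<one> \<ominus> w" e] e(1) w by (simp add: adj_diff)
    then have 1: "adj A e \<otimes> (\<one> \<ominus> w) = \<one>" unfolding e(3) by simp
    have "adj A e = (adj A e \<otimes> (\<one> \<ominus> w)) \<otimes> e"
      using e(1,3) w(1) by (simp add: A.m_assoc)
    then show ?thesis using 1 e by simp
  qed
  have "z \<otimes> (\<one> \<ominus> w) = (\<one> \<ominus> w) \<otimes> z" using z by (simp add: w_def A.ring_simprules)
  then have ze: "z \<otimes> e = e \<otimes> z"
    using Units_inverse_commutes[of "\<one> \<ominus> w" e z] e w z by simp
  have "w \<otimes> (\<one> \<ominus> w) = (\<one> \<ominus> w) \<otimes> w" using w by (simp add: A.ring_simprules)
  then have we: "w \<otimes> e = e \<otimes> w"
    using Units_inverse_commutes[of "\<one> \<ominus> w" e w] e w by simp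
  \<comment> \<open>The added \<open>1\<close> makes \<open>C - e\<close> a square; \<open>t\<close> is small enough for \<open>t C < 1/2\<close>.\<close>
  define C where "C = cnorm A e + 1"
  have C: "C \<ge> 1" using cnorm_nonneg[OF e(1)] by (simp add: C_def)
  define t where "t = 1 / (4 * C)"
  have t: "0 < t" "t \<le> 1/4" "t * C = 1/4" using C by (auto simp: t_def field_simps)
  define r where "r = 1 - t"
  have r: "0 < r" "r < 1" using t by (auto simp: r_def)
  have "complex_of_real (1/C) \<odot> e \<in> carrier A"
    "adj A (complex_of_real (1/C) \<odot> e) = complex_of_real (1/C) \<odot> e"
    "cnorm A (complex_of_real (1/C) \<odot> e) < 1"
    using e(1) ae C by (auto simp: adj_simps cnorm_smult norm_divide C_def)
  from sqrt_one_minus[OF this] obtain u where u: "u \<in> carrier A" "adj A u = u"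
      "u \<otimes> u = \<one> \<ominus> complex_of_real (1/C) \<odot> e"
    and u_comm: "\<And>x. \<lbrakk>x \<in> carrier A; x \<otimes> (complex_of_real (1/C) \<odot> e) = (complex_of_real (1/C) \<odot> e) \<otimes> x\<rbrakk>
      \<Longrightarrow> x \<otimes> u = u \<otimes> x" by metis
  have "complex_of_real r \<odot> w \<in> carrier A" "adj A (complex_of_real r \<odot> w) = complex_of_real r \<odot> w"
    "cnorm A (complex_of_real r \<odot> w) < 1"
    using w r by (auto simp: adj_simps cnorm_smult)
  from sqrt_one_minus[OF this] obtain s where s: "s \<in> carrier A" "adj A s = s"
      "s \<otimes> s = \<one> \<ominus> complex_of_real r \<odot> w"
    and s_comm: "\<And>x. \<lbrakk>x \<in> carrier A; x \<otimes> (complex_of_real r \<odot> w) = (complex_of_real r \<odot> w) \<otimes> x\<rbrakk>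
      \<Longrightarrow> x \<otimes> s = s \<otimes> x" by metis
  have zu: "z \<otimes> u = u \<otimes> z"
    by (rule u_comm) (use z e(1) ze in \<open>auto simp: smult_simps\<close>)
  have zs: "z \<otimes> s = s \<otimes> z"
    by (rule s_comm) (use z w in \<open>auto simp: smult_simps w_def A.m_assoc\<close>)
  have es: "e \<otimes> s = s \<otimes> e"
    by (rule s_comm) (use e(1) w(1) we in \<open>auto simp: smult_simps\<close>)
  have su: "s \<otimes> u = u \<otimes> s"
    by (rule u_comm) (use e(1) s(1) es in \<open>auto simp: smult_simps\<close>)
  \<comment> \<open>Up to the factor \<open>C\<close>, \<open>y\<^sup>2\<close> and \<open>v\<^sup>2\<close> are \<open>r z\<^sup>2\<close> and \<open>(1 - r z\<^sup>2) (1 - e / C)\<close>.\<close>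
  define v where "v = complex_of_real (sqrt C) \<odot> (s \<otimes> u)"
  define y where "y = complex_of_real (sqrt (r * C)) \<odot> z"
  have v: "v \<in> carrier A" "adj A v = v" using s u su by (auto simp: v_def adj_simps)
  have y: "y \<in> carrier A" "adj A y = y" using z by (auto simp: y_def adj_simps)
  have "z \<otimes> (s \<otimes> u) = (s \<otimes> u) \<otimes> z"
    using z(1) s(1) u(1) zs zu by (metis A.m_assoc)
  then have yv: "y \<otimes> v = v \<otimes> y"
    using z(1) s(1) u(1) by (simp add: y_def v_def smult_simps mult.commute)
  have yy: "y \<otimes> y = complex_of_real (r * C) \<odot> w"
    using z r C by (simp add: y_def w_def smult_simps del: of_real_mult flip: of_real_mult)
  have "(s \<otimes> u) \<otimes> (s \<otimes> u) = (s \<otimes> s) \<otimes> (u \<otimes> u)"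
    using s(1) u(1) su by (metis A.m_assoc A.m_closed)
  then have "v \<otimes> v = complex_of_real C \<odot> ((s \<otimes> s) \<otimes> (u \<otimes> u))"
    using s(1) u(1) C by (simp add: v_def smult_simps del: of_real_mult flip: of_real_mult)
  also have "\<dots> = (\<one> \<ominus> complex_of_real r \<odot> w) \<otimes> (complex_of_real C \<odot> (\<one> \<ominus> complex_of_real (1/C) \<odot> e))"
    unfolding s(3) u(3) using e(1) w(1) by (simp add: smult_simps)
  also have "complex_of_real C \<odot> (\<one> \<ominus> complex_of_real (1/C) \<odot> e) = complex_of_real C \<odot> \<one> \<ominus> e"
    using e(1) C by (simp add: smult_diff_right smult_smult)
  finally have vv: "v \<otimes> v = (\<one> \<ominus> complex_of_real r \<odot> w) \<otimes> (complex_of_real C \<odot> \<one> \<ominus> e)" .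
  have we1: "w \<otimes> e = e \<ominus> \<one>"
  proof -
    have "e \<ominus> w \<otimes> e = \<one>" using e(1,3) w(1) by (simp add: A.ring_simprules)
    then show ?thesis using e(1) w(1)
      by (smt (verit) A.add.inv_solve_right A.m_closed A.minus_eq A.one_closed a_comm A.add.inv_closed A.add.m_comm A.minus_minus A.r_neg1)
  qed
  have sum: "y \<otimes> y \<oplus> v \<otimes> v = complex_of_real (C - r) \<odot> \<one> \<ominus> complex_of_real t \<odot> e"
  proof -
    have "v \<otimes> v = complex_of_real C \<odot> \<one> \<ominus> e
        \<ominus> (complex_of_real (r * C) \<odot> w \<ominus> complex_of_real r \<odot> (w \<otimes> e))"
      unfolding vv using e(1) w(1)
      by (simp add: smult_simps smult_add_right smult_minus_right smult_minus_left A.ring_simprules mult.commute)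
    then have "y \<otimes> y \<oplus> v \<otimes> v = complex_of_real C \<odot> \<one> \<ominus> e \<oplus> complex_of_real r \<odot> (w \<otimes> e)"
      unfolding yy using e(1) w(1)
      by (simp add: A.ring_simprules add_cancel)
    also have "\<dots> = (complex_of_real C \<odot> \<one> \<ominus> complex_of_real r \<odot> \<one>) \<ominus> (1 \<odot> e \<ominus> complex_of_real r \<odot> e)"
      unfolding we1 using e(1)
      by (simp add: smult_add_right smult_minus_right smult_minus_left A.ring_simprules add_cancel)
    also have "\<dots> = complex_of_real (C - r) \<odot> \<one> \<ominus> complex_of_real t \<odot> e"
      using e(1) smult_diff_left[of e 1 "complex_of_real r"]
        smult_diff_left[of \<one> "complex_of_real C" "complex_of_real r"]
      by (simp add: r_def)
    finally show ?thesis .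
  qed
  have "cnorm A (complex_of_real (C - r) \<odot> \<one> \<ominus> complex_of_real t \<odot> e)
      \<le> cmod (complex_of_real (C - r)) + cmod (complex_of_real t) * cnorm A e"
    using cnorm_diff_le[of "complex_of_real (C - r) \<odot> \<one>" "complex_of_real t \<odot> e"]
      cnorm_smult_one_le[of "complex_of_real (C - r)"] e(1)
    by (simp add: cnorm_smult del: of_real_diff)
  moreover have "\<dots> = C - r + t * (C - 1)"
    using C r t by (simp add: C_def del: of_real_diff)
  moreover have "cnorm A (y \<otimes> y) = r * C"
    unfolding yy using w r C by (simp add: cnorm_smult del: of_real_mult)
  moreover have "cnorm A (y \<otimes> y) \<le> cnorm A (complex_of_real (C - r) \<odot> \<one> \<ominus> complex_of_real t \<odot> e)"
    using cnorm_square_le_sum[OF y v yv] unfolding sum .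
  ultimately have "r * C \<le> C - r + t * (C - 1)" by linarith
  then have "C - t * C \<le> C - 1 + t + t * C - t" by (simp add: r_def algebra_simps)
  then show False using t by simp
qed

end
section \<open>Positive functionals and the trace seminorm\<close>

definition positive_functional :: "'a cstar \<Rightarrow> ('a \<Rightarrow> complex) \<Rightarrow> bool"
  where "positive_functional A \<phi> \<longleftrightarrow>
    (\<forall>x\<in>carrier A. \<forall>y\<in>carrier A. \<phi> (x \<oplus>\<^bsub>A\<^esub> y) = \<phi> x + \<phi> y) \<and>
    (\<forall>c. \<forall>x\<in>carrier A. \<phi> (c \<odot>\<^bsub>A\<^esub> x) = c * \<phi> x) \<and>
    (\<forall>x\<in>carrier A. \<phi> (adj A x \<otimes>\<^bsub>A\<^esub> x) \<in> \<real>\<^sub>\<ge>\<^sub>0)"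

context unital_cstar_algebra
begin

context
  fixes \<phi> :: "'a \<Rightarrow> complex"
  assumes pos: "positive_functional A \<phi>"
begin

lemma pf_add: "\<lbrakk>x \<in> carrier A; y \<in> carrier A\<rbrakk> \<Longrightarrow> \<phi> (x \<oplus> y) = \<phi> x + \<phi> y"
  using pos by (simp add: positive_functional_def)

lemma pf_smult: "x \<in> carrier A \<Longrightarrow> \<phi> (c \<odot> x) = c * \<phi> x"
  using pos by (simp add: positive_functional_def)

lemma pf_zero: "\<phi> \<zero> = 0"
  using pf_smult[of \<zero> 0] by simp

lemma pf_uminus: "x \<in> carrier A \<Longrightarrow> \<phi> (\<ominus> x) = - \<phi> x"
  by (simp add: minus_eq_smult pf_smult)

lemma pf_diff: "\<lbrakk>x \<in> carrier A; y \<in> carrier A\<rbrakk> \<Longrightarrow> \<phi> (x \<ominus> y) = \<phi> x - \<phi> y"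
  by (simp add: a_minus_def pf_add pf_uminus)

lemma pf_square: "x \<in> carrier A \<Longrightarrow> \<phi> (adj A x \<otimes> x) \<in> \<real>\<^sub>\<ge>\<^sub>0"
  using pos by (simp add: positive_functional_def)

lemma pf_square_Re: "x \<in> carrier A \<Longrightarrow> 0 \<le> Re (\<phi> (adj A x \<otimes> x))"
  "x \<in> carrier A \<Longrightarrow> Im (\<phi> (adj A x \<otimes> x)) = 0"
  using pf_square[of x] by (auto simp: complex_nonneg_Reals_iff)

lemma pf_expand:
  assumes x: "x \<in> carrier A" and y: "y \<in> carrier A"
  shows "\<phi> (adj A (x \<oplus> c \<odot> y) \<otimes> (x \<oplus> c \<odot> y)) =
    \<phi> (adj A x \<otimes> x) + c * \<phi> (adj A x \<otimes> y) + cnj c * \<phi> (adj A y \<otimes> x) + (cnj c * c) * \<phi> (adj A y \<otimes> y)"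
proof -
  have "adj A (x \<oplus> c \<odot> y) \<otimes> (x \<oplus> c \<odot> y) =
      adj A x \<otimes> x \<oplus> c \<odot> (adj A x \<otimes> y) \<oplus> cnj c \<odot> (adj A y \<otimes> x) \<oplus> (cnj c * c) \<odot> (adj A y \<otimes> y)"
    using x y by (simp add: adj_simps A.l_distr A.r_distr smult_simps smult_add_right A.a_ac mult.commute)
  then show ?thesis using x y by (simp add: pf_add pf_smult)
qed

lemma pf_hermitian:
  assumes x: "x \<in> carrier A" and y: "y \<in> carrier A"
  shows "\<phi> (adj A y \<otimes> x) = cnj (\<phi> (adj A x \<otimes> y))"
proof -
  define a b where "a = \<phi> (adj A x \<otimes> y)" and "b = \<phi> (adj A y \<otimes> x)"
  have "Im (c * a + cnj c * b) = 0" for c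
    using pf_square_Re(2)[of "x \<oplus> c \<odot> y"] pf_square_Re(2)[OF x] pf_square_Re(2)[OF y] x y
    unfolding pf_expand[OF x y] by (simp add: a_def b_def)
  from this[of 1] this[of \<i>] show ?thesis by (simp add: complex_eq_iff a_def b_def)
qed

lemma pf_adj: "x \<in> carrier A \<Longrightarrow> \<phi> (adj A x) = cnj (\<phi> x)"
  using pf_hermitian[of \<one> x] by simp

lemma pf_Cauchy_Schwarz:
  assumes x: "x \<in> carrier A" and y: "y \<in> carrier A"
  shows "(cmod (\<phi> (adj A x \<otimes> y)))\<^sup>2 \<le> Re (\<phi> (adj A x \<otimes> x)) * Re (\<phi> (adj A y \<otimes> y))"
proof -
  define a where "a = \<phi> (adj A x \<otimes> y)"
  define p q where "p = Re (\<phi> (adj A x \<otimes> x))" and "q = Re (\<phi> (adj A y \<otimes> y))"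
  have pq: "p \<ge> 0" "q \<ge> 0" using pf_square_Re x y by (auto simp: p_def q_def)
  have main: "0 \<le> p - 2 * s * (cmod a)\<^sup>2 + s\<^sup>2 * (cmod a)\<^sup>2 * q" for s
  proof -
    \<comment> \<open>This phase makes both cross terms equal to \<open>- s \<bar>a\<bar>\<^sup>2\<close>.\<close>
    define c where "c = - complex_of_real s * cnj a"
    have ca: "Re (c * a) = - s * (cmod a)\<^sup>2" "Re (cnj c * cnj a) = - s * (cmod a)\<^sup>2"
      unfolding c_def cmod_power2 by (simp_all add: power2_eq_square algebra_simps)
    have cc: "cnj c * c = complex_of_real (s\<^sup>2 * (cmod a)\<^sup>2)"
      unfolding c_def of_real_mult complex_norm_square by (simp add: power2_eq_square mult_ac)
    have "0 \<le> Re (\<phi> (adj A (x \<oplus> c \<odot> y) \<otimes> (x \<oplus> c \<odot> y)))"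
      using pf_square_Re(1)[of "x \<oplus> c \<odot> y"] x y by simp
    also have "\<dots> = p + Re (c * a) + Re (cnj c * cnj a) + Re (cnj c * c * \<phi> (adj A y \<otimes> y))"
      unfolding pf_expand[OF x y] pf_hermitian[OF x y] by (simp add: a_def p_def)
    also have "Re (cnj c * c * \<phi> (adj A y \<otimes> y)) = s\<^sup>2 * (cmod a)\<^sup>2 * q"
      unfolding cc q_def by (simp del: of_real_mult of_real_power)
    finally show ?thesis unfolding ca by simp
  qed
  show ?thesis
  proof (cases "q = 0")
    case True
    have "(cmod a)\<^sup>2 = 0"
    proof (rule ccontr)
      assume "(cmod a)\<^sup>2 \<noteq> 0"
      then have "(cmod a)\<^sup>2 > 0" by simp
      then show False using main[of "(p + 1) / (2 * (cmod a)\<^sup>2)"] True by (simp add: field_simps)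
    qed
    then show ?thesis using pq True by (simp add: a_def p_def q_def)
  next
    case False
    then have q: "q > 0" using pq by simp
    have "0 \<le> p - (cmod a)\<^sup>2 / q"
      using main[of "1/q"] q by (simp add: field_simps power2_eq_square)
    then show ?thesis using q by (simp add: field_simps a_def p_def q_def)
  qed
qed

lemma pf_one_nonneg: "0 \<le> Re (\<phi> \<one>)" "Im (\<phi> \<one>) = 0"
  using pf_square_Re[of \<one>] by auto

text \<open>
  Boundedness comes from the square root: \<open>\<parallel>h\<parallel> + \<epsilon> - h\<close> is a square.
\<close>

lemma pf_self_adjoint_le:
  assumes h: "h \<in> carrier A" "adj A h = h"
  shows "Re (\<phi> h) \<le> cnorm A h * Re (\<phi> \<one>)"
proof -
  have "Re (\<phi> h) \<le> c * Re (\<phi> \<one>)" if c: "c > cnorm A h" for c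
  proof -
    have c0: "c > 0" using c cnorm_nonneg[OF h(1)] by linarith
    have "complex_of_real (1/c) \<odot> h \<in> carrier A"
        "adj A (complex_of_real (1/c) \<odot> h) = complex_of_real (1/c) \<odot> h"
        "cnorm A (complex_of_real (1/c) \<odot> h) < 1"
      using h c c0 by (auto simp: adj_simps cnorm_smult norm_divide)
    from sqrt_one_minus[OF this] obtain s where s: "s \<in> carrier A" "adj A s = s"
      "s \<otimes> s = \<one> \<ominus> complex_of_real (1/c) \<odot> h" by metis
    have "0 \<le> Re (\<phi> (\<one> \<ominus> complex_of_real (1/c) \<odot> h))"
      using pf_square_Re(1)[OF s(1)] s(2,3) by simp
    then show ?thesis using h c0 by (simp add: pf_diff pf_smult field_simps)
  qed
  then have *: "Re (\<phi> h) \<le> (cnorm A h + e) * Re (\<phi> \<one>)" if "e > 0" for e using that by simp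
  show ?thesis
  proof (rule field_le_epsilon)
    fix e :: real assume e: "e > 0"
    have "Re (\<phi> h) \<le> (cnorm A h + e / (Re (\<phi> \<one>) + 1)) * Re (\<phi> \<one>)"
      using e pf_one_nonneg by (intro *) auto
    also have "\<dots> \<le> cnorm A h * Re (\<phi> \<one>) + e"
      using e pf_one_nonneg by (simp add: field_simps)
    finally show "Re (\<phi> h) \<le> cnorm A h * Re (\<phi> \<one>) + e" .
  qed
qed

lemma pf_square_le:
  assumes x: "x \<in> carrier A"
  shows "Re (\<phi> (adj A x \<otimes> x)) \<le> (cnorm A x)\<^sup>2 * Re (\<phi> \<one>)"
  using pf_self_adjoint_le[of "adj A x \<otimes> x"] x by (simp add: adj_simps cstar_identity)

lemma pf_cmod_le:
  assumes x: "x \<in> carrier A"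
  shows "cmod (\<phi> x) \<le> cnorm A x * Re (\<phi> \<one>)"
proof -
  have "(cmod (\<phi> x))\<^sup>2 \<le> Re (\<phi> \<one>) * Re (\<phi> (adj A x \<otimes> x))"
    using pf_Cauchy_Schwarz[of \<one> x] x by simp
  also have "\<dots> \<le> Re (\<phi> \<one>) * ((cnorm A x)\<^sup>2 * Re (\<phi> \<one>))"
    using pf_square_le[OF x] pf_one_nonneg by (intro mult_left_mono) auto
  also have "\<dots> = (cnorm A x * Re (\<phi> \<one>))\<^sup>2" by (simp add: power2_eq_square)
  finally show ?thesis
    using cnorm_nonneg[OF x] pf_one_nonneg by (simp add: abs_le_square_iff[symmetric])
qed

end

lemma tracial_state_positive: "tracial_state A \<rho> \<Longrightarrow> positive_functional A \<rho>"
  by (auto simp: tracial_state_def positive_functional_def)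

context
  fixes \<rho> :: "'a \<Rightarrow> complex"
  assumes ts: "tracial_state A \<rho>"
begin

lemma ts_one: "\<rho> \<one> = 1"
  using ts by (simp add: tracial_state_def)

lemma ts_commute: "\<lbrakk>x \<in> carrier A; y \<in> carrier A\<rbrakk> \<Longrightarrow> \<rho> (x \<otimes> y) = \<rho> (y \<otimes> x)"
  using ts by (simp add: tracial_state_def)

lemmas ts_pf = tracial_state_positive[OF ts]

lemma norm2_nonneg: "x \<in> carrier A \<Longrightarrow> 0 \<le> norm2 A \<rho> x"
  using pf_square_Re(1)[OF ts_pf] by (simp add: norm2_def)

lemma norm2_power2: "x \<in> carrier A \<Longrightarrow> (norm2 A \<rho> x)\<^sup>2 = Re (\<rho> (adj A x \<otimes> x))"
  using pf_square_Re(1)[OF ts_pf] by (simp add: norm2_def)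

lemma norm2_le_cnorm:
  assumes "x \<in> carrier A" shows "norm2 A \<rho> x \<le> cnorm A x"
  using pf_square_le[OF ts_pf assms] cnorm_nonneg[OF assms]
  by (simp add: norm2_def ts_one real_le_lsqrt)

lemma cmod_le_norm2:
  assumes "x \<in> carrier A" shows "cmod (\<rho> x) \<le> norm2 A \<rho> x"
  using pf_Cauchy_Schwarz[OF ts_pf, of \<one> x] assms
  by (simp add: norm2_def ts_one real_le_rsqrt)

lemma norm2_smult: "x \<in> carrier A \<Longrightarrow> norm2 A \<rho> (c \<odot> x) = cmod c * norm2 A \<rho> x"
proof -
  assume x: "x \<in> carrier A"
  have "\<rho> (adj A (c \<odot> x) \<otimes> (c \<odot> x)) = complex_of_real ((cmod c)\<^sup>2) * \<rho> (adj A x \<otimes> x)"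
    using x by (simp add: adj_simps smult_simps pf_smult[OF ts_pf] complex_norm_square mult_ac del: of_real_power)
  then show ?thesis unfolding norm2_def by (simp add: real_sqrt_mult del: of_real_power)
qed

lemma norm2_triangle:
  assumes x: "x \<in> carrier A" and y: "y \<in> carrier A"
  shows "norm2 A \<rho> (x \<oplus> y) \<le> norm2 A \<rho> x + norm2 A \<rho> y"
proof (rule power2_le_imp_le)
  have CS: "cmod (\<rho> (adj A x \<otimes> y)) \<le> norm2 A \<rho> x * norm2 A \<rho> y"
    using pf_Cauchy_Schwarz[OF ts_pf x y] unfolding norm2_def real_sqrt_mult[symmetric]
    by (rule real_le_rsqrt)
  have "(norm2 A \<rho> (x \<oplus> y))\<^sup>2 = (norm2 A \<rho> x)\<^sup>2 + 2 * Re (\<rho> (adj A x \<otimes> y)) + (norm2 A \<rho> y)\<^sup>2"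
    using pf_expand[OF ts_pf x y, of 1] pf_hermitian[OF ts_pf x y] x y
    by (simp add: norm2_power2)
  also have "\<dots> \<le> (norm2 A \<rho> x + norm2 A \<rho> y)\<^sup>2"
    using CS complex_Re_le_cmod[of "\<rho> (adj A x \<otimes> y)"] by (simp add: power2_sum)
  finally show "(norm2 A \<rho> (x \<oplus> y))\<^sup>2 \<le> (norm2 A \<rho> x + norm2 A \<rho> y)\<^sup>2" .
qed (use x y norm2_nonneg in auto)

lemma norm2_uminus: "x \<in> carrier A \<Longrightarrow> norm2 A \<rho> (\<ominus> x) = norm2 A \<rho> x"
  using norm2_smult[of x "-1"] by (simp add: minus_eq_smult)

lemma norm2_diff_commute:
  "\<lbrakk>x \<in> carrier A; y \<in> carrier A\<rbrakk> \<Longrightarrow> norm2 A \<rho> (x \<ominus> y) = norm2 A \<rho> (y \<ominus> x)"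
  using norm2_uminus[of "x \<ominus> y"] by (simp add: A.ring_simprules)

lemma norm2_diff_triangle:
  assumes "x \<in> carrier A" "y \<in> carrier A" "z \<in> carrier A"
  shows "norm2 A \<rho> (x \<ominus> z) \<le> norm2 A \<rho> (x \<ominus> y) + norm2 A \<rho> (y \<ominus> z)"
proof -
  have "x \<ominus> z = (x \<ominus> y) \<oplus> (y \<ominus> z)" using assms by (simp add: A.ring_simprules)
  then show ?thesis using norm2_triangle[of "x \<ominus> y" "y \<ominus> z"] assms by simp
qed

end

end

section \<open>Self-adjoint elements with finite spectrum\<close>

definition poly_eval :: "'a cstar \<Rightarrow> complex poly \<Rightarrow> 'a \<Rightarrow> 'a"
  where "poly_eval A p y =
    fold_coeffs (\<lambda>c b. (c \<odot>\<^bsub>A\<^esub> \<one>\<^bsub>A\<^esub>) \<oplus>\<^bsub>A\<^esub> (y \<otimes>\<^bsub>A\<^esub> b)) p \<zero>\<^bsub>A\<^esub>"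

text \<open>
  \<open>\<Phi>\<close> is a functional calculus for \<open>y\<close> on all functions, where \<open>\<Lambda>\<close> is a finite set that
  contains the spectrum of \<open>y\<close>; spectral projections belonging to further points of \<open>\<Lambda>\<close>
  vanish.
\<close>

definition spectral_calculus ::
    "'a cstar \<Rightarrow> 'a \<Rightarrow> real set \<Rightarrow> ((real \<Rightarrow> complex) \<Rightarrow> 'a) \<Rightarrow> bool"
  where "spectral_calculus A y \<Lambda> \<Phi> \<longleftrightarrow>
    finite \<Lambda> \<and> (\<forall>t\<in>\<Lambda>. \<bar>t\<bar> \<le> cnorm A y) \<and> (\<forall>f. \<Phi> f \<in> carrier A) \<and>
    (\<forall>f g. (\<forall>t\<in>\<Lambda>. f t = g t) \<longrightarrow> \<Phi> f = \<Phi> g) \<and>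
    (\<forall>f g. \<Phi> (\<lambda>t. f t + g t) = \<Phi> f \<oplus>\<^bsub>A\<^esub> \<Phi> g) \<and>
    (\<forall>f g. \<Phi> (\<lambda>t. f t * g t) = \<Phi> f \<otimes>\<^bsub>A\<^esub> \<Phi> g) \<and>
    (\<forall>c f. \<Phi> (\<lambda>t. c * f t) = c \<odot>\<^bsub>A\<^esub> \<Phi> f) \<and>
    (\<forall>f. \<Phi> (\<lambda>t. cnj (f t)) = adj A (\<Phi> f)) \<and>
    \<Phi> (\<lambda>t. 1) = \<one>\<^bsub>A\<^esub> \<and>
    (\<forall>p. \<Phi> (\<lambda>t. poly p (complex_of_real t)) = poly_eval A p y)"

lemma poly_interpolation:
  fixes f :: "'a::field \<Rightarrow> 'a"
  assumes "finite L"
  shows "\<exists>p. \<forall>t\<in>L. poly p t = f t"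
  using assms
proof (induction L)
  case (insert x L)
  then obtain p where p: "\<forall>t\<in>L. poly p t = f t" by blast
  define m where "m = (\<Prod>t\<in>L. [:- t, 1:])"
  have m0: "poly m x \<noteq> 0" using insert by (auto simp: m_def poly_prod)
  have mL: "poly m t = 0" if "t \<in> L" for t
    using insert that by (auto simp: m_def poly_prod)
  have "\<forall>t\<in>insert x L. poly (p + Polynomial.smult ((f x - poly p x) / poly m x) m) t = f t"
    using p m0 mL by auto
  then show ?case by blast
qed auto

lemma prod_linear_dvd:
  fixes p :: "'a::field poly"
  assumes "finite L" "\<And>t. t \<in> L \<Longrightarrow> poly p t = 0"
  shows "(\<Prod>t\<in>L. [:- t, 1:]) dvd p"
  using assms
proof (induction L arbitrary: p)
  case (insert x L)
  then obtain q where q: "p = [:- x, 1:] * q" by (metis dvdE insertI1 poly_eq_0_iff_dvd)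
  have "poly q t = 0" if "t \<in> L" for t
    using insert.prems[of t] insert.hyps(2) that by (auto simp: q)
  then have "(\<Prod>t\<in>L. [:- t, 1:]) dvd q" using insert.IH by blast
  then show ?case using insert.hyps by (simp add: q mult_dvd_mono del: mult_pCons_left)
qed auto

context unital_cstar_algebra
begin

context
  fixes y assumes y: "y \<in> carrier A"
begin

lemma poly_eval_0 [simp]: "poly_eval A 0 y = \<zero>"
  by (simp add: poly_eval_def)

lemma poly_eval_pCons: "poly_eval A (pCons c p) y = c \<odot> \<one> \<oplus> y \<otimes> poly_eval A p y"
  by (cases "p = 0 \<and> c = 0") (use y in \<open>auto simp: poly_eval_def\<close>)

lemma poly_eval_closed [simp, intro]: "poly_eval A p y \<in> carrier A"
  by (induction p) (use y in \<open>auto simp: poly_eval_pCons\<close>)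

lemma poly_eval_add: "poly_eval A (p + q) y = poly_eval A p y \<oplus> poly_eval A q y"
proof (induction p q rule: poly_induct2)
  case (pCons a p b q)
  then show ?case using y
    by (simp add: poly_eval_pCons smult_add_left A.r_distr A.a_ac)
qed auto

lemma poly_eval_smult: "poly_eval A (Polynomial.smult c p) y = c \<odot> poly_eval A p y"
  by (induction p) (use y in \<open>auto simp: poly_eval_pCons smult_add_right smult_simps\<close>)

lemma poly_eval_mult: "poly_eval A (p * q) y = poly_eval A p y \<otimes> poly_eval A q y"
proof (induction p)
  case (pCons a p)
  then show ?case using y
    by (simp add: poly_eval_add poly_eval_smult poly_eval_pCons A.l_distr smult_simps A.m_assoc)
qed (use y in auto)

lemma poly_eval_const: "poly_eval A [:c:] y = c \<odot> \<one>"
  using y by (simp add: poly_eval_pCons)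

lemma poly_eval_1 [simp]: "poly_eval A 1 y = \<one>"
  using poly_eval_const[of 1] by (simp add: one_pCons)

lemma poly_eval_linear: "poly_eval A [:c, 1:] y = c \<odot> \<one> \<oplus> y"
  using y by (simp add: poly_eval_pCons)

lemma poly_eval_commute: "poly_eval A p y \<otimes> poly_eval A q y = poly_eval A q y \<otimes> poly_eval A p y"
  by (simp add: poly_eval_mult[symmetric] mult.commute)

lemma poly_eval_adj:
  assumes "adj A y = y"
  shows "adj A (poly_eval A p y) = poly_eval A (map_poly cnj p) y"
proof (induction p)
  case (pCons a p)
  have "poly_eval A q y \<otimes> y = y \<otimes> poly_eval A q y" for q
    using poly_eval_commute[of q "[:0, 1:]"] y by (simp add: poly_eval_linear)
  then show ?case using pCons y assms
    by (simp add: poly_eval_pCons map_poly_pCons adj_simps)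
qed auto

lemma poly_eval_dvd_zero: "\<lbrakk>m dvd p; poly_eval A m y = \<zero>\<rbrakk> \<Longrightarrow> poly_eval A p y = \<zero>"
  by (auto simp: poly_eval_mult elim!: dvdE)

lemma poly_eval_Units:
  assumes "p \<noteq> 0" and "\<And>c. poly p c = 0 \<Longrightarrow> c \<odot> \<one> \<ominus> y \<in> Units A"
  shows "poly_eval A p y \<in> Units A"
  using assms
proof (induction "Polynomial.degree p" arbitrary: p)
  case 0
  then obtain c where c: "p = [:c:]" "c \<noteq> 0" by (metis degree_eq_zeroE pCons_0_0)
  then show ?case using smult_Units[of \<one> c] by (simp add: poly_eval_const)
next
  case (Suc n)
  then have "\<not> constant (poly p)" by (metis constant_degree nat.simps(3))
  then obtain c where c: "poly p c = 0" using fundamental_theorem_of_algebra by blast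
  then obtain q where q: "p = [:- c, 1:] * q" by (metis dvdE poly_eq_0_iff_dvd)
  have q0: "q \<noteq> 0" using Suc.prems q by auto
  have "Polynomial.degree p = 1 + Polynomial.degree q"
    unfolding q using q0 by (subst degree_mult_eq) auto
  then have "Polynomial.degree q = n" using Suc.hyps by simp
  then have "poly_eval A q y \<in> Units A"
    using Suc.hyps(1)[of q] Suc.prems(2) q0 q by auto
  moreover have "poly_eval A [:- c, 1:] y \<in> Units A"
  proof -
    have "(- 1) \<odot> (c \<odot> \<one> \<ominus> y) \<in> Units A" using Suc.prems(2)[OF c] by (intro smult_Units) auto
    also have "(- 1) \<odot> (c \<odot> \<one> \<ominus> y) = poly_eval A [:- c, 1:] y"
      using y by (simp add: poly_eval_linear smult_minus_left A.ring_simprules)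
    finally show ?thesis .
  qed
  ultimately show ?case unfolding q poly_eval_mult by blast
qed

end

lemma Units_of_commuting_product:
  assumes x: "x \<in> carrier A" and z: "z \<in> carrier A" and comm: "x \<otimes> z = z \<otimes> x" and u: "x \<otimes> z \<in> Units A"
  shows "x \<in> Units A"
proof -
  obtain k where k: "k \<in> carrier A" "k \<otimes> (x \<otimes> z) = \<one>" "(x \<otimes> z) \<otimes> k = \<one>"
    using u by (auto simp: Units_def)
  have 1: "x \<otimes> (z \<otimes> k) = \<one>" using k(1,3) x z by (simp add: A.m_assoc)
  have 2: "(k \<otimes> z) \<otimes> x = \<one>" using k(1,2) x z comm by (simp add: A.m_assoc)
  have "k \<otimes> z = (k \<otimes> z) \<otimes> (x \<otimes> (z \<otimes> k))" using 1 k z by simp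
  also have "\<dots> = ((k \<otimes> z) \<otimes> x) \<otimes> (z \<otimes> k)" using k(1) x z by (simp only: A.m_assoc A.m_closed)
  also have "\<dots> = z \<otimes> k" using 2 k z by simp
  finally show ?thesis using 1 2 x z k(1) unfolding Units_def by auto
qed

text \<open>\<open>(c - y) (cnj c - y) = (Im c)\<^sup>2 + (y - Re c)\<^sup>2\<close>.\<close>

lemma nonreal_Units:
  assumes y: "y \<in> carrier A" "adj A y = y" and c: "Im c \<noteq> 0"
  shows "c \<odot> \<one> \<ominus> y \<in> Units A"
proof -
  define p q where "p = [:c, -1:]" and "q = [:cnj c, -1:]"
  have lin: "poly_eval A [:d, -1:] y = d \<odot> \<one> \<ominus> y" for d
    using y by (simp add: poly_eval_pCons a_minus_def minus_eq_smult smult_simps)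
  define x where "x = y \<ominus> complex_of_real (Re c) \<odot> \<one>"
  have x: "x \<in> carrier A" "adj A x = x" using y by (auto simp: x_def adj_simps)
  have xl: "x = poly_eval A [:- complex_of_real (Re c), 1:] y"
    using y by (simp add: x_def poly_eval_linear smult_minus_left a_minus_def A.a_comm)
  have pq: "p * q = [:complex_of_real ((Im c)\<^sup>2):] + [:- complex_of_real (Re c), 1:] * [:- complex_of_real (Re c), 1:]"
    by (simp add: p_def q_def complex_eq_iff power2_eq_square)
  have "poly_eval A (p * q) y \<in> Units A"
    using square_plus_pos_Units[OF x, of "(Im c)\<^sup>2"] c y unfolding pq
    by (simp add: poly_eval_add poly_eval_mult poly_eval_const xl del: mult_pCons_left mult_pCons_right of_real_power)
  then have "poly_eval A p y \<in> Units A"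
    using Units_of_commuting_product[of "poly_eval A p y" "poly_eval A q y"] y
    by (simp add: poly_eval_mult poly_eval_commute)
  then show ?thesis by (simp add: p_def lin)
qed

text \<open>
  Let \<open>m\<close> be the product of the linear factors. Were \<open>m(y)\<close> nonzero, then after
  normalisation \<open>1 - m(y)\<^sup>2\<close> would be a polynomial in \<open>y\<close> whose roots avoid the spectrum, hence
  invertible, although \<open>m(y)\<close> is self-adjoint of norm \<open>1\<close>.
\<close>

lemma spectral_polynomial_zero:
  assumes y: "y \<in> carrier A" "adj A y = y" and L: "finite L" "L \<noteq> {}"
    and spec: "\<And>c. c \<notin> complex_of_real ` L \<Longrightarrow> c \<odot> \<one> \<ominus> y \<in> Units A"
  shows "poly_eval A (\<Prod>t\<in>complex_of_real ` L. [:- t, 1:]) y = \<zero>"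
proof (rule ccontr)
  define m where "m = (\<Prod>t\<in>complex_of_real ` L. [:- t, 1:])"
  have cnj_m: "map_poly cnj m = m"
  proof -
    have "poly (map_poly cnj m) x = poly m x" for x
    proof -
      have "poly (map_poly cnj m) x = cnj (poly m (cnj x))" by (metis complex_cnj_cnj poly_cnj)
      also have "\<dots> = poly m x"
        using L by (auto simp: m_def poly_prod intro!: prod.cong)
      finally show ?thesis .
    qed
    then show ?thesis using poly_eq_poly_eq_iff by blast
  qed
  define q where "q = poly_eval A m y"
  have q: "q \<in> carrier A" "adj A q = q"
    using y by (auto simp: q_def poly_eval_adj cnj_m)
  assume "poly_eval A (\<Prod>t\<in>complex_of_real ` L. [:- t, 1:]) y \<noteq> \<zero>"
  then have "cnorm A q \<noteq> 0" using q by (simp add: q_def m_def cnorm_eq_0)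
  then have n: "cnorm A q > 0" using cnorm_nonneg[OF q(1)] by simp
  define k where "k = complex_of_real (1 / cnorm A q)"
  define P where "P = 1 - Polynomial.smult k m * Polynomial.smult k m"
  have P1: "poly P c = 1" if "c \<in> complex_of_real ` L" for c
    using L that by (auto simp: P_def m_def poly_prod)
  have "poly_eval A P y \<in> Units A"
  proof (rule poly_eval_Units[OF y(1)])
    show "P \<noteq> 0" using P1 L by fastforce
    show "c \<odot> \<one> \<ominus> y \<in> Units A" if "poly P c = 0" for c
      using P1[of c] that by (intro spec) auto
  qed
  moreover have "poly_eval A P y = \<one> \<ominus> (k \<odot> q) \<otimes> (k \<odot> q)"
  proof -
    have "P = 1 + Polynomial.smult (-1) (Polynomial.smult k m * Polynomial.smult k m)" by (simp add: P_def)
    then show ?thesis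
      using y q by (simp only: poly_eval_add poly_eval_smult poly_eval_mult poly_eval_1 q_def[symmetric])
        (simp add: a_minus_def minus_eq_smult)
  qed
  ultimately show False
    using one_minus_square_not_Units[of "k \<odot> q"] q n by (simp add: k_def adj_simps cnorm_smult norm_divide)
qed

text \<open>
  Polynomials that agree on \<open>\<Lambda>\<close> differ by a multiple of \<open>m\<close> and so have the same value at
  \<open>y\<close>. Hence \<open>\<Phi> f\<close> can be defined by any polynomial interpolating \<open>f\<close> on \<open>\<Lambda>\<close>.
\<close>

theorem finite_spectrum_calculus:
  assumes y: "self_adjoint A y" and fin: "finite (spectrum A y)"
  shows "\<exists>\<Lambda> \<Phi>. spectral_calculus A y \<Lambda> \<Phi>"
proof -
  have yA: "y \<in> carrier A" "adj A y = y" using y by (auto simp: self_adjoint_def)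
  \<comment> \<open>\<open>0\<close> is added so that \<open>\<Lambda>\<close> is nonempty.\<close>
  define \<Lambda> where "\<Lambda> = insert 0 {t. complex_of_real t \<in> spectrum A y}"
  have fin\<Lambda>: "finite \<Lambda>"
    using finite_vimageI[OF fin, of complex_of_real] by (simp add: \<Lambda>_def vimage_def inj_of_real)
  have bound: "\<bar>t\<bar> \<le> cnorm A y" if "t \<in> \<Lambda>" for t
  proof (rule ccontr)
    assume "\<not> \<bar>t\<bar> \<le> cnorm A y"
    then have "cnorm A y < cmod (complex_of_real t)" by simp
    from smult_one_diff_Units[OF yA(1) this] have "t = 0"
      using that by (auto simp: \<Lambda>_def spectrum_def)
    then show False using \<open>\<not> \<bar>t\<bar> \<le> cnorm A y\<close> cnorm_nonneg[OF yA(1)] by simp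
  qed
  have spec: "c \<odot> \<one> \<ominus> y \<in> Units A" if "c \<notin> complex_of_real ` \<Lambda>" for c
  proof (cases "Im c = 0")
    case True
    then obtain t where t: "c = complex_of_real t" by (metis complex_is_Real_iff Reals_cases)
    then have "t \<notin> \<Lambda>" using that by blast
    then show ?thesis by (simp add: t \<Lambda>_def spectrum_def)
  next
    case False
    then show ?thesis using nonreal_Units yA by blast
  qed
  have zero: "poly_eval A (\<Prod>t\<in>complex_of_real ` \<Lambda>. [:- t, 1:]) y = \<zero>"
    by (rule spectral_polynomial_zero) (use yA fin\<Lambda> spec in \<open>auto simp: \<Lambda>_def\<close>)
  have eq: "poly_eval A p y = poly_eval A q y"
    if "\<And>t. t \<in> \<Lambda> \<Longrightarrow> poly p (complex_of_real t) = poly q (complex_of_real t)" for p q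
  proof -
    have "(\<Prod>t\<in>complex_of_real ` \<Lambda>. [:- t, 1:]) dvd (p - q)"
      using that fin\<Lambda> by (intro prod_linear_dvd) auto
    then have "poly_eval A (p - q) y = \<zero>" using poly_eval_dvd_zero[OF yA(1)] zero by blast
    then show ?thesis using poly_eval_add[OF yA(1), of "p - q" q] yA by simp
  qed
  define ip where "ip f = (SOME p. \<forall>t\<in>\<Lambda>. poly p (complex_of_real t) = f t)" for f :: "real \<Rightarrow> complex"
  have ip: "poly (ip f) (complex_of_real t) = f t" if "t \<in> \<Lambda>" for f t
  proof -
    have "\<exists>p. \<forall>t\<in>complex_of_real ` \<Lambda>. poly p t = f (Re t)"
      using fin\<Lambda> by (intro poly_interpolation) auto
    then have "\<exists>p. \<forall>t\<in>\<Lambda>. poly p (complex_of_real t) = f t" by auto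
    from someI_ex[OF this] show ?thesis using that by (simp add: ip_def)
  qed
  define \<Phi> where "\<Phi> f = poly_eval A (ip f) y" for f
  have \<Phi>: "\<Phi> f = poly_eval A p y" if "\<And>t. t \<in> \<Lambda> \<Longrightarrow> f t = poly p (complex_of_real t)" for f p
    unfolding \<Phi>_def by (rule eq) (simp add: ip that)
  have "spectral_calculus A y \<Lambda> \<Phi>"
    unfolding spectral_calculus_def
  proof (intro conjI allI ballI impI)
    show "finite \<Lambda>" by fact
    show "\<bar>t\<bar> \<le> cnorm A y" if "t \<in> \<Lambda>" for t using bound that by blast
    show "\<Phi> f \<in> carrier A" for f using yA by (simp add: \<Phi>_def)
    show "\<Phi> f = \<Phi> g" if "\<forall>t\<in>\<Lambda>. f t = g t" for f g
      unfolding \<Phi>_def[of g] by (rule \<Phi>) (simp add: ip that)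
    show "\<Phi> (\<lambda>t. f t + g t) = \<Phi> f \<oplus> \<Phi> g" for f g
      using \<Phi>[of "\<lambda>t. f t + g t" "ip f + ip g"] ip by (simp add: \<Phi>_def[of f] \<Phi>_def[of g] poly_eval_add yA(1))
    show "\<Phi> (\<lambda>t. f t * g t) = \<Phi> f \<otimes> \<Phi> g" for f g
      unfolding \<Phi>_def[of f] \<Phi>_def[of g] poly_eval_mult[OF yA(1), symmetric] by (rule \<Phi>) (simp add: ip)
    show "\<Phi> (\<lambda>t. c * f t) = c \<odot> \<Phi> f" for c f
      unfolding \<Phi>_def[of f] poly_eval_smult[OF yA(1), symmetric] by (rule \<Phi>) (simp add: ip)
    show "\<Phi> (\<lambda>t. cnj (f t)) = adj A (\<Phi> f)" for f
    proof -
      have "\<Phi> (\<lambda>t. cnj (f t)) = poly_eval A (map_poly cnj (ip f)) y"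
      proof (rule \<Phi>)
        fix t assume "t \<in> \<Lambda>"
        then have "cnj (poly (ip f) (complex_of_real t)) = cnj (f t)" by (simp only: ip)
        then show "cnj (f t) = poly (map_poly cnj (ip f)) (complex_of_real t)"
          by (simp only: poly_cnj complex_cnj_complex_of_real)
      qed
      then show ?thesis by (simp only: \<Phi>_def[of f] poly_eval_adj[OF yA])
    qed
    show "\<Phi> (\<lambda>t. 1) = \<one>" 
      unfolding poly_eval_1[OF yA(1), symmetric] by (rule \<Phi>) simp
    show "\<Phi> (\<lambda>t. poly p (complex_of_real t)) = poly_eval A p y" for p by (rule \<Phi>) simp
  qed
  then show ?thesis by blast
qed

lemma
  assumes sc: "spectral_calculus A y \<Lambda> \<Phi>"
  shows sc_finite: "finite \<Lambda>"
    and sc_bound: "t \<in> \<Lambda> \<Longrightarrow> \<bar>t\<bar> \<le> cnorm A y"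
    and sc_closed: "\<Phi> f \<in> carrier A"
    and sc_cong: "(\<And>t. t \<in> \<Lambda> \<Longrightarrow> f t = g t) \<Longrightarrow> \<Phi> f = \<Phi> g"
    and sc_add: "\<Phi> (\<lambda>t. f t + g t) = \<Phi> f \<oplus> \<Phi> g"
    and sc_mult: "\<Phi> (\<lambda>t. f t * g t) = \<Phi> f \<otimes> \<Phi> g"
    and sc_smult: "\<Phi> (\<lambda>t. c * f t) = c \<odot> \<Phi> f"
    and sc_adj: "\<Phi> (\<lambda>t. cnj (f t)) = adj A (\<Phi> f)"
    and sc_one: "\<Phi> (\<lambda>t. 1) = \<one>"
    and sc_poly: "\<Phi> (\<lambda>t. poly p (complex_of_real t)) = poly_eval A p y"
  using sc unfolding spectral_calculus_def by blast+

text \<open>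
  With \<open>u = \<Phi> \<bar>f\<bar>\<close> and \<open>v = \<Phi> (sqrt (M\<^sup>2 - \<bar>f\<bar>\<^sup>2))\<close> one has \<open>\<parallel>\<Phi> f\<parallel>\<^sup>2 = \<parallel>u\<^sup>2\<parallel>\<close> and
  \<open>u\<^sup>2 + v\<^sup>2 = M\<^sup>2\<close>.
\<close>

lemma spectral_calculus_cnorm_le:
  assumes sc: "spectral_calculus A y \<Lambda> \<Phi>" and M: "\<And>t. t \<in> \<Lambda> \<Longrightarrow> cmod (f t) \<le> M" "0 \<le> M"
  shows "cnorm A (\<Phi> f) \<le> M"
proof -
  define u where "u = \<Phi> (\<lambda>t. complex_of_real (cmod (f t)))"
  define v where "v = \<Phi> (\<lambda>t. complex_of_real (sqrt (M\<^sup>2 - (cmod (f t))\<^sup>2)))"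
  have cl: "u \<in> carrier A" "v \<in> carrier A" "\<Phi> f \<in> carrier A"
    using sc_closed[OF sc] by (auto simp: u_def v_def)
  have sa: "adj A u = u" "adj A v = v"
    by (simp_all add: u_def v_def flip: sc_adj[OF sc])
  have comm: "u \<otimes> v = v \<otimes> u" by (simp add: u_def v_def mult.commute flip: sc_mult[OF sc])
  have "u \<otimes> u \<oplus> v \<otimes> v = \<Phi> (\<lambda>t. complex_of_real (M\<^sup>2) * 1)"
    unfolding u_def v_def sc_mult[OF sc, symmetric] sc_add[OF sc, symmetric]
  proof (rule sc_cong[OF sc])
    fix t assume "t \<in> \<Lambda>"
    then have "(cmod (f t))\<^sup>2 \<le> M\<^sup>2" using M by (intro power_mono) auto
    then have "cmod (f t) * cmod (f t) + sqrt (M\<^sup>2 - (cmod (f t))\<^sup>2) * sqrt (M\<^sup>2 - (cmod (f t))\<^sup>2) = M\<^sup>2"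
      by (simp add: power2_eq_square)
    then show "complex_of_real (cmod (f t)) * complex_of_real (cmod (f t)) +
        complex_of_real (sqrt (M\<^sup>2 - (cmod (f t))\<^sup>2)) * complex_of_real (sqrt (M\<^sup>2 - (cmod (f t))\<^sup>2)) =
        complex_of_real (M\<^sup>2) * 1"
      by (simp only: of_real_mult[symmetric] of_real_add[symmetric] mult_1_right)
  qed
  also have "\<dots> = complex_of_real (M\<^sup>2) \<odot> \<one>" unfolding sc_smult[OF sc] sc_one[OF sc] ..
  finally have "cnorm A (u \<otimes> u \<oplus> v \<otimes> v) \<le> M\<^sup>2"
    using cnorm_smult_one_le[of "complex_of_real (M\<^sup>2)"] by (simp add: norm_power)
  moreover have "cnorm A (u \<otimes> u) \<le> cnorm A (u \<otimes> u \<oplus> v \<otimes> v)"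
    by (rule cnorm_square_le_sum[OF cl(1) sa(1) cl(2) sa(2) comm])
  moreover have "adj A (\<Phi> f) \<otimes> \<Phi> f = u \<otimes> u"
    unfolding u_def sc_adj[OF sc, symmetric] sc_mult[OF sc, symmetric]
  proof (rule sc_cong[OF sc])
    show "cnj (f t) * f t = complex_of_real (cmod (f t)) * complex_of_real (cmod (f t))" for t
      using complex_norm_square[of "f t"] by (simp add: power2_eq_square mult.commute)
  qed
  ultimately have "(cnorm A (\<Phi> f))\<^sup>2 \<le> M\<^sup>2" using cstar_identity[OF cl(3)] by simp
  then show ?thesis using M(2) cnorm_nonneg[OF cl(3)] by (simp add: abs_le_square_iff[symmetric])
qed

lemma spectral_calculus_functional_sum:
  assumes sc: "spectral_calculus A y \<Lambda> \<Phi>"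
    and add: "\<And>x z. \<lbrakk>x \<in> carrier A; z \<in> carrier A\<rbrakk> \<Longrightarrow> \<psi> (x \<oplus> z) = \<psi> x + \<psi> z"
    and smult: "\<And>c x. x \<in> carrier A \<Longrightarrow> \<psi> (c \<odot> x) = c * \<psi> x"
  shows "\<psi> (\<Phi> f) = (\<Sum>l\<in>\<Lambda>. f l * \<psi> (\<Phi> (\<lambda>t. of_bool (t = l))))"
proof -
  note cl = sc_closed[OF sc]
  have z: "\<psi> (\<Phi> (\<lambda>t. 0)) = 0"
    using smult[OF cl, of 0 "\<lambda>t. 0"] sc_smult[OF sc, of 0 "\<lambda>t. 0"] by simp
  have "\<psi> (\<Phi> (\<lambda>t. \<Sum>l\<in>S. f l * of_bool (t = l))) = (\<Sum>l\<in>S. f l * \<psi> (\<Phi> (\<lambda>t. of_bool (t = l))))"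
    if "finite S" for S
    using that
  proof (induction S)
    case (insert x S)
    have *: "\<Phi> (\<lambda>t. f x * of_bool (t = x) + (\<Sum>l\<in>S. f l * of_bool (t = l)))
      = f x \<odot> \<Phi> (\<lambda>t. of_bool (t = x)) \<oplus> \<Phi> (\<lambda>t. \<Sum>l\<in>S. f l * of_bool (t = l))"
      unfolding sc_add[OF sc] sc_smult[OF sc] ..
    show ?case using insert.IH unfolding sum.insert[OF insert.hyps] *
      by (simp add: add smult cl)
  qed (simp add: z)
  moreover have "\<Phi> f = \<Phi> (\<lambda>t. \<Sum>l\<in>\<Lambda>. f l * of_bool (t = l))"
    by (rule sc_cong[OF sc]) (use sc_finite[OF sc] in \<open>simp add: of_bool_def if_distrib[of "(*) _"] sum.delta cong: if_cong\<close>)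
  ultimately show ?thesis using sc_finite[OF sc] by simp
qed

end

section \<open>States and characters of a separable commutative algebra\<close>

text \<open>
  Functionals are normalised to vanish off the carrier, so that they form a compact set in
  the topology of pointwise convergence on the whole type.
\<close>

definition states :: "'a cstar \<Rightarrow> ('a \<Rightarrow> complex) set"
  where "states A = {\<phi>. (\<forall>x. x \<notin> carrier A \<longrightarrow> \<phi> x = 0) \<and> positive_functional A \<phi> \<and> \<phi> \<one>\<^bsub>A\<^esub> = 1}"

definition characters :: "'a cstar \<Rightarrow> ('a \<Rightarrow> complex) set"
  where "characters A =
    {\<kappa> \<in> states A. \<forall>x\<in>carrier A. \<forall>y\<in>carrier A. \<kappa> (x \<otimes>\<^bsub>A\<^esub> y) = \<kappa> x * \<kappa> y}"

definition extreme_state :: "'a cstar \<Rightarrow> ('a \<Rightarrow> complex) \<Rightarrow> bool"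
  where "extreme_state A \<phi> \<longleftrightarrow> \<phi> \<in> states A \<and>
    (\<forall>\<phi>1\<in>states A. \<forall>\<phi>2\<in>states A. \<forall>t. 0 < t \<and> t < 1 \<and>
      (\<forall>x\<in>carrier A. \<phi> x = complex_of_real t * \<phi>1 x + complex_of_real (1 - t) * \<phi>2 x) \<longrightarrow>
      (\<forall>x\<in>carrier A. \<phi>1 x = \<phi> x))"

context unital_cstar_algebra
begin

lemma state_cmod_le: "\<lbrakk>\<phi> \<in> states A; x \<in> carrier A\<rbrakk> \<Longrightarrow> cmod (\<phi> x) \<le> cnorm A x"
  using pf_cmod_le[of \<phi> x] by (simp add: states_def)

lemma closed_states: "closed (states A)"
proof -
  have cont: "continuous_on UNIV (\<lambda>\<phi>::'a \<Rightarrow> complex. \<phi> x)" for x by simp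
  have eq: "states A = (\<Inter>x\<in>- carrier A. {\<phi>. \<phi> x = 0}) \<inter>
      (\<Inter>x\<in>carrier A. \<Inter>y\<in>carrier A. {\<phi>. \<phi> (x \<oplus> y) = \<phi> x + \<phi> y}) \<inter>
      (\<Inter>c. \<Inter>x\<in>carrier A. {\<phi>. \<phi> (c \<odot> x) = c * \<phi> x}) \<inter>
      (\<Inter>x\<in>carrier A. {\<phi>. 0 \<le> Re (\<phi> (adj A x \<otimes> x))} \<inter> {\<phi>. Im (\<phi> (adj A x \<otimes> x)) = 0}) \<inter>
      {\<phi>. \<phi> \<one> = 1}"
    unfolding states_def positive_functional_def complex_nonneg_Reals_iff by blast
  show ?thesis
    unfolding eq
    by (intro closed_Int closed_INT ballI closed_Collect_eq closed_Collect_le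
        continuous_on_const continuous_on_add continuous_on_mult continuous_on_Re continuous_on_Im cont)
qed

lemma compact_states: "compact (states A)"
proof -
  define S where "S x = cball (0::complex) (if x \<in> carrier A then cnorm A x else 0)" for x
  have "compactin (product_topology (\<lambda>i. euclidean) UNIV) (PiE UNIV S)"
    unfolding compactin_PiE by (simp add: S_def)
  then have comp: "compact (PiE UNIV S)"
    by (simp add: euclidean_product_topology)
  have "states A \<subseteq> PiE UNIV S"
    using state_cmod_le by (auto simp: S_def states_def)
  then show ?thesis using comp closed_states compact_Int_closed[of "PiE UNIV S" "states A"]
    by (simp add: Int_absorb1)
qed

lemma dense_sequence:
  assumes "separable_cstar A"
  shows "\<exists>c. (\<forall>n::nat. c n \<in> carrier A) \<and>
    (\<forall>x\<in>carrier A. \<forall>e>0. \<exists>n. cnorm A (x \<ominus> c n) < e)"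
proof -
  interpret Metric_space "carrier A" "cdist A" by (rule Metric_space_cdist)
  obtain C where C: "countable C" "C \<subseteq> carrier A" "mtopology closure_of C = carrier A"
    using assms unfolding separable_cstar_def separable_space_def by auto
  have near: "\<exists>y\<in>C. cnorm A (x \<ominus> y) < e" if "x \<in> carrier A" "e > 0" for x e
  proof -
    have "x \<in> mtopology closure_of C" using C(3) that by simp
    then obtain y where "y \<in> C" "y \<in> mball x e"
      using \<open>e > 0\<close> unfolding metric_closure_of by blast
    then show ?thesis using C(2) that by (auto simp: in_mball cdist_def)
  qed
  have "C \<noteq> {}" using near[of \<zero> 1] by auto
  have "from_nat_into C n \<in> carrier A" for n
    using from_nat_into[OF \<open>C \<noteq> {}\<close>] C(2) by blast
  moreover have "\<exists>n. cnorm A (x \<ominus> from_nat_into C n) < e" if "x \<in> carrier A" "e > 0" for x e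
    using near[OF that] from_nat_into_surj[OF C(1)] by metis
  ultimately show ?thesis by blast
qed

text \<open>
  Minimising \<open>Re \<phi> (f n)\<close> successively over compact faces of the state space isolates one
  state as soon as the \<open>f n\<close> are dense; being lexicographically minimal, it cannot be a proper
  convex combination of other states.
\<close>

lemma exists_extreme_state:
  assumes sep: "separable_cstar A" and \<phi>0: "\<phi>0 \<in> states A" and b: "b \<in> carrier A"
  obtains \<phi> where "extreme_state A \<phi>" "Re (\<phi> b) \<le> Re (\<phi>0 b)"
proof -
  obtain c where "(\<forall>n::nat. c n \<in> carrier A) \<and> (\<forall>x\<in>carrier A. \<forall>e>0. \<exists>n. cnorm A (x \<ominus> c n) < e)"
    using dense_sequence[OF sep] ..
  then have c: "c n \<in> carrier A"
    and dense: "\<lbrakk>x \<in> carrier A; e > 0\<rbrakk> \<Longrightarrow> \<exists>n. cnorm A (x \<ominus> c n) < e" for n x e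
    by auto
  define f where "f n = (case n of 0 \<Rightarrow> b | Suc m \<Rightarrow> c m)" for n
  have f: "f n \<in> carrier A" for n using b c by (simp add: f_def split: nat.split)
  define P where "P = rec_nat (states A) (\<lambda>n Q. {\<phi> \<in> Q. \<forall>\<psi>\<in>Q. Re (\<phi> (f n)) \<le> Re (\<psi> (f n))})"
  have P0: "P 0 = states A" and PS: "P (Suc n) = {\<phi> \<in> P n. \<forall>\<psi>\<in>P n. Re (\<phi> (f n)) \<le> Re (\<psi> (f n))}" for n
    by (simp_all add: P_def)
  have cont: "continuous_on UNIV (\<lambda>\<phi>::'a \<Rightarrow> complex. Re (\<phi> x))" for x
    by (intro continuous_intros continuous_on_product_coordinates)
  have P: "compact (P n) \<and> closed (P n) \<and> P n \<noteq> {}" for n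
  proof (induction n)
    case 0
    then show ?case using compact_states closed_states \<phi>0 by (auto simp: P0)
  next
    case (Suc n)
    then obtain \<psi> where \<psi>: "\<psi> \<in> P n" "\<And>\<phi>. \<phi> \<in> P n \<Longrightarrow> Re (\<psi> (f n)) \<le> Re (\<phi> (f n))"
      using continuous_attains_inf[of "P n" "\<lambda>\<phi>. Re (\<phi> (f n))"] continuous_on_subset[OF cont]
      by blast
    have eq: "P (Suc n) = P n \<inter> {\<phi>. Re (\<phi> (f n)) \<le> Re (\<psi> (f n))}"
      unfolding PS using \<psi>(1) by (auto intro: order_trans[OF _ \<psi>(2)])
    have "closed {\<phi>::'a \<Rightarrow> complex. Re (\<phi> (f n)) \<le> Re (\<psi> (f n))}"
      by (intro closed_Collect_le cont continuous_on_const)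
    then have "compact (P (Suc n))" "closed (P (Suc n))"
      unfolding eq using Suc by (auto intro!: compact_Int_closed closed_Int)
    moreover have "\<psi> \<in> P (Suc n)" using \<psi>(1) by (simp add: eq)
    ultimately show ?case by blast
  qed
  have anti: "P n \<subseteq> P m" if "m \<le> n" for m n
    using lift_Suc_antimono_le[of P, OF _ that] PS by blast
  have "states A \<inter> (\<Inter>n\<in>UNIV. P n) \<noteq> {}"
  proof (rule compact_imp_fip_image[OF compact_states])
    show "closed (P n)" for n using P[of n] by simp
    fix I :: "nat set" assume I: "finite I"
    have "P (Max (insert 0 I)) \<subseteq> P n" if "n \<in> insert 0 I" for n
      using that I by (intro anti Max_ge) auto
    then have "P (Max (insert 0 I)) \<subseteq> states A \<inter> (\<Inter>n\<in>I. P n)"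
      unfolding P0[symmetric] by blast
    then show "states A \<inter> (\<Inter>n\<in>I. P n) \<noteq> {}" using P[of "Max (insert 0 I)"] by blast
  qed
  then obtain \<phi> where \<phi>: "\<phi> \<in> states A" "\<phi> \<in> P n" for n by auto
  show ?thesis
  proof
    show "Re (\<phi> b) \<le> Re (\<phi>0 b)" using \<phi>(2)[of "Suc 0"] \<phi>0 unfolding PS P0 by (simp add: f_def)
    have unique: "\<phi>1 x = \<phi> x"
      if \<phi>12: "\<phi>1 \<in> states A" "\<phi>2 \<in> states A" and t: "0 < t" "t < 1" and x: "x \<in> carrier A"
        and conv: "\<forall>x\<in>carrier A. \<phi> x = complex_of_real t * \<phi>1 x + complex_of_real (1 - t) * \<phi>2 x"
      for \<phi>1 \<phi>2 t x
    proof -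
      have step: "Re (\<phi>1 (f n)) = Re (\<phi> (f n)) \<and> Re (\<phi>2 (f n)) = Re (\<phi> (f n))"
        if "\<phi>1 \<in> P n" "\<phi>2 \<in> P n" for n
      proof -
        have le: "Re (\<phi> (f n)) \<le> Re (\<phi>1 (f n))" "Re (\<phi> (f n)) \<le> Re (\<phi>2 (f n))"
          using \<phi>(2)[of "Suc n"] that by (auto simp: PS)
        have "t * (Re (\<phi>1 (f n)) - Re (\<phi> (f n))) + (1 - t) * (Re (\<phi>2 (f n)) - Re (\<phi> (f n))) = 0"
          using arg_cong[OF bspec[OF conv f, of n], of Re] by (simp add: algebra_simps)
        moreover have "t * (Re (\<phi>1 (f n)) - Re (\<phi> (f n))) \<ge> 0" "(1 - t) * (Re (\<phi>2 (f n)) - Re (\<phi> (f n))) \<ge> 0"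
          using le t by auto
        ultimately have "t * (Re (\<phi>1 (f n)) - Re (\<phi> (f n))) = 0" "(1 - t) * (Re (\<phi>2 (f n)) - Re (\<phi> (f n))) = 0"
          by linarith+
        then show ?thesis using t by auto
      qed
      have inP: "\<phi>1 \<in> P n \<and> \<phi>2 \<in> P n" for n
      proof (induction n)
        case 0
        then show ?case using \<phi>12 P0 by simp
      next
        case (Suc n)
        then show ?case using step[of n] \<phi>(2)[of "Suc n"] by (auto simp: PS)
      qed
      have Re_c: "Re (\<phi>1 (c n)) = Re (\<phi> (c n))" for n
        using step[of "Suc n"] inP[of "Suc n"] by (simp add: f_def)
      have Re_eq: "Re (\<phi>1 z) = Re (\<phi> z)" if z: "z \<in> carrier A" for z
      proof -
        have "\<bar>Re (\<phi>1 z) - Re (\<phi> z)\<bar> \<le> 0 + e" if e: "e > 0" for e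
        proof -
          obtain n where n: "cnorm A (z \<ominus> c n) < e / 2" using dense[OF z, of "e / 2"] e by auto
          have *: "\<bar>Re (\<psi> z) - Re (\<psi> (c n))\<bar> \<le> e / 2" if "\<psi> \<in> states A" for \<psi>
          proof -
            have "\<psi> (z \<ominus> c n) = \<psi> z - \<psi> (c n)"
              using that z c by (intro pf_diff) (auto simp: states_def)
            then have "cmod (\<psi> z - \<psi> (c n)) \<le> e / 2"
              using state_cmod_le[OF that, of "z \<ominus> c n"] n z c by simp
            then show ?thesis using abs_Re_le_cmod[of "\<psi> z - \<psi> (c n)"] by simp
          qed
          show ?thesis using *[OF \<phi>12(1)] *[OF \<phi>(1)] Re_c[of n] by linarith
        qed
        from field_le_epsilon[OF this] show ?thesis by simp
      qed
      have Im_eq: "Im (\<phi>1 x) = Im (\<phi> x)"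
        using Re_eq[of "(- \<i>) \<odot> x"] x \<phi>12(1) \<phi>(1) by (simp add: states_def pf_smult)
      show "\<phi>1 x = \<phi> x" using Re_eq[OF x] Im_eq by (simp add: complex_eq_iff)
    qed
    show "extreme_state A \<phi>"
      unfolding extreme_state_def using \<phi>(1) unique by blast
  qed
qed

lemma Re_Im_decomposition:
  assumes y: "y \<in> carrier A"
  obtains a b where "a \<in> carrier A" "adj A a = a" "b \<in> carrier A" "adj A b = b" "y = a \<oplus> \<i> \<odot> b"
proof
  show "(1/2) \<odot> (y \<oplus> adj A y) \<in> carrier A" "(- \<i>/2) \<odot> (y \<ominus> adj A y) \<in> carrier A" using y by auto
  show "adj A ((1/2) \<odot> (y \<oplus> adj A y)) = (1/2) \<odot> (y \<oplus> adj A y)"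
    using y by (simp add: adj_simps A.a_comm)
  show "adj A ((- \<i>/2) \<odot> (y \<ominus> adj A y)) = (- \<i>/2) \<odot> (y \<ominus> adj A y)"
    using y by (simp add: adj_simps a_minus_def smult_add_right smult_minus_right A.a_comm)
  have "(1/2) \<odot> (y \<oplus> adj A y) \<oplus> \<i> \<odot> ((- \<i>/2) \<odot> (y \<ominus> adj A y)) = (1/2) \<odot> (y \<oplus> adj A y) \<oplus> (1/2) \<odot> (y \<ominus> adj A y)"
    using y by (simp add: smult_smult)
  also have "\<dots> = (1/2) \<odot> ((y \<oplus> adj A y) \<oplus> (y \<ominus> adj A y))" using y by (simp add: smult_add_right)
  also have "(y \<oplus> adj A y) \<oplus> (y \<ominus> adj A y) = 2 \<odot> y"
    using smult_add_left[of y 1 1] y by (simp add: A.ring_simprules add_cancel)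
  finally show "y = (1/2) \<odot> (y \<oplus> adj A y) \<oplus> \<i> \<odot> ((- \<i>/2) \<odot> (y \<ominus> adj A y))"
    using y by (simp add: smult_smult)
qed

text \<open>
  An extreme state \<open>\<phi>\<close> is multiplicative: for self-adjoint \<open>h\<close> with \<open>\<parallel>h\<parallel> < 1\<close> both \<open>1 + h\<close>
  and \<open>1 - h\<close> are squares, so \<open>\<phi>\<close> is a convex combination of the states obtained by
  normalising \<open>\<phi> ((1 + h) x)\<close> and \<open>\<phi> ((1 - h) x)\<close>. Both must equal \<open>\<phi>\<close>.
\<close>

lemma extreme_state_multiplicative:
  assumes "cring A" and ext: "extreme_state A \<phi>"
    and y: "y \<in> carrier A" and x: "x \<in> carrier A"
  shows "\<phi> (y \<otimes> x) = \<phi> y * \<phi> x"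
proof -
  interpret C: cring A by fact
  have \<phi>: "\<phi> \<in> states A" using ext by (simp add: extreme_state_def)
  then have pf: "positive_functional A \<phi>" and \<phi>1: "\<phi> \<one> = 1" by (auto simp: states_def)
  have Rephi: "\<phi> h = complex_of_real (Re (\<phi> h))" if "h \<in> carrier A" "adj A h = h" for h
    using pf_adj[OF pf that(1)] that(2) by (simp add: complex_eq_iff)
  define \<tau> where "\<tau> h x = (if x \<in> carrier A then \<phi> ((\<one> \<oplus> h) \<otimes> x) / (1 + \<phi> h) else 0)" for h x
  have \<tau>: "\<tau> h \<in> states A" if h: "h \<in> carrier A" "adj A h = h" "cnorm A h < 1" for h
  proof -
    obtain s where s: "s \<in> carrier A" "adj A s = s" "s \<otimes> s = \<one> \<oplus> h"
    proof -
      have "\<ominus> h \<in> carrier A" "adj A (\<ominus> h) = \<ominus> h" "cnorm A (\<ominus> h) < 1"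
        using h by (auto simp: adj_uminus cnorm_a_inv)
      from sqrt_one_minus[OF this] show ?thesis using that h
        by (metis A.minus_minus a_minus_def)
    qed
    have less: "0 < Re (1 + \<phi> h)"
      using state_cmod_le[OF \<phi> h(1)] h(3) abs_Re_le_cmod[of "\<phi> h"] by simp
    have real: "1 + \<phi> h = complex_of_real (Re (1 + \<phi> h))" using Rephi[OF h(1,2)] by (simp add: complex_eq_iff)
    have ne: "1 + \<phi> h \<noteq> 0" using less by (metis less_irrefl zero_complex.sel(1))
    have sq: "\<phi> ((\<one> \<oplus> h) \<otimes> (adj A z \<otimes> z)) \<in> \<real>\<^sub>\<ge>\<^sub>0" if z: "z \<in> carrier A" for z
    proof -
      have "(\<one> \<oplus> h) \<otimes> (adj A z \<otimes> z) = adj A (s \<otimes> z) \<otimes> (s \<otimes> z)"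
        unfolding s(3)[symmetric] using s(1,2) z by (simp add: adj_mult C.m_ac)
      then show ?thesis using pf_square[OF pf, of "s \<otimes> z"] s z by simp
    qed
    have "positive_functional A (\<tau> h)"
      unfolding positive_functional_def
    proof (intro conjI ballI allI)
      fix z assume z: "z \<in> carrier A"
      have "\<tau> h (adj A z \<otimes> z) = \<phi> ((\<one> \<oplus> h) \<otimes> (adj A z \<otimes> z)) / complex_of_real (Re (1 + \<phi> h))"
        using z real by (simp add: \<tau>_def)
      then show "\<tau> h (adj A z \<otimes> z) \<in> \<real>\<^sub>\<ge>\<^sub>0"
        using sq[OF z] less by (simp add: complex_nonneg_Reals_iff del: of_real_add plus_complex.sel)
    qed (use h in \<open>auto simp: \<tau>_def A.r_distr smult_simps pf_add[OF pf] pf_smult[OF pf] add_divide_distrib\<close>)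
    moreover have "\<tau> h \<one> = 1" using h ne \<phi>1 by (simp add: \<tau>_def pf_add[OF pf])
    ultimately show ?thesis by (simp add: states_def \<tau>_def)
  qed
  have small: "\<phi> (h \<otimes> x) = \<phi> h * \<phi> x"
    if h: "h \<in> carrier A" "adj A h = h" "cnorm A h < 1" and x: "x \<in> carrier A" for h x
  proof -
    define t where "t = (1 + Re (\<phi> h)) / 2"
    have lt: "\<bar>Re (\<phi> h)\<bar> < 1"
      using state_cmod_le[OF \<phi> h(1)] h(3) abs_Re_le_cmod[of "\<phi> h"] by simp
    define r where "r = \<phi> h"
    have r: "complex_of_real t = (1 + r) / 2" "complex_of_real (1 - t) = (1 - r) / 2"
      using Rephi[OF h(1,2)] by (auto simp: t_def r_def complex_eq_iff)
    have ne: "1 + r \<noteq> 0" "1 - r \<noteq> 0" using lt by (auto simp: r_def complex_eq_iff)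
    have half: "z / 2 * (w / z) = w / 2" if "z \<noteq> 0" for z w :: complex using that by simp
    have "\<phi> x = complex_of_real t * \<tau> h x + complex_of_real (1 - t) * \<tau> (\<ominus> h) x"
      if x: "x \<in> carrier A" for x
    proof -
      have "complex_of_real t * \<tau> h x = (\<phi> x + \<phi> (h \<otimes> x)) / 2"
        using x h(1) unfolding r half[OF ne(1), of "\<phi> x + \<phi> (h \<otimes> x)", symmetric]
        by (simp add: \<tau>_def r_def[symmetric] A.l_distr pf_add[OF pf])
      moreover have "complex_of_real (1 - t) * \<tau> (\<ominus> h) x = (\<phi> x - \<phi> (h \<otimes> x)) / 2"
        using x h(1) unfolding r half[OF ne(2), of "\<phi> x - \<phi> (h \<otimes> x)", symmetric]
        by (simp add: \<tau>_def pf_uminus[OF pf] r_def[symmetric] A.l_distr A.l_minus pf_add[OF pf])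
      ultimately have "complex_of_real t * \<tau> h x + complex_of_real (1 - t) * \<tau> (\<ominus> h) x
          = (\<phi> x + \<phi> (h \<otimes> x)) / 2 + (\<phi> x - \<phi> (h \<otimes> x)) / 2" by (simp only:)
      also have "\<dots> = \<phi> x" by (simp add: field_simps)
      finally show ?thesis by simp
    qed
    moreover have "\<tau> h \<in> states A" "\<tau> (\<ominus> h) \<in> states A"
      using h by (auto simp: adj_uminus cnorm_a_inv intro!: \<tau>)
    moreover have "0 < t" "t < 1" using lt by (auto simp: t_def)
    ultimately have "\<tau> h x = \<phi> x" using ext x unfolding extreme_state_def by blast
    then have "\<phi> x + \<phi> (h \<otimes> x) = (1 + r) * \<phi> x"
      using x h ne by (simp add: \<tau>_def r_def[symmetric] A.l_distr pf_add[OF pf] field_simps)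
    then show ?thesis by (simp add: r_def algebra_simps)
  qed
  have sa: "\<phi> (h \<otimes> x) = \<phi> h * \<phi> x"
    if h: "h \<in> carrier A" "adj A h = h" and x: "x \<in> carrier A" for h x
  proof -
    define k where "k = complex_of_real (1 / (cnorm A h + 1))"
    have k: "k \<noteq> 0" using cnorm_nonneg[OF h(1)] unfolding k_def of_real_eq_0_iff by simp
    have "\<phi> ((k \<odot> h) \<otimes> x) = \<phi> (k \<odot> h) * \<phi> x"
    proof (rule small)
      show "cnorm A (k \<odot> h) < 1"
        unfolding k_def cnorm_smult[OF h(1)] norm_of_real using cnorm_nonneg[OF h(1)] by simp
    qed (use h x in \<open>auto simp: k_def adj_simps\<close>)
    then show ?thesis using h x k by (simp add: smult_simps pf_smult[OF pf])
  qed
  obtain a b where ab: "a \<in> carrier A" "adj A a = a" "b \<in> carrier A" "adj A b = b" "y = a \<oplus> \<i> \<odot> b"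
    using Re_Im_decomposition[OF y] by metis
  then show ?thesis using x sa[OF ab(1,2) x] sa[OF ab(3,4) x]
    by (simp add: A.l_distr smult_simps pf_add[OF pf] pf_smult[OF pf] algebra_simps)
qed

text \<open>The minimum of \<open>Re \<phi> b\<close> over all states is attained at an extreme state, a character.\<close>

theorem state_nonneg_if_characters_nonneg:
  assumes "cring A" "separable_cstar A" and \<omega>: "positive_functional A \<omega>" "\<omega> \<one> = 1"
    and b: "b \<in> carrier A" and pos: "\<And>\<kappa>. \<kappa> \<in> characters A \<Longrightarrow> 0 \<le> Re (\<kappa> b)"
  shows "0 \<le> Re (\<omega> b)"
proof -
  define \<phi>0 where "\<phi>0 x = (if x \<in> carrier A then \<omega> x else 0)" for x
  have "\<phi>0 \<in> states A"
    using \<omega> by (auto simp: states_def \<phi>0_def positive_functional_def)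
  from exists_extreme_state[OF assms(2) this b] obtain \<phi> where
    \<phi>: "extreme_state A \<phi>" "Re (\<phi> b) \<le> Re (\<phi>0 b)" .
  have "\<phi> \<in> characters A"
    using extreme_state_multiplicative[OF assms(1) \<phi>(1)] \<phi>(1)
    by (auto simp: characters_def extreme_state_def)
  then show ?thesis using pos \<phi>(2) b by (force simp: \<phi>0_def)
qed

end

section \<open>Functions on the character space and the integral of a state\<close>

locale commutative_state = unital_cstar_algebra A for A :: "'a cstar" (structure) +
  fixes \<omega> :: "'a \<Rightarrow> complex"
  assumes comm: "cring A" and sep: "separable_cstar A"
    and \<omega>_pos: "positive_functional A \<omega>" and \<omega>_one: "\<omega> \<one> = 1"
begin

abbreviation "K \<equiv> characters A"

definition approximable :: "(('a \<Rightarrow> complex) \<Rightarrow> real) \<Rightarrow> bool"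
  where "approximable F \<longleftrightarrow>
    (\<forall>e>0. \<exists>a\<in>carrier A. \<forall>\<kappa>\<in>K. cmod (\<kappa> a - complex_of_real (F \<kappa>)) \<le> e)"

text \<open>The upper integral; on approximable functions it is the integral against \<open>\<omega>\<close>.\<close>

definition mean :: "(('a \<Rightarrow> complex) \<Rightarrow> real) \<Rightarrow> real"
  where "mean F = Inf {Re (\<omega> a) | a. a \<in> carrier A \<and> (\<forall>\<kappa>\<in>K. F \<kappa> \<le> Re (\<kappa> a))}"

lemma character:
  assumes "\<kappa> \<in> K"
  shows character_pf: "positive_functional A \<kappa>" and character_one: "\<kappa> \<one> = 1"
    and character_mult: "\<lbrakk>x \<in> carrier A; y \<in> carrier A\<rbrakk> \<Longrightarrow> \<kappa> (x \<otimes> y) = \<kappa> x * \<kappa> y"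
    and character_cmod_le: "x \<in> carrier A \<Longrightarrow> cmod (\<kappa> x) \<le> cnorm A x"
  using assms state_cmod_le[of \<kappa> x] by (auto simp: characters_def states_def)

lemmas character_simps =
  pf_add[OF character_pf] pf_diff[OF character_pf] pf_smult[OF character_pf]
  pf_adj[OF character_pf] character_one character_mult

lemma character_sa: "\<lbrakk>\<kappa> \<in> K; x \<in> carrier A; adj A x = x\<rbrakk> \<Longrightarrow> \<kappa> x = complex_of_real (Re (\<kappa> x))"
  using pf_adj[OF character_pf, of \<kappa> x] by (simp add: complex_eq_iff)

lemma Re_\<omega>_mono:
  assumes "a \<in> carrier A" "b \<in> carrier A" "\<And>\<kappa>. \<kappa> \<in> K \<Longrightarrow> Re (\<kappa> a) \<le> Re (\<kappa> b) + e"
  shows "Re (\<omega> a) \<le> Re (\<omega> b) + e"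
proof -
  have "0 \<le> Re (\<omega> ((b \<oplus> complex_of_real e \<odot> \<one>) \<ominus> a))"
    by (rule state_nonneg_if_characters_nonneg[OF comm sep \<omega>_pos \<omega>_one])
      (use assms in \<open>auto simp: character_simps\<close>)
  then show ?thesis
    using assms(1,2) by (simp add: pf_add[OF \<omega>_pos] pf_diff[OF \<omega>_pos] pf_smult[OF \<omega>_pos] \<omega>_one)
qed

lemma characters_nonempty: "K \<noteq> {}"
  using Re_\<omega>_mono[of \<zero> \<zero> "-1"] by auto

text \<open>
  Inequalities at all characters pass to \<open>\<omega>\<close>, so an element that is uniformly close to \<open>F\<close>
  determines the infimum up to the same error.
\<close>

lemma mean_approx:
  assumes a: "a \<in> carrier A" and near: "\<And>\<kappa>. \<kappa> \<in> K \<Longrightarrow> \<bar>Re (\<kappa> a) - F \<kappa>\<bar> \<le> e"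
  shows "\<bar>Re (\<omega> a) - mean F\<bar> \<le> e"
proof -
  define S where "S = {Re (\<omega> a) | a. a \<in> carrier A \<and> (\<forall>\<kappa>\<in>K. F \<kappa> \<le> Re (\<kappa> a))}"
  have up: "Re (\<omega> a) + e \<in> S"
  proof -
    have "Re (\<omega> (a \<oplus> complex_of_real e \<odot> \<one>)) \<in> S"
      unfolding S_def using a near by (force simp: character_simps)
    then show ?thesis using a by (simp add: pf_add[OF \<omega>_pos] pf_smult[OF \<omega>_pos] \<omega>_one)
  qed
  have low: "Re (\<omega> a) - e \<le> s" if s: "s \<in> S" for s
  proof -
    obtain b where b: "b \<in> carrier A" "\<And>\<kappa>. \<kappa> \<in> K \<Longrightarrow> F \<kappa> \<le> Re (\<kappa> b)" "s = Re (\<omega> b)"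
      using s unfolding S_def by blast
    have "Re (\<omega> a) \<le> Re (\<omega> b) + e"
    proof (rule Re_\<omega>_mono[OF a b(1)])
      show "Re (\<kappa> a) \<le> Re (\<kappa> b) + e" if "\<kappa> \<in> K" for \<kappa>
        using near[OF that] b(2)[OF that] by linarith
    qed
    then show ?thesis using b(3) by simp
  qed
  have "bdd_below S" using low by (auto intro!: bdd_belowI)
  then have "mean F \<le> Re (\<omega> a) + e" using up unfolding mean_def S_def[symmetric] by (rule cInf_lower[rotated])
  moreover have "Re (\<omega> a) - e \<le> mean F"
    unfolding mean_def S_def[symmetric] using up low by (intro cInf_greatest) auto
  ultimately show ?thesis by linarith
qed

lemma approximableD:
  assumes "approximable F" "e > 0"
  shows "\<exists>a\<in>carrier A. (\<forall>\<kappa>\<in>K. cmod (\<kappa> a - complex_of_real (F \<kappa>)) \<le> e) \<and>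
    (\<forall>\<kappa>\<in>K. \<bar>Re (\<kappa> a) - F \<kappa>\<bar> \<le> e) \<and> \<bar>Re (\<omega> a) - mean F\<bar> \<le> e"
proof -
  obtain a where a: "a \<in> carrier A" "\<forall>\<kappa>\<in>K. cmod (\<kappa> a - complex_of_real (F \<kappa>)) \<le> e"
    using assms unfolding approximable_def by blast
  have re: "\<bar>Re (\<kappa> a) - F \<kappa>\<bar> \<le> e" if "\<kappa> \<in> K" for \<kappa>
    using bspec[OF a(2) that] abs_Re_le_cmod[of "\<kappa> a - complex_of_real (F \<kappa>)"] by simp
  then have "\<bar>Re (\<omega> a) - mean F\<bar> \<le> e" by (rule mean_approx[OF a(1)])
  then show ?thesis using a re by blast
qed

lemma approximable_bounded:
  assumes "approximable F"
  shows "\<exists>M>0. \<forall>\<kappa>\<in>K. \<bar>F \<kappa>\<bar> \<le> M"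
proof -
  obtain a where a: "a \<in> carrier A" "\<And>\<kappa>. \<kappa> \<in> K \<Longrightarrow> \<bar>Re (\<kappa> a) - F \<kappa>\<bar> \<le> 1"
    using approximableD[OF assms zero_less_one] by blast
  have "\<bar>F \<kappa>\<bar> \<le> cnorm A a + 1" if "\<kappa> \<in> K" for \<kappa>
    using a(2)[OF that] character_cmod_le[OF that a(1)] abs_Re_le_cmod[of "\<kappa> a"] by linarith
  moreover have "cnorm A a + 1 > 0" using cnorm_nonneg[OF a(1)] by simp
  ultimately show ?thesis by blast
qed

lemma approximable_element:
  assumes "a \<in> carrier A" "\<And>\<kappa>. \<kappa> \<in> K \<Longrightarrow> \<kappa> a = complex_of_real (F \<kappa>)"
  shows "approximable F"
  unfolding approximable_def using assms by (intro allI impI bexI[of _ a]) auto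

lemma approximable_const: "approximable (\<lambda>_. c)"
  by (rule approximable_element[of "complex_of_real c \<odot> \<one>"]) (auto simp: character_simps)

lemma approximable_add:
  assumes "approximable F" "approximable G" shows "approximable (\<lambda>\<kappa>. F \<kappa> + G \<kappa>)"
  unfolding approximable_def
proof (intro allI impI)
  fix e :: real assume "e > 0"
  then have e: "e / 2 > 0" by simp
  obtain a where a: "a \<in> carrier A" "\<And>\<kappa>. \<kappa> \<in> K \<Longrightarrow> cmod (\<kappa> a - complex_of_real (F \<kappa>)) \<le> e / 2"
    using approximableD[OF assms(1) e] by blast
  obtain b where b: "b \<in> carrier A" "\<And>\<kappa>. \<kappa> \<in> K \<Longrightarrow> cmod (\<kappa> b - complex_of_real (G \<kappa>)) \<le> e / 2"
    using approximableD[OF assms(2) e] by blast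
  have "cmod (\<kappa> (a \<oplus> b) - complex_of_real (F \<kappa> + G \<kappa>)) \<le> e" if "\<kappa> \<in> K" for \<kappa>
    using norm_add_rule_thm[OF a(2)[OF that] b(2)[OF that]] a(1) b(1) that
    by (simp add: character_simps algebra_simps)
  then show "\<exists>a\<in>carrier A. \<forall>\<kappa>\<in>K. cmod (\<kappa> a - complex_of_real (F \<kappa> + G \<kappa>)) \<le> e"
    using a(1) b(1) by blast
qed

lemma approximable_mult:
  assumes "approximable F" "approximable G" shows "approximable (\<lambda>\<kappa>. F \<kappa> * G \<kappa>)"
  unfolding approximable_def
proof (intro allI impI)
  fix e :: real assume "e > 0"
  obtain M where M: "M > 0" "\<And>\<kappa>. \<kappa> \<in> K \<Longrightarrow> \<bar>F \<kappa>\<bar> \<le> M" using approximable_bounded[OF assms(1)] by blast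
  obtain N where N: "N > 0" "\<And>\<kappa>. \<kappa> \<in> K \<Longrightarrow> \<bar>G \<kappa>\<bar> \<le> N" using approximable_bounded[OF assms(2)] by blast
  define d where "d = min 1 (e / (M + N + 1))"
  have d: "d > 0" "d \<le> 1" using \<open>e > 0\<close> M(1) N(1) by (auto simp: d_def)
  have "d \<le> e / (M + N + 1)" by (simp add: d_def)
  then have d3: "d * (M + N + 1) \<le> e" using M(1) N(1) by (simp add: pos_le_divide_eq)
  obtain a where a: "a \<in> carrier A" "\<And>\<kappa>. \<kappa> \<in> K \<Longrightarrow> cmod (\<kappa> a - complex_of_real (F \<kappa>)) \<le> d"
    using approximableD[OF assms(1) d(1)] by blast
  obtain b where b: "b \<in> carrier A" "\<And>\<kappa>. \<kappa> \<in> K \<Longrightarrow> cmod (\<kappa> b - complex_of_real (G \<kappa>)) \<le> d"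
    using approximableD[OF assms(2) d(1)] by blast
  have "cmod (\<kappa> (a \<otimes> b) - complex_of_real (F \<kappa> * G \<kappa>)) \<le> e" if \<kappa>: "\<kappa> \<in> K" for \<kappa>
  proof -
    define p q where "p = \<kappa> a - complex_of_real (F \<kappa>)" and "q = \<kappa> b - complex_of_real (G \<kappa>)"
    have pq: "cmod p \<le> d" "cmod q \<le> d" using a(2) b(2) \<kappa> by (auto simp: p_def q_def)
    have "\<kappa> (a \<otimes> b) - complex_of_real (F \<kappa> * G \<kappa>) =
        complex_of_real (F \<kappa>) * q + p * complex_of_real (G \<kappa>) + p * q"
      using a(1) b(1) \<kappa> by (simp add: character_simps p_def q_def algebra_simps)
    also have "cmod \<dots> \<le> M * d + d * N + d * 1"
    proof (intro norm_add_rule_thm)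
      show "cmod (complex_of_real (F \<kappa>) * q) \<le> M * d"
        unfolding norm_mult using pq M \<kappa> by (intro mult_mono) auto
      show "cmod (p * complex_of_real (G \<kappa>)) \<le> d * N"
        unfolding norm_mult using pq N \<kappa> d by (intro mult_mono) auto
      show "cmod (p * q) \<le> d * 1"
        unfolding norm_mult using pq d by (intro mult_mono) auto
    qed
    also have "\<dots> \<le> e" using d3 by (simp add: algebra_simps)
    finally show ?thesis .
  qed
  then show "\<exists>a\<in>carrier A. \<forall>\<kappa>\<in>K. cmod (\<kappa> a - complex_of_real (F \<kappa> * G \<kappa>)) \<le> e"
    using a(1) b(1) by blast
qed

lemma approximable_diff:
  assumes "approximable F" "approximable G" shows "approximable (\<lambda>\<kappa>. F \<kappa> - G \<kappa>)"
  using approximable_add[OF assms(1) approximable_mult[OF approximable_const[of "-1"] assms(2)]] by simp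

lemma approximable_sum:
  assumes "finite I" "\<And>i. i \<in> I \<Longrightarrow> approximable (F i)"
  shows "approximable (\<lambda>\<kappa>. \<Sum>i\<in>I. F i \<kappa>)"
  using assms by (induction I) (auto intro: approximable_const approximable_add)

lemma approximable_prod:
  assumes "finite I" "\<And>i. i \<in> I \<Longrightarrow> approximable (F i)"
  shows "approximable (\<lambda>\<kappa>. \<Prod>i\<in>I. F i \<kappa>)"
  using assms by (induction I) (auto intro: approximable_const approximable_mult)

lemmas approximable_intros = approximable_const approximable_add approximable_diff
  approximable_mult approximable_sum approximable_prod

lemma approximable_uniform_limit:
  assumes "\<And>e. e > 0 \<Longrightarrow> \<exists>G. approximable G \<and> (\<forall>\<kappa>\<in>K. \<bar>F \<kappa> - G \<kappa>\<bar> \<le> e)"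
  shows "approximable F"
  unfolding approximable_def
proof (intro allI impI)
  fix e :: real assume "e > 0"
  then have e: "e / 2 > 0" by simp
  obtain G where G: "approximable G" "\<And>\<kappa>. \<kappa> \<in> K \<Longrightarrow> \<bar>F \<kappa> - G \<kappa>\<bar> \<le> e / 2" using assms[OF e] by blast
  obtain a where a: "a \<in> carrier A" "\<And>\<kappa>. \<kappa> \<in> K \<Longrightarrow> cmod (\<kappa> a - complex_of_real (G \<kappa>)) \<le> e / 2"
    using approximableD[OF G(1) e] by blast
  have "cmod (\<kappa> a - complex_of_real (F \<kappa>)) \<le> e" if "\<kappa> \<in> K" for \<kappa>
  proof -
    have "cmod (complex_of_real (G \<kappa>) - complex_of_real (F \<kappa>)) \<le> e / 2"
      using G(2)[OF that] by (simp add: abs_minus_commute norm_of_real flip: of_real_diff)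
    from norm_add_rule_thm[OF a(2)[OF that] this] show ?thesis by simp
  qed
  then show "\<exists>a\<in>carrier A. \<forall>\<kappa>\<in>K. cmod (\<kappa> a - complex_of_real (F \<kappa>)) \<le> e" using a(1) by blast
qed

lemma approximable_continuous:
  assumes F: "approximable F" and g: "continuous_on UNIV (g :: real \<Rightarrow> real)"
  shows "approximable (\<lambda>\<kappa>. g (F \<kappa>))"
proof (rule approximable_uniform_limit)
  fix e :: real assume e: "e > 0"
  obtain M where M: "\<And>\<kappa>. \<kappa> \<in> K \<Longrightarrow> \<bar>F \<kappa>\<bar> \<le> M" using approximable_bounded[OF F] by blast
  obtain p where p: "real_polynomial_function p" "\<And>t. t \<in> {-M..M} \<Longrightarrow> \<bar>g t - p t\<bar> < e"
    using Stone_Weierstrass_real_polynomial_function[of "{-M..M}" g e] continuous_on_subset[OF g subset_UNIV] e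
    by blast
  have "approximable (\<lambda>\<kappa>. p (F \<kappa>))"
    using p(1)
  proof (induction rule: real_polynomial_function.induct)
    case (linear f)
    have "f t = t * f 1" for t
      using linear_scale[OF bounded_linear.linear[OF linear], of t 1] by simp
    then have "(\<lambda>\<kappa>. f (F \<kappa>)) = (\<lambda>\<kappa>. F \<kappa> * f 1)" by blast
    then show ?case using approximable_mult[OF F approximable_const[of "f 1"]] by simp
  qed (auto intro: approximable_intros)
  moreover have "\<forall>\<kappa>\<in>K. \<bar>g (F \<kappa>) - p (F \<kappa>)\<bar> \<le> e"
  proof
    fix \<kappa> assume "\<kappa> \<in> K"
    then have "F \<kappa> \<in> {-M..M}" using M[of \<kappa>] by auto
    then show "\<bar>g (F \<kappa>) - p (F \<kappa>)\<bar> \<le> e" using p(2)[of "F \<kappa>"] by simp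
  qed
  ultimately show "\<exists>G. approximable G \<and> (\<forall>\<kappa>\<in>K. \<bar>g (F \<kappa>) - G \<kappa>\<bar> \<le> e)" by blast
qed

lemma mean_mono:
  assumes "approximable F" "approximable G" "\<And>\<kappa>. \<kappa> \<in> K \<Longrightarrow> F \<kappa> \<le> G \<kappa>"
  shows "mean F \<le> mean G"
proof (rule field_le_epsilon)
  fix e :: real assume "e > 0"
  then have e: "e / 4 > 0" by simp
  obtain a where a: "a \<in> carrier A" "\<And>\<kappa>. \<kappa> \<in> K \<Longrightarrow> \<bar>Re (\<kappa> a) - F \<kappa>\<bar> \<le> e / 4"
    "\<bar>Re (\<omega> a) - mean F\<bar> \<le> e / 4" using approximableD[OF assms(1) e] by blast
  obtain b where b: "b \<in> carrier A" "\<And>\<kappa>. \<kappa> \<in> K \<Longrightarrow> \<bar>Re (\<kappa> b) - G \<kappa>\<bar> \<le> e / 4"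
    "\<bar>Re (\<omega> b) - mean G\<bar> \<le> e / 4" using approximableD[OF assms(2) e] by blast
  have "Re (\<omega> a) \<le> Re (\<omega> b) + e / 2"
  proof (rule Re_\<omega>_mono[OF a(1) b(1)])
    show "Re (\<kappa> a) \<le> Re (\<kappa> b) + e / 2" if "\<kappa> \<in> K" for \<kappa>
      using a(2)[OF that] b(2)[OF that] assms(3)[OF that] by linarith
  qed
  then show "mean F \<le> mean G + e" using a(3) b(3) by linarith
qed

lemma mean_eq:
  assumes "a \<in> carrier A" "\<And>\<kappa>. \<kappa> \<in> K \<Longrightarrow> Re (\<kappa> a) = F \<kappa>"
  shows "mean F = Re (\<omega> a)"
  using mean_approx[of a F 0] assms by simp

lemma mean_const: "mean (\<lambda>_. c) = c"
  using mean_eq[of "complex_of_real c \<odot> \<one>" "\<lambda>_. c"]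
  by (simp add: character_simps pf_smult[OF \<omega>_pos] \<omega>_one)

lemma mean_add:
  assumes "approximable F" "approximable G"
  shows "mean (\<lambda>\<kappa>. F \<kappa> + G \<kappa>) = mean F + mean G"
proof -
  have "\<bar>mean (\<lambda>\<kappa>. F \<kappa> + G \<kappa>) - (mean F + mean G)\<bar> \<le> 0 + e" if "e > 0" for e
  proof -
    have e: "e / 4 > 0" using that by simp
    obtain a where a: "a \<in> carrier A" "\<And>\<kappa>. \<kappa> \<in> K \<Longrightarrow> \<bar>Re (\<kappa> a) - F \<kappa>\<bar> \<le> e / 4"
      "\<bar>Re (\<omega> a) - mean F\<bar> \<le> e / 4" using approximableD[OF assms(1) e] by blast
    obtain b where b: "b \<in> carrier A" "\<And>\<kappa>. \<kappa> \<in> K \<Longrightarrow> \<bar>Re (\<kappa> b) - G \<kappa>\<bar> \<le> e / 4"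
      "\<bar>Re (\<omega> b) - mean G\<bar> \<le> e / 4" using approximableD[OF assms(2) e] by blast
    have "\<bar>Re (\<omega> (a \<oplus> b)) - mean (\<lambda>\<kappa>. F \<kappa> + G \<kappa>)\<bar> \<le> e / 2"
    proof (rule mean_approx)
      show "\<bar>Re (\<kappa> (a \<oplus> b)) - (F \<kappa> + G \<kappa>)\<bar> \<le> e / 2" if "\<kappa> \<in> K" for \<kappa>
      proof -
        have "Re (\<kappa> (a \<oplus> b)) = Re (\<kappa> a) + Re (\<kappa> b)" using a(1) b(1) that by (simp add: character_simps)
        then show ?thesis using a(2)[OF that] b(2)[OF that] by linarith
      qed
    qed (use a(1) b(1) in auto)
    moreover have "Re (\<omega> (a \<oplus> b)) = Re (\<omega> a) + Re (\<omega> b)"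
      using a(1) b(1) by (simp add: pf_add[OF \<omega>_pos])
    ultimately show ?thesis using a(3) b(3) by linarith
  qed
  from field_le_epsilon[OF this] show ?thesis by simp
qed

lemma mean_cmult:
  assumes F: "approximable F"
  shows "mean (\<lambda>\<kappa>. c * F \<kappa>) = c * mean F"
proof -
  have "\<bar>mean (\<lambda>\<kappa>. c * F \<kappa>) - c * mean F\<bar> \<le> 0 + e" if "e > 0" for e
  proof -
    define d where "d = e / (2 * (\<bar>c\<bar> + 1))"
    have d: "d > 0" "\<bar>c\<bar> * d \<le> e / 2" using that by (auto simp: d_def field_simps)
    obtain a where a: "a \<in> carrier A" "\<And>\<kappa>. \<kappa> \<in> K \<Longrightarrow> \<bar>Re (\<kappa> a) - F \<kappa>\<bar> \<le> d"
      "\<bar>Re (\<omega> a) - mean F\<bar> \<le> d" using approximableD[OF F d(1)] by blast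
    have cd: "\<bar>c * x - c * y\<bar> \<le> e / 2" if "\<bar>x - y\<bar> \<le> d" for x y
      using mult_left_mono[OF that, of "\<bar>c\<bar>"] d(2) by (simp flip: abs_mult right_diff_distrib)
    have "\<bar>Re (\<omega> (complex_of_real c \<odot> a)) - mean (\<lambda>\<kappa>. c * F \<kappa>)\<bar> \<le> e / 2"
    proof (rule mean_approx)
      show "\<bar>Re (\<kappa> (complex_of_real c \<odot> a)) - c * F \<kappa>\<bar> \<le> e / 2" if "\<kappa> \<in> K" for \<kappa>
        using cd[OF a(2)[OF that]] a(1) that by (simp add: character_simps)
    qed (use a in auto)
    moreover have "Re (\<omega> (complex_of_real c \<odot> a)) = c * Re (\<omega> a)"
      using a(1) by (simp add: pf_smult[OF \<omega>_pos])
    ultimately show ?thesis using cd[OF a(3)] by linarith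
  qed
  from field_le_epsilon[OF this] show ?thesis by simp
qed

lemma mean_sum:
  assumes "finite I" "\<And>i. i \<in> I \<Longrightarrow> approximable (F i)"
  shows "mean (\<lambda>\<kappa>. \<Sum>i\<in>I. F i \<kappa>) = (\<Sum>i\<in>I. mean (F i))"
  using assms
proof (induction I)
  case (insert i I)
  then show ?case using mean_add[of "F i" "\<lambda>\<kappa>. \<Sum>i\<in>I. F i \<kappa>"] by (simp add: approximable_sum)
qed (simp add: mean_const)

text \<open>
  Among \<open>S\<close> continuous steps between \<open>a\<close> and \<open>b\<close> with disjoint transition zones, one has a
  zone of mass at most \<open>1 / S\<close>. The mass is measured by \<open>\<sigma> (1 - \<sigma>)\<close>, which vanishes where \<open>\<sigma>\<close> is \<open>0\<close> or \<open>1\<close>.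
\<close>

lemma soft_step:
  assumes D: "approximable D" and ab: "a < b" and \<delta>: "\<delta> > 0"
  obtains \<sigma> where "approximable \<sigma>" "mean (\<lambda>\<kappa>. \<sigma> \<kappa> * (1 - \<sigma> \<kappa>)) \<le> \<delta>"
    "\<And>\<kappa>. 0 \<le> \<sigma> \<kappa>" "\<And>\<kappa>. \<sigma> \<kappa> \<le> 1" "\<And>\<kappa>. D \<kappa> \<le> a \<Longrightarrow> \<sigma> \<kappa> = 0" "\<And>\<kappa>. b \<le> D \<kappa> \<Longrightarrow> \<sigma> \<kappa> = 1"
proof -
  obtain S :: nat where S: "1 / \<delta> < real S" using reals_Archimedean2 by blast
  have "0 < 1 / \<delta>" using \<delta> by simp
  then have S0: "real S > 0" using S by linarith
  define w where "w = (b - a) / real S"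
  have w: "w > 0" using ab S0 by (simp add: w_def)
  define \<theta> where "\<theta> k t = max 0 (min 1 ((t - a) / w - real k))" for k :: nat and t :: real
  define \<sigma> where "\<sigma> k \<kappa> = \<theta> k (D \<kappa>)" for k \<kappa>
  have \<sigma>a: "approximable (\<sigma> k)" for k
    unfolding \<sigma>_def \<theta>_def using w by (intro approximable_continuous[OF D] continuous_intros) auto
  have \<sigma>b: "approximable (\<lambda>\<kappa>. \<sigma> k \<kappa> * (1 - \<sigma> k \<kappa>))" for k
    using \<sigma>a by (intro approximable_intros)
  have term_le: "\<theta> k t * (1 - \<theta> k t) \<le> (if k = nat \<lfloor>(t - a) / w\<rfloor> then 1 else 0)" for k t
  proof (cases "real k \<le> (t - a) / w \<and> (t - a) / w < real k + 1")
    case True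
    then have "\<lfloor>(t - a) / w\<rfloor> = int k" by linarith
    moreover have "\<theta> k t * (1 - \<theta> k t) \<le> 1 * 1" by (intro mult_mono) (auto simp: \<theta>_def)
    ultimately show ?thesis by simp
  next
    case False
    then have "\<theta> k t = 0 \<or> \<theta> k t = 1" by (auto simp: \<theta>_def)
    then show ?thesis by auto
  qed
  have "(\<Sum>k<S. \<theta> k t * (1 - \<theta> k t)) \<le> 1" for t
  proof -
    have "(\<Sum>k<S. \<theta> k t * (1 - \<theta> k t)) \<le> (\<Sum>k<S. if k = nat \<lfloor>(t - a) / w\<rfloor> then 1 else 0)"
      by (intro sum_mono term_le)
    also have "\<dots> \<le> 1" by (simp add: sum.delta)
    finally show ?thesis .
  qed
  then have "mean (\<lambda>\<kappa>. \<Sum>k<S. \<sigma> k \<kappa> * (1 - \<sigma> k \<kappa>)) \<le> mean (\<lambda>_. 1)"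
    by (intro mean_mono approximable_sum approximable_const \<sigma>b) (auto simp: \<sigma>_def)
  then have tot: "(\<Sum>k<S. mean (\<lambda>\<kappa>. \<sigma> k \<kappa> * (1 - \<sigma> k \<kappa>))) \<le> 1"
    by (subst (asm) mean_sum) (auto simp: \<sigma>b mean_const)
  have "\<exists>k<S. mean (\<lambda>\<kappa>. \<sigma> k \<kappa> * (1 - \<sigma> k \<kappa>)) \<le> \<delta>"
  proof (rule ccontr)
    assume "\<not> ?thesis"
    then have "(\<Sum>k<S. \<delta>) \<le> (\<Sum>k<S. mean (\<lambda>\<kappa>. \<sigma> k \<kappa> * (1 - \<sigma> k \<kappa>)))"
      by (intro sum_mono) (auto simp: not_le intro: less_imp_le)
    then have "real S * \<delta> \<le> 1" using tot by simp
    then show False using S \<delta> by (simp add: field_simps)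
  qed
  then obtain k where k: "k < S" "mean (\<lambda>\<kappa>. \<sigma> k \<kappa> * (1 - \<sigma> k \<kappa>)) \<le> \<delta>" by blast
  show ?thesis
  proof (rule that[of "\<sigma> k", OF \<sigma>a k(2)])
    show "\<sigma> k \<kappa> = 0" if "D \<kappa> \<le> a" for \<kappa>
    proof -
      have "(D \<kappa> - a) / w \<le> 0" using that w by (simp add: divide_nonpos_pos)
      then show ?thesis by (simp add: \<sigma>_def \<theta>_def)
    qed
    show "\<sigma> k \<kappa> = 1" if "b \<le> D \<kappa>" for \<kappa>
    proof -
      have "real S = (b - a) / w" using S0 ab by (simp add: w_def)
      also have "\<dots> \<le> (D \<kappa> - a) / w" using that w by (simp add: divide_right_mono)
      finally have "1 \<le> (D \<kappa> - a) / w - real k" using k(1) by linarith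
      then show ?thesis by (simp add: \<sigma>_def \<theta>_def)
    qed
  qed (auto simp: \<sigma>_def \<theta>_def)
qed

end

section \<open>A single element that almost generates\<close>

text \<open>
  \<open>clip n\<close> retracts the line to \<open>[0, n - 1]\<close>; \<open>nearest n t\<close> is an index in \<open>{0..<n}\<close> next to
  \<open>clip n t\<close>; \<open>tent n l\<close> is a continuous function dominating the indicator of
  \<open>nearest n t = l\<close> and supported on the points within \<open>3/4\<close> of \<open>l\<close> after clipping.
\<close>

definition clip :: "nat \<Rightarrow> real \<Rightarrow> real"
  where "clip n t = max 0 (min (real n - 1) t)"

definition nearest :: "nat \<Rightarrow> real \<Rightarrow> nat"
  where "nearest n t = nat (round (clip n t))"

definition tent :: "nat \<Rightarrow> nat \<Rightarrow> real \<Rightarrow> real"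
  where "tent n l t = max 0 (min 1 (3 - 4 * \<bar>clip n t - real l\<bar>))"

lemma nearest_less:
  assumes "n > 0" shows "nearest n t < n"
proof -
  have "clip n t \<le> real_of_int (int n - 1)" using assms by (simp add: clip_def)
  then have "round (clip n t) \<le> round (real_of_int (int n - 1))" by (rule round_mono)
  then have "round (clip n t) \<le> int n - 1" by (simp only: round_of_int)
  then show ?thesis using assms by (simp add: nearest_def nat_less_iff)
qed

lemma tent_nearest:
  assumes "n > 0" shows "tent n (nearest n t) t = 1"
proof -
  have "clip n t \<ge> real_of_int 0" using assms by (simp add: clip_def)
  then have "round (clip n t) \<ge> round (real_of_int 0 :: real)" by (rule round_mono)
  then have "round (clip n t) \<ge> 0" by simp
  then have "real (nearest n t) = real_of_int (round (clip n t))" by (simp add: nearest_def)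
  then have "\<bar>clip n t - real (nearest n t)\<bar> \<le> 1/2"
    using of_int_round_abs_le[of "clip n t"] by (simp add: abs_minus_commute)
  then show ?thesis by (simp add: tent_def)
qed

lemma tent_bounds: "0 \<le> tent n l t" "tent n l t \<le> 1"
  by (auto simp: tent_def)

lemma continuous_on_tent: "continuous_on UNIV (tent n l)"
  unfolding tent_def clip_def by (intro continuous_intros)

lemma tent_eq_0:
  assumes "m < n" "l \<noteq> m" "\<bar>t - real m\<bar> \<le> 1/4"
  shows "tent n l t = 0"
proof -
  have "\<bar>clip n t - real m\<bar> \<le> 1/4" 
  proof -
    have "real m \<le> real n - 1" using assms(1) by simp
    then show ?thesis using assms(3) by (auto simp: clip_def max_def min_def)
  qed
  moreover have "\<bar>real l - real m\<bar> \<ge> 1"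
  proof (cases "l < m")
    case True
    then have "real l + 1 \<le> real m" by simp
    then show ?thesis by simp
  next
    case False
    then have "real m + 1 \<le> real l" using assms(2) by simp
    then show ?thesis by simp
  qed
  ultimately have "\<bar>clip n t - real l\<bar> \<ge> 3/4" by linarith
  then show ?thesis by (simp add: tent_def)
qed

text \<open>
  \<open>t (1 - t)\<close> measures how far \<open>t\<close> is from being \<open>0\<close> or \<open>1\<close>. The bound iterates the identity
  \<open>f g (1 - f g) = g f (1 - f) + f\<^sup>2 g (1 - g)\<close>.
\<close>

lemma prod_defect_le:
  fixes f :: "nat \<Rightarrow> real"
  assumes "\<And>i. 0 \<le> f i" "\<And>i. f i \<le> 1"
  shows "(\<Prod>i<n. f i) * (1 - (\<Prod>i<n. f i)) \<le> (\<Sum>i<n. f i * (1 - f i))"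
proof (induction n)
  case (Suc n)
  define p where "p = (\<Prod>i<n. f i)"
  have p: "0 \<le> p" "p \<le> 1" using assms by (auto simp: p_def intro: prod_nonneg prod_le_1)
  have "p * f n * (1 - p * f n) = f n * (p * (1 - p)) + p * (p * (f n * (1 - f n)))"
    by (simp add: algebra_simps)
  also have "\<dots> \<le> 1 * (p * (1 - p)) + 1 * (1 * (f n * (1 - f n)))"
    using p assms[of n] by (intro add_mono mult_mono mult_nonneg_nonneg) auto
  finally show ?case using Suc by (simp add: p_def)
qed simp

lemma first_zero_partition:
  fixes s :: "nat \<Rightarrow> real"
  shows "(\<Sum>l<n. (1 - s l) * (\<Prod>m<l. s m)) = 1 - (\<Prod>m<n. s m)"
  by (induction n) (auto simp: algebra_simps)

text \<open>Since the \<open>v l\<close> sum to \<open>1\<close>, the hypothesis bounds the mean of \<open>1 - v l\<close> with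
  weights \<open>v l\<close>.\<close>

lemma partition_concentrated:
  fixes v :: "nat \<Rightarrow> real"
  assumes v: "\<And>l. 0 \<le> v l" and sum: "(\<Sum>l<n. v l) = 1"
    and small: "(\<Sum>l<n. v l * (1 - v l)) < \<eta>"
  obtains m where "m < n" "v m > 1 - \<eta>"
proof -
  have "\<exists>m<n. v m > 1 - \<eta>"
  proof (rule ccontr)
    assume "\<not> ?thesis"
    then have "(\<Sum>l<n. v l * \<eta>) \<le> (\<Sum>l<n. v l * (1 - v l))"
      using v by (intro sum_mono mult_left_mono) auto
    then show False using small sum by (simp flip: sum_distrib_right)
  qed
  then show ?thesis using that by blast
qed

lemma weighted_index_near:
  fixes v :: "nat \<Rightarrow> real"
  assumes v: "\<And>l. 0 \<le> v l" and sum: "(\<Sum>l<n. v l) = 1" and m: "m < n"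
  shows "\<bar>(\<Sum>l<n. real l * v l) - real m\<bar> \<le> real n * (1 - v m)"
proof -
  have "(\<Sum>l<n. real l * v l) - real m = (\<Sum>l<n. (real l - real m) * v l)"
    using sum by (simp add: left_diff_distrib sum_subtractf flip: sum_distrib_left)
  also have "\<dots> = (\<Sum>l\<in>{..<n} - {m}. (real l - real m) * v l)"
    using m by (subst sum.remove[of _ m]) auto
  also have "\<bar>\<dots>\<bar> \<le> (\<Sum>l\<in>{..<n} - {m}. real n * v l)"
  proof (rule order_trans[OF sum_abs sum_mono])
    fix l assume l: "l \<in> {..<n} - {m}"
    have "\<bar>(real l - real m) * v l\<bar> = \<bar>real l - real m\<bar> * v l" using v[of l] by (simp add: abs_mult)
    also have "\<dots> \<le> real n * v l" using l m v[of l] by (intro mult_right_mono) auto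
    finally show "\<bar>(real l - real m) * v l\<bar> \<le> real n * v l" .
  qed
  also have "\<dots> = real n * (1 - v m)"
    using sum m by (simp add: sum_diff1 flip: sum_distrib_left)
  finally show ?thesis .
qed

context commutative_state
begin

text \<open>
  \<open>v l\<close> is the continuous version of the indicator of the characters for which \<open>l\<close> is the first
  index with \<open>D l\<close> small; the steps \<open>\<sigma> l\<close> that it is made of have small transition zones.
\<close>

lemma partition_with_small_overlap:
  fixes n :: nat
  assumes D: "\<And>l. approximable (D l)"
    and cover: "\<And>\<kappa>. \<kappa> \<in> K \<Longrightarrow> \<exists>l<n. D l \<kappa> \<le> a" and ab: "a < b" and \<delta>: "\<delta> > 0"
  obtains v where "\<And>l. approximable (v l)" "\<And>l \<kappa>. 0 \<le> v l \<kappa>"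
    "\<And>\<kappa>. \<kappa> \<in> K \<Longrightarrow> (\<Sum>l<n. v l \<kappa>) = 1" "\<And>l \<kappa>. v l \<kappa> > 0 \<Longrightarrow> D l \<kappa> < b"
    "mean (\<lambda>\<kappa>. \<Sum>l<n. v l \<kappa> * (1 - v l \<kappa>)) \<le> \<delta>"
proof -
  define d where "d = \<delta> / (real n + 1)^2"
  have d: "d > 0" using \<delta> by (simp add: d_def)
  have "\<exists>\<sigma>. approximable \<sigma> \<and> mean (\<lambda>\<kappa>. \<sigma> \<kappa> * (1 - \<sigma> \<kappa>)) \<le> d \<and> (\<forall>\<kappa>. 0 \<le> \<sigma> \<kappa> \<and> \<sigma> \<kappa> \<le> 1 \<and>
      (D l \<kappa> \<le> a \<longrightarrow> \<sigma> \<kappa> = 0) \<and> (b \<le> D l \<kappa> \<longrightarrow> \<sigma> \<kappa> = 1))" for l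
    by (rule soft_step[OF D[of l] ab d]) blast
  then obtain \<sigma> where \<sigma>: "\<forall>l. approximable (\<sigma> l) \<and> mean (\<lambda>\<kappa>. \<sigma> l \<kappa> * (1 - \<sigma> l \<kappa>)) \<le> d \<and>
      (\<forall>\<kappa>. 0 \<le> \<sigma> l \<kappa> \<and> \<sigma> l \<kappa> \<le> 1 \<and> (D l \<kappa> \<le> a \<longrightarrow> \<sigma> l \<kappa> = 0) \<and> (b \<le> D l \<kappa> \<longrightarrow> \<sigma> l \<kappa> = 1))"
    by metis
  have \<sigma>a: "approximable (\<sigma> l)" and \<sigma>i: "mean (\<lambda>\<kappa>. \<sigma> l \<kappa> * (1 - \<sigma> l \<kappa>)) \<le> d"
    and \<sigma>01: "0 \<le> \<sigma> l \<kappa>" "\<sigma> l \<kappa> \<le> 1" and \<sigma>0: "D l \<kappa> \<le> a \<Longrightarrow> \<sigma> l \<kappa> = 0"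
    and \<sigma>1: "b \<le> D l \<kappa> \<Longrightarrow> \<sigma> l \<kappa> = 1" for l \<kappa>
    using \<sigma> by auto
  define v where "v l \<kappa> = (1 - \<sigma> l \<kappa>) * (\<Prod>m<l. \<sigma> m \<kappa>)" for l \<kappa>
  have va: "approximable (v l)" for l
    unfolding v_def by (intro approximable_intros \<sigma>a) auto
  have defect: "v l \<kappa> * (1 - v l \<kappa>) \<le> (\<Sum>m<n. \<sigma> m \<kappa> * (1 - \<sigma> m \<kappa>))" if "l < n" for l \<kappa>
  proof -
    define f where "f m = (if m = l then 1 - \<sigma> m \<kappa> else \<sigma> m \<kappa>)" for m
    have "(\<Prod>m<Suc l. f m) = v l \<kappa>"
      by (simp add: f_def v_def mult.commute)
    moreover have "(\<Prod>m<Suc l. f m) * (1 - (\<Prod>m<Suc l. f m)) \<le> (\<Sum>m<Suc l. f m * (1 - f m))"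
      by (rule prod_defect_le) (use \<sigma>01 in \<open>auto simp: f_def\<close>)
    moreover have "(\<Sum>m<Suc l. f m * (1 - f m)) = (\<Sum>m<Suc l. \<sigma> m \<kappa> * (1 - \<sigma> m \<kappa>))"
      by (rule sum.cong) (auto simp: f_def)
    moreover have "(\<Sum>m<Suc l. \<sigma> m \<kappa> * (1 - \<sigma> m \<kappa>)) \<le> (\<Sum>m<n. \<sigma> m \<kappa> * (1 - \<sigma> m \<kappa>))"
      using that \<sigma>01 by (intro sum_mono2) auto
    ultimately show ?thesis by (simp only:)
  qed
  have sa: "approximable (\<lambda>\<kappa>. \<sigma> m \<kappa> * (1 - \<sigma> m \<kappa>))" for m
    by (intro approximable_intros \<sigma>a)
  have "mean (\<lambda>\<kappa>. \<Sum>l<n. v l \<kappa> * (1 - v l \<kappa>))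
      \<le> mean (\<lambda>\<kappa>. real n * (\<Sum>m<n. \<sigma> m \<kappa> * (1 - \<sigma> m \<kappa>)))"
  proof (rule mean_mono)
    show "(\<Sum>l<n. v l \<kappa> * (1 - v l \<kappa>)) \<le> real n * (\<Sum>m<n. \<sigma> m \<kappa> * (1 - \<sigma> m \<kappa>))" for \<kappa>
      using sum_mono[of "{..<n}" "\<lambda>l. v l \<kappa> * (1 - v l \<kappa>)", OF defect] by simp
  qed (intro approximable_intros va \<sigma>a; simp)+
  also have "\<dots> = real n * (\<Sum>m<n. mean (\<lambda>\<kappa>. \<sigma> m \<kappa> * (1 - \<sigma> m \<kappa>)))"
    using sa by (simp add: mean_cmult mean_sum approximable_sum)
  also have "\<dots> \<le> real n * (\<Sum>m<n. d)"
    by (intro mult_left_mono sum_mono \<sigma>i) auto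
  also have "\<dots> \<le> \<delta>"
  proof -
    have "real n * (real n * \<delta>) \<le> (real n + 1)^2 * \<delta>"
      using \<delta> by (simp add: power2_eq_square algebra_simps)
    then show ?thesis by (simp add: d_def field_simps)
  qed
  finally have int: "mean (\<lambda>\<kappa>. \<Sum>l<n. v l \<kappa> * (1 - v l \<kappa>)) \<le> \<delta>" .
  show ?thesis
  proof (rule that[OF va _ _ _ int])
    show "0 \<le> v l \<kappa>" for l \<kappa>
      unfolding v_def using \<sigma>01 by (intro mult_nonneg_nonneg prod_nonneg) auto
    show "(\<Sum>l<n. v l \<kappa>) = 1" if \<kappa>: "\<kappa> \<in> K" for \<kappa>
    proof -
      obtain l where "l < n" "\<sigma> l \<kappa> = 0" using cover[OF \<kappa>] \<sigma>0 by blast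
      then have "(\<Prod>m<n. \<sigma> m \<kappa>) = 0" by auto
      then show ?thesis unfolding v_def first_zero_partition by simp
    qed
    show "D l \<kappa> < b" if "v l \<kappa> > 0" for l \<kappa>
      using that \<sigma>1[of l \<kappa>] by (cases "D l \<kappa> < b") (auto simp: v_def)
  qed
qed

text \<open>
  The self-adjoint \<open>x\<close> is a continuous version of the function sending a character to the
  index of its cell. Away from a set of small mass its value determines the cell, on which
  \<open>D l\<close> is small; so the sum below, which measures how badly \<open>x\<close> separates the cells, has a
  small integral.
\<close>

lemma separating_element:
  fixes n :: nat
  assumes D: "\<And>l. approximable (D l)" and D0: "\<And>l \<kappa>. \<kappa> \<in> K \<Longrightarrow> 0 \<le> D l \<kappa>"
    and cover: "\<And>\<kappa>. \<kappa> \<in> K \<Longrightarrow> \<exists>l<n. D l \<kappa> \<le> a" and ab: "a < b" and n: "n > 0"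
  obtains x where "x \<in> carrier A" "adj A x = x"
    "mean (\<lambda>\<kappa>. \<Sum>l<n. D l \<kappa> * tent n l (Re (\<kappa> x))) \<le> 2 * b"
proof -
  have "\<forall>l. \<exists>M>0. \<forall>\<kappa>\<in>K. \<bar>D l \<kappa>\<bar> \<le> M" using approximable_bounded[OF D] by blast
  then obtain M where M: "\<And>l. M l > 0" "\<And>l \<kappa>. \<kappa> \<in> K \<Longrightarrow> \<bar>D l \<kappa>\<bar> \<le> M l" by metis
  define R where "R = (\<Sum>l<n. M l)"
  have R: "R > 0" "\<And>\<kappa>. \<kappa> \<in> K \<Longrightarrow> (\<Sum>l<n. D l \<kappa>) \<le> R"
    unfolding R_def using M n by (auto intro!: sum_pos sum_mono simp: abs_le_iff)
  have b: "b > 0"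
  proof -
    obtain \<kappa> where \<kappa>: "\<kappa> \<in> K" using characters_nonempty by blast
    then obtain l where "D l \<kappa> \<le> a" using cover by blast
    then show ?thesis using D0[OF \<kappa>, of l] ab by linarith
  qed
  define \<delta> where "\<delta> = b / (8 * real n * R)"
  have \<delta>: "\<delta> > 0" using b R n by (simp add: \<delta>_def)
  obtain v where va: "\<And>l. approximable (v l)" and v0: "\<And>l \<kappa>. 0 \<le> v l \<kappa>"
    and v1: "\<And>\<kappa>. \<kappa> \<in> K \<Longrightarrow> (\<Sum>l<n. v l \<kappa>) = 1" and vD: "\<And>l \<kappa>. v l \<kappa> > 0 \<Longrightarrow> D l \<kappa> < b"
    and vi: "mean (\<lambda>\<kappa>. \<Sum>l<n. v l \<kappa> * (1 - v l \<kappa>)) \<le> \<delta>"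
    by (rule partition_with_small_overlap[OF D cover ab \<delta>]) blast+
  define W where "W \<kappa> = (\<Sum>l<n. real l * v l \<kappa>)" for \<kappa>
  have Xa: "approximable W" unfolding W_def by (intro approximable_intros va) auto
  have "(1/8::real) > 0" by simp
  from approximableD[OF Xa this] obtain x0 where x0: "x0 \<in> carrier A"
    "\<forall>\<kappa>\<in>K. \<bar>Re (\<kappa> x0) - W \<kappa>\<bar> \<le> 1/8" by blast
  define x where "x = (1/2) \<odot> (x0 \<oplus> adj A x0)"
  have x: "x \<in> carrier A" "adj A x = x"
    using x0(1) by (auto simp: x_def adj_simps A.a_comm)
  have x_near: "\<bar>Re (\<kappa> x) - W \<kappa>\<bar> \<le> 1/8" if "\<kappa> \<in> K" for \<kappa>
    using bspec[OF x0(2) that] x0(1) that by (simp add: x_def character_simps)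
  define V where "V \<kappa> = (\<Sum>l<n. v l \<kappa> * (1 - v l \<kappa>))" for \<kappa>
  have Va: "approximable V" unfolding V_def by (intro approximable_intros va) auto
  \<comment> \<open>Either one \<open>v m\<close> is almost \<open>1\<close>, and then \<open>\<kappa> x\<close> is near \<open>m\<close> and \<open>D m \<kappa> < b\<close>; or \<open>V \<kappa>\<close> is
    bounded below, and then it pays for the trivial bound \<open>R\<close>.\<close>
  have le: "(\<Sum>l<n. D l \<kappa> * tent n l (Re (\<kappa> x))) \<le> b + 8 * real n * R * V \<kappa>" if \<kappa>: "\<kappa> \<in> K" for \<kappa>
  proof -
    have v_le: "v l \<kappa> \<le> 1" if "l < n" for l
      using v1[OF \<kappa>] v0 that member_le_sum[of l "{..<n}" "\<lambda>l. v l \<kappa>"] by simp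
    have V0: "V \<kappa> \<ge> 0" unfolding V_def using v0 v_le by (intro sum_nonneg mult_nonneg_nonneg) auto
    show ?thesis
    proof (cases "V \<kappa> < 1 / (8 * real n)")
      case True
      obtain m where m: "m < n" "v m \<kappa> > 1 - 1 / (8 * real n)"
        using partition_concentrated[of "\<lambda>l. v l \<kappa>" n "1 / (8 * real n)"] v0 v1[OF \<kappa>] True
        unfolding V_def by blast
      have "\<bar>W \<kappa> - real m\<bar> \<le> real n * (1 - v m \<kappa>)"
        unfolding W_def using weighted_index_near[of "\<lambda>l. v l \<kappa>", OF v0 v1[OF \<kappa>] m(1)] .
      also have "\<dots> \<le> real n * (1 / (8 * real n))" using m(2) by (intro mult_left_mono) auto
      also have "\<dots> = 1/8" using n by simp
      finally have near: "\<bar>Re (\<kappa> x) - real m\<bar> \<le> 1/4" using x_near[OF \<kappa>] by linarith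
      have "1 / (8 * real n) \<le> 1" using n by simp
      then have "v m \<kappa> > 0" using m(2) by linarith
      have "(\<Sum>l<n. D l \<kappa> * tent n l (Re (\<kappa> x))) = (\<Sum>l<n. if l = m then D m \<kappa> * tent n m (Re (\<kappa> x)) else 0)"
        using tent_eq_0[OF m(1) _ near] by (intro sum.cong) auto
      also have "\<dots> = D m \<kappa> * tent n m (Re (\<kappa> x))" using m(1) by simp
      also have "\<dots> \<le> b * 1"
        using vD[OF \<open>v m \<kappa> > 0\<close>] D0[OF \<kappa>] tent_bounds b by (intro mult_mono) auto
      finally show ?thesis using V0 R(1) by (simp add: add_increasing2)
    next
      case False
      have "(\<Sum>l<n. D l \<kappa> * tent n l (Re (\<kappa> x))) \<le> (\<Sum>l<n. D l \<kappa> * 1)"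
        using D0[OF \<kappa>] tent_bounds by (intro sum_mono mult_left_mono) auto
      also have "\<dots> \<le> R" using R(2)[OF \<kappa>] by simp
      also have "\<dots> \<le> 8 * real n * R * V \<kappa>"
      proof -
        have "1 \<le> 8 * real n * V \<kappa>" using False n by (simp add: field_simps)
        from mult_left_mono[OF this, of R] R(1) show ?thesis by (simp add: mult_ac)
      qed
      finally show ?thesis using b by simp
    qed
  qed
  have "approximable (\<lambda>\<kappa>. Re (\<kappa> x))"
    by (rule approximable_element[OF x(1)]) (use character_sa x in auto)
  note ta = approximable_continuous[OF this continuous_on_tent]
  have "mean (\<lambda>\<kappa>. \<Sum>l<n. D l \<kappa> * tent n l (Re (\<kappa> x))) \<le> mean (\<lambda>\<kappa>. b + 8 * real n * R * V \<kappa>)"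
    by (rule mean_mono[OF _ _ le]) (intro approximable_intros D ta Va; simp)+
  also have "\<dots> = b + 8 * real n * R * mean V"
    by (simp add: mean_add mean_cmult mean_const approximable_intros Va)
  also have "\<dots> \<le> b + 8 * real n * R * \<delta>"
    using vi R(1) unfolding V_def by (intro add_left_mono mult_left_mono) auto
  also have "\<dots> = 2 * b" using R(1) n by (simp add: \<delta>_def)
  finally show ?thesis using that x by blast
qed

text \<open>
  The values of characters on the \<open>a j\<close> form a bounded subset of a finite-dimensional space:
  only finitely many integral parts of the values divided by \<open>h\<close> occur, and characters that
  share them are close.
\<close>

lemma finite_net:
  fixes a :: "nat \<Rightarrow> 'a"
  assumes a: "\<And>j. j < r \<Longrightarrow> a j \<in> carrier A" and e: "e > 0"
  shows "\<exists>(n :: nat) \<xi>. n > 0 \<and> (\<forall>l. \<xi> l \<in> K) \<and>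
    (\<forall>\<kappa>\<in>K. \<exists>l<n. (\<Sum>j<r. (cmod (\<kappa> (a j) - \<xi> l (a j)))\<^sup>2) \<le> e)"
proof -
  \<comment> \<open>The mesh: \<open>r\<close> coordinates contribute at most \<open>2 h\<^sup>2\<close> each.\<close>
  define h where "h = sqrt (e / (2 * (real r + 1)))"
  have h: "h > 0" "2 * real r * h\<^sup>2 \<le> e" using e by (auto simp: h_def field_simps)
  define code where "code \<kappa> = (\<lambda>j\<in>{..<r}. (\<lfloor>Re (\<kappa> (a j)) / h\<rfloor>, \<lfloor>Im (\<kappa> (a j)) / h\<rfloor>))" for \<kappa> :: "'a \<Rightarrow> complex"
  define B where "B j = {-\<lceil>cnorm A (a j) / h\<rceil> .. \<lceil>cnorm A (a j) / h\<rceil>}" for j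
  have fl: "\<lfloor>t / h\<rfloor> \<in> B j" if "\<bar>t\<bar> \<le> cnorm A (a j)" for t j
  proof -
    have "t / h \<le> cnorm A (a j) / h" "- (cnorm A (a j) / h) \<le> t / h"
      using that h by (auto simp: field_simps abs_le_iff)
    then have "- (cnorm A (a j) / h) < \<lfloor>t / h\<rfloor> + 1" "\<lfloor>t / h\<rfloor> \<le> cnorm A (a j) / h" by linarith+
    then show ?thesis unfolding B_def by (auto simp: le_ceiling_iff) linarith+
  qed
  have "code ` K \<subseteq> PiE {..<r} (\<lambda>j. B j \<times> B j)"
  proof
    fix c assume "c \<in> code ` K"
    then obtain \<kappa> where \<kappa>: "\<kappa> \<in> K" "c = code \<kappa>" by blast
    show "c \<in> PiE {..<r} (\<lambda>j. B j \<times> B j)"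
      unfolding \<kappa>(2) code_def
    proof (rule restrict_PiE_iff[THEN iffD2], intro ballI)
      fix j assume "j \<in> {..<r}"
      then have "cmod (\<kappa> (a j)) \<le> cnorm A (a j)" using a character_cmod_le[OF \<kappa>(1)] by simp
      then show "(\<lfloor>Re (\<kappa> (a j)) / h\<rfloor>, \<lfloor>Im (\<kappa> (a j)) / h\<rfloor>) \<in> B j \<times> B j"
        using abs_Re_le_cmod[of "\<kappa> (a j)"] abs_Im_le_cmod[of "\<kappa> (a j)"] by (auto intro!: fl)
    qed
  qed
  moreover have "finite (PiE {..<r} (\<lambda>j. B j \<times> B j))" by (intro finite_PiE) (auto simp: B_def)
  ultimately have fin: "finite (code ` K)" by (rule finite_subset)
  define n where "n = card (code ` K)"
  have n: "n > 0" using fin characters_nonempty by (simp add: n_def card_gt_0_iff)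
  obtain g where g: "bij_betw g {..<n} (code ` K)"
    using ex_bij_betw_nat_finite[OF fin] by (auto simp: n_def atLeast0LessThan)
  obtain \<kappa>0 where \<kappa>0: "\<kappa>0 \<in> K" using characters_nonempty by blast
  define \<xi> where "\<xi> l = (if l < n then (SOME \<kappa>. \<kappa> \<in> K \<and> code \<kappa> = g l) else \<kappa>0)" for l
  have \<xi>: "\<xi> l \<in> K \<and> code (\<xi> l) = g l" if "l < n" for l
  proof -
    have "g l \<in> code ` K" using bij_betwE[OF g] that by blast
    then have "\<exists>\<kappa>. \<kappa> \<in> K \<and> code \<kappa> = g l" by auto
    from someI_ex[OF this] show ?thesis using that by (simp add: \<xi>_def)
  qed
  show ?thesis
  proof (rule exI[of _ n], rule exI[of _ \<xi>], intro conjI allI ballI)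
    show "n > 0" by fact
    show "\<xi> l \<in> K" for l using \<xi> \<kappa>0 by (cases "l < n") (auto simp: \<xi>_def)
    fix \<kappa> assume \<kappa>: "\<kappa> \<in> K"
    then have "code \<kappa> \<in> g ` {..<n}" using g by (simp add: bij_betw_def)
    then obtain l where l: "l < n" "g l = code \<kappa>" by auto
    have same: "code (\<xi> l) = code \<kappa>" using \<xi>[OF l(1)] l(2) by simp
    have fl_close: "\<bar>s - t\<bar> \<le> h" if "\<lfloor>s / h\<rfloor> = \<lfloor>t / h\<rfloor>" for s t
    proof -
      have "\<bar>s / h - t / h\<bar> \<le> 1" using that by linarith
      then have "\<bar>s - t\<bar> / h \<le> 1" using h by (simp flip: diff_divide_distrib)
      then show ?thesis using h by (simp add: field_simps)
    qed
    have "(\<Sum>j<r. (cmod (\<kappa> (a j) - \<xi> l (a j)))\<^sup>2) \<le> (\<Sum>j<r. 2 * h\<^sup>2)"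
    proof (rule sum_mono)
      fix j assume j: "j \<in> {..<r}"
      have "code \<kappa> j = code (\<xi> l) j" using same by simp
      then have "\<lfloor>Re (\<kappa> (a j)) / h\<rfloor> = \<lfloor>Re (\<xi> l (a j)) / h\<rfloor>" "\<lfloor>Im (\<kappa> (a j)) / h\<rfloor> = \<lfloor>Im (\<xi> l (a j)) / h\<rfloor>"
        using j by (auto simp: code_def)
      from this[THEN fl_close] have "\<bar>Re (\<kappa> (a j) - \<xi> l (a j))\<bar> \<le> h" "\<bar>Im (\<kappa> (a j) - \<xi> l (a j))\<bar> \<le> h"
        by auto
      then have "(Re (\<kappa> (a j) - \<xi> l (a j)))\<^sup>2 \<le> h\<^sup>2" "(Im (\<kappa> (a j) - \<xi> l (a j)))\<^sup>2 \<le> h\<^sup>2"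
        using h by (auto simp: abs_le_square_iff[symmetric])
      then show "(cmod (\<kappa> (a j) - \<xi> l (a j)))\<^sup>2 \<le> 2 * h\<^sup>2" unfolding cmod_power2 by linarith
    qed
    also have "\<dots> \<le> e" using h by (simp add: mult_ac)
    finally show "\<exists>l<n. (\<Sum>j<r. (cmod (\<kappa> (a j) - \<xi> l (a j)))\<^sup>2) \<le> e" using l(1) by blast
  qed
qed

end

section \<open>Ultraproducts\<close>

text \<open>A cluster point exists by compactness, and along an ultrafilter it is a limit.\<close>

lemma ultrafilter_bounded_limit:
  fixes f :: "'i \<Rightarrow> complex"
  assumes uf: "ultrafilter_on I \<alpha>" and bound: "\<And>i. i \<in> I \<Longrightarrow> cmod (f i) \<le> B"
  shows "\<exists>l. (f \<longlongrightarrow> l) \<alpha>"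
proof -
  have evI: "\<forall>\<^sub>F i in \<alpha>. i \<in> I" and ne: "\<alpha> \<noteq> bot"
    using uf by (auto simp: ultrafilter_on_def le_principal)
  have "filtermap f \<alpha> \<noteq> bot" using ne by (simp add: filtermap_bot_iff)
  moreover have "filtermap f \<alpha> \<le> principal (cball 0 B)"
    unfolding le_principal eventually_filtermap
    using evI by (rule eventually_mono) (use bound in auto)
  ultimately have "\<exists>l\<in>cball 0 B. inf (nhds l) (filtermap f \<alpha>) \<noteq> bot"
    using spec[OF compact_filter[THEN iffD1, OF compact_cball], of "filtermap f \<alpha>" 0 B]
    unfolding le_principal by blast
  then obtain l where l: "inf (nhds l) (filtermap f \<alpha>) \<noteq> bot" by blast
  have "(f \<longlongrightarrow> l) \<alpha>"
  proof (rule topological_tendstoI)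
    fix S assume S: "open S" "l \<in> S"
    have "\<forall>E\<subseteq>I. (\<forall>\<^sub>F i in \<alpha>. i \<in> E) \<or> (\<forall>\<^sub>F i in \<alpha>. i \<in> I - E)"
      using uf unfolding ultrafilter_on_def by (elim conjE)
    moreover have "{i\<in>I. f i \<in> S} \<subseteq> I" by blast
    ultimately have "(\<forall>\<^sub>F i in \<alpha>. i \<in> {i\<in>I. f i \<in> S}) \<or> (\<forall>\<^sub>F i in \<alpha>. i \<in> I - {i\<in>I. f i \<in> S})"
      by (elim allE impE)
    then show "\<forall>\<^sub>F i in \<alpha>. f i \<in> S"
    proof
      assume "\<forall>\<^sub>F i in \<alpha>. i \<in> {i\<in>I. f i \<in> S}"
      then show ?thesis by (rule eventually_mono) auto
    next
      assume "\<forall>\<^sub>F i in \<alpha>. i \<in> I - {i\<in>I. f i \<in> S}"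
      then have "\<forall>\<^sub>F z in filtermap f \<alpha>. z \<notin> S"
        unfolding eventually_filtermap by (rule eventually_mono) auto
      moreover have "\<forall>\<^sub>F z in nhds l. z \<in> S" using S by (simp add: eventually_nhds_in_open)
      ultimately have "\<forall>\<^sub>F z in inf (nhds l) (filtermap f \<alpha>). z \<notin> S \<and> z \<in> S"
        by (intro eventually_conj) (auto elim: filter_leD[rotated])
      then show ?thesis using l by (simp add: eventually_False)
    qed
  qed
  then show ?thesis by blast
qed

text \<open>
  Countable incompleteness is what turns countably many asymptotic statements into one.
\<close>

lemma nontrivial_ultrafilter_diagonal:
  assumes uf: "nontrivial_ultrafilter_on I \<alpha>" and P: "\<And>n. \<forall>\<^sub>F i in \<alpha>. P n i"
  shows "\<exists>k :: 'i \<Rightarrow> nat. (\<forall>\<^sub>F i in \<alpha>. P (k i) i) \<and> (\<forall>m. \<forall>\<^sub>F i in \<alpha>. m \<le> k i)"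
proof -
  obtain E :: "nat \<Rightarrow> 'i set" where E: "\<And>n. \<forall>\<^sub>F i in \<alpha>. i \<in> E n" "(\<Inter>n. E n) = {}"
    using uf unfolding nontrivial_ultrafilter_on_def by blast
  define Q where "Q n i \<longleftrightarrow> (\<forall>m\<le>n. i \<in> E m \<and> P m i)" for n i
  have Q: "\<forall>\<^sub>F i in \<alpha>. Q n i" for n
    using eventually_ball_finite[of "{..n}" "\<lambda>i m. i \<in> E m \<and> P m i" \<alpha>] E(1) P
    by (simp add: Q_def eventually_conj_iff Ball_def)
  have ex: "\<exists>n. \<not> Q n i" for i
  proof -
    obtain m where "i \<notin> E m" using E(2) by blast
    then show ?thesis unfolding Q_def by blast
  qed
  \<comment> \<open>\<open>N i - 1\<close> is the last stage up to which \<open>i\<close> is good; it exists for \<open>i \<in> E 0\<close> with \<open>P 0 i\<close>.\<close>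
  define N where "N i = (LEAST n. \<not> Q n i)" for i
  have N_gt: "n < N i" if "Q n i" for n i
  proof (rule ccontr)
    assume "\<not> n < N i"
    then have "Q (N i) i" using that unfolding Q_def by auto
    then show False using LeastI_ex[OF ex, of i] by (simp add: N_def)
  qed
  show ?thesis
  proof (intro exI[of _ "\<lambda>i. N i - 1"] conjI allI)
    show "\<forall>\<^sub>F i in \<alpha>. m \<le> N i - 1" for m
      using Q[of m]
    proof (rule eventually_mono)
      fix i assume "Q m i"
      from N_gt[OF this] show "m \<le> N i - 1" by simp
    qed
    show "\<forall>\<^sub>F i in \<alpha>. P (N i - 1) i"
      using Q[of 0]
    proof (rule eventually_mono)
      fix i assume "Q 0 i"
      then have "N i - 1 < (LEAST n. \<not> Q n i)" using N_gt[of 0 i] unfolding N_def by simp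
      from not_less_Least[OF this] have "Q (N i - 1) i" by simp
      then show "P (N i - 1) i" unfolding Q_def by simp
    qed
  qed
qed

locale tracial_ultraproduct_hom =
  fixes A :: "'a cstar" and I :: "'i set" and \<alpha> :: "'i filter"
    and \<A> :: "'i \<Rightarrow> 'b cstar" and \<rho> :: "'i \<Rightarrow> 'b \<Rightarrow> complex" and \<pi> :: "'a \<Rightarrow> ('i \<Rightarrow> 'b) set"
  assumes A: "unital_cstar_algebra A"
    and uf: "nontrivial_ultrafilter_on I \<alpha>"
    and alg: "\<And>i. i \<in> I \<Longrightarrow> unital_cstar_algebra (\<A> i)"
    and tr: "\<And>i. i \<in> I \<Longrightarrow> tracial_state (\<A> i) (\<rho> i)"
    and hom: "unital_star_hom A (tracial_ultraproduct I \<alpha> \<A> \<rho>) \<pi>"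
begin

sublocale A: unital_cstar_algebra A by (rule A)

abbreviation "Bdd \<equiv> cstar_product I \<A>"
abbreviation "Null \<equiv> trace_null_ideal I \<alpha> \<A> \<rho>"
abbreviation "N i \<equiv> norm2 (\<A> i) (\<rho> i)"

lemma ufI: "ultrafilter_on I \<alpha>" using uf by (simp add: nontrivial_ultrafilter_on_def)

lemma \<alpha>_neq_bot: "\<alpha> \<noteq> bot" using ufI by (simp add: ultrafilter_on_def)

lemma eventually_I: "\<forall>\<^sub>F i in \<alpha>. i \<in> I" using ufI by (simp add: ultrafilter_on_def le_principal)

lemma eventuallyI: "(\<And>i. i \<in> I \<Longrightarrow> P i) \<Longrightarrow> \<forall>\<^sub>F i in \<alpha>. P i"
  using eventually_I by (rule eventually_mono)

lemma carrier_Bdd: "x \<in> carrier Bdd \<longleftrightarrow>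
  x \<in> extensional I \<and> (\<forall>i\<in>I. x i \<in> carrier (\<A> i)) \<and> (\<exists>B. \<forall>i\<in>I. cnorm (\<A> i) (x i) \<le> B)"
  by (auto simp: cstar_product_def PiE_iff bdd_above_def)

lemma BddD: "x \<in> carrier Bdd \<Longrightarrow> i \<in> I \<Longrightarrow> x i \<in> carrier (\<A> i)"
  by (simp add: carrier_Bdd)

lemma restrict_in_Bdd:
  assumes "\<And>i. i \<in> I \<Longrightarrow> f i \<in> carrier (\<A> i)" "\<And>i. i \<in> I \<Longrightarrow> cnorm (\<A> i) (f i) \<le> B"
  shows "(\<lambda>i\<in>I. f i) \<in> carrier Bdd"
  unfolding carrier_Bdd using assms by auto

lemma Bdd_add:
  assumes x: "x \<in> carrier Bdd" and y: "y \<in> carrier Bdd"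
  shows "(\<lambda>i\<in>I. x i \<oplus>\<^bsub>\<A> i\<^esub> y i) \<in> carrier Bdd"
proof -
  obtain B C where B: "\<And>i. i \<in> I \<Longrightarrow> cnorm (\<A> i) (x i) \<le> B" and C: "\<And>i. i \<in> I \<Longrightarrow> cnorm (\<A> i) (y i) \<le> C"
    using x y unfolding carrier_Bdd by blast
  show ?thesis
  proof (rule restrict_in_Bdd[where B = "B + C"])
    fix i assume i: "i \<in> I"
    interpret B: unital_cstar_algebra "\<A> i" by (rule alg[OF i])
    show "x i \<oplus>\<^bsub>\<A> i\<^esub> y i \<in> carrier (\<A> i)" using BddD x y i by simp
    show "cnorm (\<A> i) (x i \<oplus>\<^bsub>\<A> i\<^esub> y i) \<le> B + C"
      using B.cnorm_triangle[OF BddD[OF x i] BddD[OF y i]] B[OF i] C[OF i] by linarith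
  qed
qed

lemma Bdd_mult:
  assumes x: "x \<in> carrier Bdd" and y: "y \<in> carrier Bdd"
  shows "(\<lambda>i\<in>I. x i \<otimes>\<^bsub>\<A> i\<^esub> y i) \<in> carrier Bdd"
proof -
  obtain B C where B: "\<And>i. i \<in> I \<Longrightarrow> cnorm (\<A> i) (x i) \<le> B" and C: "\<And>i. i \<in> I \<Longrightarrow> cnorm (\<A> i) (y i) \<le> C"
    using x y unfolding carrier_Bdd by blast
  show ?thesis
  proof (rule restrict_in_Bdd[where B = "B * C"])
    fix i assume i: "i \<in> I"
    interpret B: unital_cstar_algebra "\<A> i" by (rule alg[OF i])
    show "x i \<otimes>\<^bsub>\<A> i\<^esub> y i \<in> carrier (\<A> i)" using BddD x y i by simp
    have "0 \<le> B" using B[OF i] B.cnorm_nonneg[OF BddD[OF x i]] by linarith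
    then have "cnorm (\<A> i) (x i) * cnorm (\<A> i) (y i) \<le> B * C"
      using B.cnorm_nonneg BddD x y i B[OF i] C[OF i] by (intro mult_mono) auto
    then show "cnorm (\<A> i) (x i \<otimes>\<^bsub>\<A> i\<^esub> y i) \<le> B * C"
      using B.cnorm_mult[OF BddD[OF x i] BddD[OF y i]] by linarith
  qed
qed

lemma Bdd_smult:
  assumes x: "x \<in> carrier Bdd"
  shows "(\<lambda>i\<in>I. c \<odot>\<^bsub>\<A> i\<^esub> x i) \<in> carrier Bdd"
proof -
  obtain B where B: "\<And>i. i \<in> I \<Longrightarrow> cnorm (\<A> i) (x i) \<le> B"
    using x unfolding carrier_Bdd by blast
  show ?thesis
  proof (rule restrict_in_Bdd[where B = "cmod c * B"])
    fix i assume i: "i \<in> I"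
    interpret B: unital_cstar_algebra "\<A> i" by (rule alg[OF i])
    show "c \<odot>\<^bsub>\<A> i\<^esub> x i \<in> carrier (\<A> i)" using BddD x i by simp
    show "cnorm (\<A> i) (c \<odot>\<^bsub>\<A> i\<^esub> x i) \<le> cmod c * B"
      using B.cnorm_smult[OF BddD[OF x i]] B[OF i] by (simp add: mult_left_mono)
  qed
qed

lemma Bdd_adj:
  assumes x: "x \<in> carrier Bdd"
  shows "(\<lambda>i\<in>I. adj (\<A> i) (x i)) \<in> carrier Bdd"
proof -
  obtain B where B: "\<And>i. i \<in> I \<Longrightarrow> cnorm (\<A> i) (x i) \<le> B"
    using x unfolding carrier_Bdd by blast
  show ?thesis
  proof (rule restrict_in_Bdd[where B = B])
    fix i assume i: "i \<in> I"
    interpret B: unital_cstar_algebra "\<A> i" by (rule alg[OF i])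
    show "adj (\<A> i) (x i) \<in> carrier (\<A> i)" using BddD x i by simp
    show "cnorm (\<A> i) (adj (\<A> i) (x i)) \<le> B"
      using B.cnorm_adj[OF BddD[OF x i]] B[OF i] by simp
  qed
qed

lemma Bdd_one: "(\<lambda>i\<in>I. \<one>\<^bsub>\<A> i\<^esub>) \<in> carrier Bdd"
proof (rule restrict_in_Bdd[where B = 1])
  fix i assume i: "i \<in> I"
  interpret B: unital_cstar_algebra "\<A> i" by (rule alg[OF i])
  show "\<one>\<^bsub>\<A> i\<^esub> \<in> carrier (\<A> i)" "cnorm (\<A> i) \<one>\<^bsub>\<A> i\<^esub> \<le> 1" using B.cnorm_one_le by auto
qed

lemma Bdd_diff:
  assumes x: "x \<in> carrier Bdd" and y: "y \<in> carrier Bdd"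
  shows "(\<lambda>i\<in>I. x i \<ominus>\<^bsub>\<A> i\<^esub> y i) \<in> carrier Bdd"
proof -
  have "(\<lambda>i\<in>I. x i \<ominus>\<^bsub>\<A> i\<^esub> y i) = (\<lambda>i\<in>I. x i \<oplus>\<^bsub>\<A> i\<^esub> (\<lambda>i\<in>I. (-1) \<odot>\<^bsub>\<A> i\<^esub> y i) i)"
  proof (rule restrict_ext)
    fix i assume i: "i \<in> I"
    interpret B: unital_cstar_algebra "\<A> i" by (rule alg[OF i])
    show "x i \<ominus>\<^bsub>\<A> i\<^esub> y i = x i \<oplus>\<^bsub>\<A> i\<^esub> (\<lambda>i\<in>I. (-1) \<odot>\<^bsub>\<A> i\<^esub> y i) i"
      using i BddD[OF y i] by (simp add: a_minus_def B.minus_eq_smult)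
  qed
  then show ?thesis using Bdd_add[OF x Bdd_smult[OF y]] by simp
qed

text \<open>
  \<open>x \<doteq> y\<close> says that two bounded families represent the same element of the ultraproduct.
\<close>

definition close :: "('i \<Rightarrow> 'b) \<Rightarrow> ('i \<Rightarrow> 'b) \<Rightarrow> bool" (infix \<open>\<doteq>\<close> 50)
  where "x \<doteq> y \<longleftrightarrow> ((\<lambda>i. N i (x i \<ominus>\<^bsub>\<A> i\<^esub> y i)) \<longlongrightarrow> 0) \<alpha>"

lemma close_trans:
  assumes x: "x \<in> carrier Bdd" and y: "y \<in> carrier Bdd" and z: "z \<in> carrier Bdd"
    and xy: "x \<doteq> y" and yz: "y \<doteq> z"
  shows "x \<doteq> z"
proof -
  have "((\<lambda>i. N i (x i \<ominus>\<^bsub>\<A> i\<^esub> y i) + N i (y i \<ominus>\<^bsub>\<A> i\<^esub> z i)) \<longlongrightarrow> 0 + 0) \<alpha>"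
    using xy yz unfolding close_def by (intro tendsto_add)
  then show ?thesis
    unfolding close_def add_0
  proof (rule tendsto_sandwich[OF _ _ tendsto_const, rotated 2])
    show "\<forall>\<^sub>F i in \<alpha>. 0 \<le> N i (x i \<ominus>\<^bsub>\<A> i\<^esub> z i)"
    proof (rule eventuallyI)
      fix i assume i: "i \<in> I"
      interpret B: unital_cstar_algebra "\<A> i" by (rule alg[OF i])
      show "0 \<le> N i (x i \<ominus>\<^bsub>\<A> i\<^esub> z i)" using B.norm2_nonneg[OF tr[OF i]] BddD[OF x i] BddD[OF z i] by simp
    qed
    show "\<forall>\<^sub>F i in \<alpha>. N i (x i \<ominus>\<^bsub>\<A> i\<^esub> z i) \<le> N i (x i \<ominus>\<^bsub>\<A> i\<^esub> y i) + N i (y i \<ominus>\<^bsub>\<A> i\<^esub> z i)"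
    proof (rule eventuallyI)
      fix i assume i: "i \<in> I"
      interpret B: unital_cstar_algebra "\<A> i" by (rule alg[OF i])
      show "N i (x i \<ominus>\<^bsub>\<A> i\<^esub> z i) \<le> N i (x i \<ominus>\<^bsub>\<A> i\<^esub> y i) + N i (y i \<ominus>\<^bsub>\<A> i\<^esub> z i)"
        by (rule B.norm2_diff_triangle[OF tr[OF i]]) (use x y z i BddD in auto)
    qed
  qed
qed

lemma close_sym:
  assumes x: "x \<in> carrier Bdd" and y: "y \<in> carrier Bdd" and xy: "x \<doteq> y"
  shows "y \<doteq> x"
  using xy unfolding close_def
proof (rule Lim_transform_eventually)
  show "\<forall>\<^sub>F i in \<alpha>. N i (x i \<ominus>\<^bsub>\<A> i\<^esub> y i) = N i (y i \<ominus>\<^bsub>\<A> i\<^esub> x i)"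
  proof (rule eventuallyI)
    fix i assume i: "i \<in> I"
    interpret B: unital_cstar_algebra "\<A> i" by (rule alg[OF i])
    show "N i (x i \<ominus>\<^bsub>\<A> i\<^esub> y i) = N i (y i \<ominus>\<^bsub>\<A> i\<^esub> x i)"
      by (rule B.norm2_diff_commute[OF tr[OF i]]) (use x y i BddD in auto)
  qed
qed

lemma norm2_zero: "i \<in> I \<Longrightarrow> N i \<zero>\<^bsub>\<A> i\<^esub> = 0"
proof -
  assume i: "i \<in> I"
  interpret B: unital_cstar_algebra "\<A> i" by (rule alg[OF i])
  show ?thesis using B.norm2_le_cnorm[OF tr[OF i], of "\<zero>\<^bsub>\<A> i\<^esub>"] B.norm2_nonneg[OF tr[OF i], of "\<zero>\<^bsub>\<A> i\<^esub>"]
    by simp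
qed

lemma close_refl:
  assumes x: "x \<in> carrier Bdd" shows "x \<doteq> x"
  unfolding close_def
proof (rule tendsto_eventually, rule eventuallyI)
  fix i assume i: "i \<in> I"
  interpret B: unital_cstar_algebra "\<A> i" by (rule alg[OF i])
  show "N i (x i \<ominus>\<^bsub>\<A> i\<^esub> x i) = 0" using norm2_zero[OF i] BddD[OF x i] by (simp add: a_minus_def B.r_neg)
qed

lemma coset_eq:
  assumes c: "c \<in> carrier Bdd"
  shows "Null +>\<^bsub>Bdd\<^esub> c = {y \<in> carrier Bdd. y \<doteq> c}"
proof (intro equalityI subsetI)
  fix y assume "y \<in> Null +>\<^bsub>Bdd\<^esub> c"
  then obtain h where h: "h \<in> Null" "y = h \<oplus>\<^bsub>Bdd\<^esub> c" by (auto simp: a_r_coset_def')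
  have hP: "h \<in> carrier Bdd" using h(1) by (simp add: trace_null_ideal_def)
  have y: "y = (\<lambda>i\<in>I. h i \<oplus>\<^bsub>\<A> i\<^esub> c i)" unfolding h(2) by (simp add: cstar_product_def)
  have "y \<doteq> c"
    unfolding close_def
  proof (rule Lim_transform_eventually)
    show "((\<lambda>i. N i (h i)) \<longlongrightarrow> 0) \<alpha>" using h(1) by (simp add: trace_null_ideal_def)
    show "\<forall>\<^sub>F i in \<alpha>. N i (h i) = N i (y i \<ominus>\<^bsub>\<A> i\<^esub> c i)"
    proof (rule eventuallyI)
      fix i assume i: "i \<in> I"
      interpret B: unital_cstar_algebra "\<A> i" by (rule alg[OF i])
      have "y i \<ominus>\<^bsub>\<A> i\<^esub> c i = h i"
        using i BddD[OF hP i] BddD[OF c i] by (simp add: y a_minus_def B.a_assoc B.r_neg)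
      then show "N i (h i) = N i (y i \<ominus>\<^bsub>\<A> i\<^esub> c i)" by simp
    qed
  qed
  then show "y \<in> {y \<in> carrier Bdd. y \<doteq> c}" using Bdd_add[OF hP c] by (simp add: y)
next
  fix y assume "y \<in> {y \<in> carrier Bdd. y \<doteq> c}"
  then have y: "y \<in> carrier Bdd" "y \<doteq> c" by auto
  define h where "h = (\<lambda>i\<in>I. y i \<ominus>\<^bsub>\<A> i\<^esub> c i)"
  have hP: "h \<in> carrier Bdd" unfolding h_def using Bdd_diff[OF y(1) c] .
  have "((\<lambda>i. N i (h i)) \<longlongrightarrow> 0) \<alpha>"
    using y(2) unfolding close_def
    by (rule Lim_transform_eventually) (rule eventuallyI, simp add: h_def)
  then have "h \<in> Null" using hP by (simp add: trace_null_ideal_def)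
  moreover have "y = h \<oplus>\<^bsub>Bdd\<^esub> c"
  proof
    fix i
    show "y i = (h \<oplus>\<^bsub>Bdd\<^esub> c) i"
    proof (cases "i \<in> I")
      case True
      interpret B: unital_cstar_algebra "\<A> i" by (rule alg[OF True])
      show ?thesis using True BddD[OF y(1) True] BddD[OF c True]
        by (simp add: h_def cstar_product_def a_minus_def B.a_assoc B.l_neg)
    next
      case False
      then show ?thesis using y(1) by (simp add: cstar_product_def PiE_iff extensional_def)
    qed
  qed
  ultimately show "y \<in> Null +>\<^bsub>Bdd\<^esub> c" by (auto simp: a_r_coset_def')
qed

text \<open>
  The lemmas \<open>rep_add\<close> to \<open>rep_poly_eval\<close> compute with representatives \<open>x \<in> \<pi> a\<close>, so that the
  quotient algebra need not be handled as an algebra.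
\<close>

lemma rep_coset:
  assumes a: "a \<in> carrier A"
  obtains c where "c \<in> carrier Bdd" "\<pi> a = {y \<in> carrier Bdd. y \<doteq> c}"
proof -
  have "\<pi> a \<in> carrier (tracial_ultraproduct I \<alpha> \<A> \<rho>)"
    using hom a unfolding unital_star_hom_def by (auto intro: ring_hom_closed)
  then have "\<pi> a \<in> a_rcosets\<^bsub>Bdd\<^esub> Null"
    by (simp add: tracial_ultraproduct_def cstar_quotient_def FactRing_def)
  then obtain c where "c \<in> carrier Bdd" "\<pi> a = Null +>\<^bsub>Bdd\<^esub> c"
    by (auto simp: A_RCOSETS_def')
  then show ?thesis using that coset_eq by simp
qed

lemma rep_exists:
  assumes "a \<in> carrier A" shows "\<exists>x. x \<in> \<pi> a"
proof -
  obtain c where "c \<in> carrier Bdd" "\<pi> a = {y \<in> carrier Bdd. y \<doteq> c}" by (rule rep_coset[OF assms])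
  then show ?thesis using close_refl by blast
qed

lemma rep_Bdd: "\<lbrakk>a \<in> carrier A; x \<in> \<pi> a\<rbrakk> \<Longrightarrow> x \<in> carrier Bdd"
  by (rule rep_coset[of a]) auto

lemma rep_carrier: "\<lbrakk>a \<in> carrier A; x \<in> \<pi> a; i \<in> I\<rbrakk> \<Longrightarrow> x i \<in> carrier (\<A> i)"
  using rep_Bdd BddD by blast

lemma rep_close:
  assumes "a \<in> carrier A" "x \<in> \<pi> a" "y \<in> \<pi> a" shows "x \<doteq> y"
proof -
  obtain c where "c \<in> carrier Bdd" "\<pi> a = {y \<in> carrier Bdd. y \<doteq> c}" by (rule rep_coset[OF assms(1)])
  then show ?thesis using assms close_trans[of x c y] close_sym[of y c] by auto
qed

lemma rep_cong:
  assumes "a \<in> carrier A" "x \<in> \<pi> a" "y \<in> carrier Bdd" "y \<doteq> x" shows "y \<in> \<pi> a"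
proof -
  obtain c where "c \<in> carrier Bdd" "\<pi> a = {y \<in> carrier Bdd. y \<doteq> c}" by (rule rep_coset[OF assms(1)])
  then show ?thesis using assms close_trans[of y x c] by auto
qed

lemma rep_eq:
  assumes "a \<in> carrier A" "x \<in> \<pi> a" shows "\<pi> a = Null +>\<^bsub>Bdd\<^esub> x"
  using rep_cong[OF assms] rep_close[OF assms(1) _ assms(2)] rep_Bdd[OF assms(1)]
    coset_eq[OF rep_Bdd[OF assms]] by blast

lemma rep_add:
  assumes "a \<in> carrier A" "b \<in> carrier A" "x \<in> \<pi> a" "y \<in> \<pi> b"
  shows "(\<lambda>i\<in>I. x i \<oplus>\<^bsub>\<A> i\<^esub> y i) \<in> \<pi> (a \<oplus>\<^bsub>A\<^esub> b)"
proof -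
  have "\<pi> (a \<oplus>\<^bsub>A\<^esub> b) = \<pi> a \<oplus>\<^bsub>tracial_ultraproduct I \<alpha> \<A> \<rho>\<^esub> \<pi> b"
    using hom assms by (auto simp: unital_star_hom_def ring_hom_add)
  also have "\<dots> = \<pi> a <+>\<^bsub>Bdd\<^esub> \<pi> b"
    by (simp add: tracial_ultraproduct_def cstar_quotient_def FactRing_def)
  also have "x \<oplus>\<^bsub>Bdd\<^esub> y \<in> \<pi> a <+>\<^bsub>Bdd\<^esub> \<pi> b"
    using assms by (auto simp: set_add_def')
  finally have "x \<oplus>\<^bsub>Bdd\<^esub> y \<in> \<pi> (a \<oplus>\<^bsub>A\<^esub> b)" .
  moreover have "x \<oplus>\<^bsub>Bdd\<^esub> y = (\<lambda>i\<in>I. x i \<oplus>\<^bsub>\<A> i\<^esub> y i)" by (simp add: cstar_product_def)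
  ultimately show ?thesis by (simp only:)
qed

lemma rep_mult:
  assumes "a \<in> carrier A" "b \<in> carrier A" "x \<in> \<pi> a" "y \<in> \<pi> b"
  shows "(\<lambda>i\<in>I. x i \<otimes>\<^bsub>\<A> i\<^esub> y i) \<in> \<pi> (a \<otimes>\<^bsub>A\<^esub> b)"
proof -
  have "\<pi> (a \<otimes>\<^bsub>A\<^esub> b) = \<pi> a \<otimes>\<^bsub>tracial_ultraproduct I \<alpha> \<A> \<rho>\<^esub> \<pi> b"
    using hom assms by (auto simp: unital_star_hom_def ring_hom_mult)
  also have "\<dots> = rcoset_mult Bdd Null (\<pi> a) (\<pi> b)"
    by (simp add: tracial_ultraproduct_def cstar_quotient_def FactRing_def)
  finally have "Null +>\<^bsub>Bdd\<^esub> (x \<otimes>\<^bsub>Bdd\<^esub> y) \<subseteq> \<pi> (a \<otimes>\<^bsub>A\<^esub> b)"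
    using assms by (auto simp: rcoset_mult_def)
  moreover have "x \<otimes>\<^bsub>Bdd\<^esub> y = (\<lambda>i\<in>I. x i \<otimes>\<^bsub>\<A> i\<^esub> y i)" by (simp add: cstar_product_def)
  moreover have "(\<lambda>i\<in>I. x i \<otimes>\<^bsub>\<A> i\<^esub> y i) \<in> carrier Bdd" using assms rep_Bdd by (intro Bdd_mult) auto
  ultimately show ?thesis using coset_eq close_refl by auto
qed

lemma rep_smult:
  assumes "a \<in> carrier A" "x \<in> \<pi> a"
  shows "(\<lambda>i\<in>I. c \<odot>\<^bsub>\<A> i\<^esub> x i) \<in> \<pi> (c \<odot>\<^bsub>A\<^esub> a)"
proof -
  have "\<pi> (c \<odot>\<^bsub>A\<^esub> a) = c \<odot>\<^bsub>tracial_ultraproduct I \<alpha> \<A> \<rho>\<^esub> \<pi> a"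
    using hom assms unfolding unital_star_hom_def by blast
  also have "\<dots> = (\<Union>x\<in>\<pi> a. Null +>\<^bsub>Bdd\<^esub> (c \<odot>\<^bsub>Bdd\<^esub> x))"
    by (simp add: tracial_ultraproduct_def cstar_quotient_def)
  finally have "Null +>\<^bsub>Bdd\<^esub> (c \<odot>\<^bsub>Bdd\<^esub> x) \<subseteq> \<pi> (c \<odot>\<^bsub>A\<^esub> a)" using assms by auto
  moreover have "c \<odot>\<^bsub>Bdd\<^esub> x = (\<lambda>i\<in>I. c \<odot>\<^bsub>\<A> i\<^esub> x i)" by (simp add: cstar_product_def)
  moreover have "(\<lambda>i\<in>I. c \<odot>\<^bsub>\<A> i\<^esub> x i) \<in> carrier Bdd" using assms rep_Bdd by (intro Bdd_smult) auto
  ultimately show ?thesis using coset_eq close_refl by auto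
qed

lemma rep_adj:
  assumes "a \<in> carrier A" "x \<in> \<pi> a"
  shows "(\<lambda>i\<in>I. adj (\<A> i) (x i)) \<in> \<pi> (adj A a)"
proof -
  have "\<pi> (adj A a) = adj (tracial_ultraproduct I \<alpha> \<A> \<rho>) (\<pi> a)"
    using hom assms unfolding unital_star_hom_def by blast
  also have "\<dots> = (\<Union>x\<in>\<pi> a. Null +>\<^bsub>Bdd\<^esub> (adj Bdd x))"
    by (simp add: tracial_ultraproduct_def cstar_quotient_def)
  finally have "Null +>\<^bsub>Bdd\<^esub> (adj Bdd x) \<subseteq> \<pi> (adj A a)" using assms by auto
  moreover have "adj Bdd x = (\<lambda>i\<in>I. adj (\<A> i) (x i))" by (simp add: cstar_product_def)
  moreover have "(\<lambda>i\<in>I. adj (\<A> i) (x i)) \<in> carrier Bdd" using assms rep_Bdd by (intro Bdd_adj) auto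
  ultimately show ?thesis using coset_eq close_refl by auto
qed

lemma rep_one: "(\<lambda>i\<in>I. \<one>\<^bsub>\<A> i\<^esub>) \<in> \<pi> \<one>\<^bsub>A\<^esub>"
proof -
  have "\<pi> \<one>\<^bsub>A\<^esub> = \<one>\<^bsub>tracial_ultraproduct I \<alpha> \<A> \<rho>\<^esub>"
    using hom by (auto simp: unital_star_hom_def ring_hom_one)
  also have "\<dots> = Null +>\<^bsub>Bdd\<^esub> (\<lambda>i\<in>I. \<one>\<^bsub>\<A> i\<^esub>)"
    by (simp add: tracial_ultraproduct_def cstar_quotient_def FactRing_def) (simp add: cstar_product_def)
  finally show ?thesis using coset_eq[OF Bdd_one] close_refl[OF Bdd_one] Bdd_one by simp
qed

lemma rep_diff:
  assumes a: "a \<in> carrier A" and b: "b \<in> carrier A" and x: "x \<in> \<pi> a" and y: "y \<in> \<pi> b"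
  shows "(\<lambda>i\<in>I. x i \<ominus>\<^bsub>\<A> i\<^esub> y i) \<in> \<pi> (a \<ominus>\<^bsub>A\<^esub> b)"
proof -
  have "(\<lambda>i\<in>I. x i \<ominus>\<^bsub>\<A> i\<^esub> y i) = (\<lambda>i\<in>I. x i \<oplus>\<^bsub>\<A> i\<^esub> (\<lambda>i\<in>I. (-1) \<odot>\<^bsub>\<A> i\<^esub> y i) i)"
  proof (rule restrict_ext)
    fix i assume i: "i \<in> I"
    interpret B: unital_cstar_algebra "\<A> i" by (rule alg[OF i])
    show "x i \<ominus>\<^bsub>\<A> i\<^esub> y i = x i \<oplus>\<^bsub>\<A> i\<^esub> (\<lambda>i\<in>I. (-1) \<odot>\<^bsub>\<A> i\<^esub> y i) i"
      using i rep_carrier[OF b y i] by (simp add: a_minus_def B.minus_eq_smult)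
  qed
  moreover have "a \<ominus>\<^bsub>A\<^esub> b = a \<oplus>\<^bsub>A\<^esub> (-1) \<odot>\<^bsub>A\<^esub> b" using b by (simp add: a_minus_def A.minus_eq_smult)
  ultimately show ?thesis using rep_add[OF a _ x rep_smult[OF b y]] b by simp
qed

lemma rep_poly_eval:
  assumes a: "a \<in> carrier A" and x: "x \<in> \<pi> a"
  shows "(\<lambda>i\<in>I. poly_eval (\<A> i) p (x i)) \<in> \<pi> (poly_eval A p a)"
proof (induction p)
  case 0
  have "(\<lambda>i\<in>I. 0 \<odot>\<^bsub>\<A> i\<^esub> (\<lambda>i\<in>I. \<one>\<^bsub>\<A> i\<^esub>) i) \<in> \<pi> (0 \<odot>\<^bsub>A\<^esub> \<one>\<^bsub>A\<^esub>)"
    by (rule rep_smult[OF _ rep_one]) simp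
  moreover have "(\<lambda>i\<in>I. 0 \<odot>\<^bsub>\<A> i\<^esub> (\<lambda>i\<in>I. \<one>\<^bsub>\<A> i\<^esub>) i) = (\<lambda>i\<in>I. poly_eval (\<A> i) 0 (x i))"
  proof (rule restrict_ext)
    fix i assume i: "i \<in> I"
    interpret B: unital_cstar_algebra "\<A> i" by (rule alg[OF i])
    show "0 \<odot>\<^bsub>\<A> i\<^esub> (\<lambda>i\<in>I. \<one>\<^bsub>\<A> i\<^esub>) i = poly_eval (\<A> i) 0 (x i)"
      using i B.poly_eval_0[OF rep_carrier[OF a x i]] by simp
  qed
  ultimately show ?case unfolding A.poly_eval_0[OF a] A.smult_0[OF A.A.one_closed] by (simp only:)
next
  case (pCons c p)
  have "(\<lambda>i\<in>I. (\<lambda>i\<in>I. c \<odot>\<^bsub>\<A> i\<^esub> (\<lambda>i\<in>I. \<one>\<^bsub>\<A> i\<^esub>) i) i \<oplus>\<^bsub>\<A> i\<^esub>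
      (\<lambda>i\<in>I. x i \<otimes>\<^bsub>\<A> i\<^esub> (\<lambda>i\<in>I. poly_eval (\<A> i) p (x i)) i) i)
      \<in> \<pi> (c \<odot>\<^bsub>A\<^esub> \<one>\<^bsub>A\<^esub> \<oplus>\<^bsub>A\<^esub> a \<otimes>\<^bsub>A\<^esub> poly_eval A p a)"
    by (intro rep_add rep_smult rep_mult rep_one x pCons.IH)
      (use a A.poly_eval_closed[OF a] in auto)
  moreover have "(\<lambda>i\<in>I. (\<lambda>i\<in>I. c \<odot>\<^bsub>\<A> i\<^esub> (\<lambda>i\<in>I. \<one>\<^bsub>\<A> i\<^esub>) i) i \<oplus>\<^bsub>\<A> i\<^esub>
      (\<lambda>i\<in>I. x i \<otimes>\<^bsub>\<A> i\<^esub> (\<lambda>i\<in>I. poly_eval (\<A> i) p (x i)) i) i) = (\<lambda>i\<in>I. poly_eval (\<A> i) (pCons c p) (x i))"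
  proof (rule restrict_ext)
    fix i assume i: "i \<in> I"
    interpret B: unital_cstar_algebra "\<A> i" by (rule alg[OF i])
    show "(\<lambda>i\<in>I. c \<odot>\<^bsub>\<A> i\<^esub> (\<lambda>i\<in>I. \<one>\<^bsub>\<A> i\<^esub>) i) i \<oplus>\<^bsub>\<A> i\<^esub>
      (\<lambda>i\<in>I. x i \<otimes>\<^bsub>\<A> i\<^esub> (\<lambda>i\<in>I. poly_eval (\<A> i) p (x i)) i) i = poly_eval (\<A> i) (pCons c p) (x i)"
      using i B.poly_eval_pCons[OF rep_carrier[OF a x i]] by simp
  qed
  ultimately show ?case unfolding A.poly_eval_pCons[OF a] by (simp only:)
qed

text \<open>The state that the homomorphism induces by pulling back the limit trace.\<close>

definition \<omega> :: "'a \<Rightarrow> complex"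
  where "\<omega> a = Lim \<alpha> (\<lambda>i. \<rho> i ((SOME x. x \<in> \<pi> a) i))"

lemma rep_limit:
  assumes a: "a \<in> carrier A" and x: "x \<in> \<pi> a"
  shows "((\<lambda>i. \<rho> i (x i)) \<longlongrightarrow> \<omega> a) \<alpha>"
proof -
  define y where "y = (SOME x. x \<in> \<pi> a)"
  have y: "y \<in> \<pi> a" unfolding y_def using rep_exists[OF a] by (rule someI_ex)
  obtain B where B: "\<And>i. i \<in> I \<Longrightarrow> cnorm (\<A> i) (y i) \<le> B"
    using rep_Bdd[OF a y] unfolding carrier_Bdd by blast
  have bd: "cmod (\<rho> i (y i)) \<le> B" if i: "i \<in> I" for i
  proof -
    interpret B: unital_cstar_algebra "\<A> i" by (rule alg[OF i])
    show ?thesis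
      using B.cmod_le_norm2[OF tr[OF i]] B.norm2_le_cnorm[OF tr[OF i]] rep_carrier[OF a y i] B[OF i]
      by (meson order_trans)
  qed
  obtain l where l: "((\<lambda>i. \<rho> i (y i)) \<longlongrightarrow> l) \<alpha>"
    using ultrafilter_bounded_limit[OF ufI, of "\<lambda>i. \<rho> i (y i)" B] bd by blast
  then have "\<omega> a = l" unfolding \<omega>_def y_def[symmetric] using \<alpha>_neq_bot by (intro tendsto_Lim)
  then have lim: "((\<lambda>i. \<rho> i (y i)) \<longlongrightarrow> \<omega> a) \<alpha>" using l by simp
  have "((\<lambda>i. \<rho> i (x i) - \<rho> i (y i)) \<longlongrightarrow> 0) \<alpha>"
  proof (rule Lim_null_comparison)
    show "((\<lambda>i. N i (x i \<ominus>\<^bsub>\<A> i\<^esub> y i)) \<longlongrightarrow> 0) \<alpha>" using rep_close[OF a x y] by (simp add: close_def)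
    show "\<forall>\<^sub>F i in \<alpha>. norm (\<rho> i (x i) - \<rho> i (y i)) \<le> N i (x i \<ominus>\<^bsub>\<A> i\<^esub> y i)"
    proof (rule eventuallyI)
      fix i assume i: "i \<in> I"
      interpret B: unital_cstar_algebra "\<A> i" by (rule alg[OF i])
      show "norm (\<rho> i (x i) - \<rho> i (y i)) \<le> N i (x i \<ominus>\<^bsub>\<A> i\<^esub> y i)"
        using B.cmod_le_norm2[OF tr[OF i], of "x i \<ominus>\<^bsub>\<A> i\<^esub> y i"] rep_carrier[OF a x i] rep_carrier[OF a y i]
          B.pf_diff[OF B.ts_pf[OF tr[OF i]]] by simp
    qed
  qed
  from tendsto_add[OF this lim] show ?thesis by simp
qed

lemma \<omega>_state: "positive_functional A \<omega>" "\<omega> \<one>\<^bsub>A\<^esub> = 1"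
proof -
  show "\<omega> \<one>\<^bsub>A\<^esub> = 1"
  proof (rule tendsto_unique[OF \<alpha>_neq_bot rep_limit[OF _ rep_one]])
    show "((\<lambda>i. \<rho> i ((\<lambda>i\<in>I. \<one>\<^bsub>\<A> i\<^esub>) i)) \<longlongrightarrow> 1) \<alpha>"
      by (rule tendsto_eventually, rule eventuallyI) (use tr in \<open>simp add: tracial_state_def\<close>)
  qed simp
  show "positive_functional A \<omega>"
    unfolding positive_functional_def
  proof (intro conjI ballI allI)
    fix a b assume a: "a \<in> carrier A" and b: "b \<in> carrier A"
    obtain x y where x: "x \<in> \<pi> a" and y: "y \<in> \<pi> b" using rep_exists a b by blast
    show "\<omega> (a \<oplus>\<^bsub>A\<^esub> b) = \<omega> a + \<omega> b"
    proof (rule tendsto_unique[OF \<alpha>_neq_bot rep_limit[OF _ rep_add[OF a b x y]]])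
      show "((\<lambda>i. \<rho> i ((\<lambda>i\<in>I. x i \<oplus>\<^bsub>\<A> i\<^esub> y i) i)) \<longlongrightarrow> \<omega> a + \<omega> b) \<alpha>"
        using tendsto_add[OF rep_limit[OF a x] rep_limit[OF b y]]
        by (rule Lim_transform_eventually, intro eventuallyI)
          (use tr rep_carrier[OF a x] rep_carrier[OF b y] in \<open>simp add: tracial_state_def\<close>)
    qed (use a b in simp)
  next
    fix c a assume a: "a \<in> carrier A"
    obtain x where x: "x \<in> \<pi> a" using rep_exists a by blast
    show "\<omega> (c \<odot>\<^bsub>A\<^esub> a) = c * \<omega> a"
    proof (rule tendsto_unique[OF \<alpha>_neq_bot rep_limit[OF _ rep_smult[OF a x]]])
      show "((\<lambda>i. \<rho> i ((\<lambda>i\<in>I. c \<odot>\<^bsub>\<A> i\<^esub> x i) i)) \<longlongrightarrow> c * \<omega> a) \<alpha>"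
        using tendsto_mult_left[OF rep_limit[OF a x]]
        by (rule Lim_transform_eventually, intro eventuallyI)
          (use tr rep_carrier[OF a x] in \<open>simp add: tracial_state_def\<close>)
    qed (use a in simp)
  next
    fix a assume a: "a \<in> carrier A"
    obtain x where x: "x \<in> \<pi> a" using rep_exists a by blast
    have lim: "((\<lambda>i. \<rho> i (adj (\<A> i) (x i) \<otimes>\<^bsub>\<A> i\<^esub> x i)) \<longlongrightarrow> \<omega> (adj A a \<otimes>\<^bsub>A\<^esub> a)) \<alpha>"
      by (rule Lim_transform_eventually[OF rep_limit[OF _ rep_mult[OF _ a rep_adj[OF a x] x]]],
          use a in simp, use a in simp, rule eventuallyI, simp)
    show "\<omega> (adj A a \<otimes>\<^bsub>A\<^esub> a) \<in> \<real>\<^sub>\<ge>\<^sub>0"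
    proof (rule Lim_in_closed_set[OF closed_nonneg_Reals_complex _ \<alpha>_neq_bot lim])
      show "\<forall>\<^sub>F i in \<alpha>. \<rho> i (adj (\<A> i) (x i) \<otimes>\<^bsub>\<A> i\<^esub> x i) \<in> \<real>\<^sub>\<ge>\<^sub>0"
        by (rule eventuallyI) (use tr rep_carrier[OF a x] in \<open>simp add: tracial_state_def\<close>)
    qed
  qed
qed

text \<open>The squared trace seminorms converge to \<open>\<omega> (a\<^sup>* a)\<close>, which is at most \<open>\<parallel>a\<parallel>\<^sup>2\<close> for a state.\<close>

lemma rep_norm2_eventually_less:
  assumes a: "a \<in> carrier A" and x: "x \<in> \<pi> a" and e: "cnorm A a < e"
  shows "\<forall>\<^sub>F i in \<alpha>. N i (x i) < e"
proof -
  have e0: "e > 0" using e A.cnorm_nonneg[OF a] by linarith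
  have "((\<lambda>i. \<rho> i ((\<lambda>i\<in>I. (\<lambda>i\<in>I. adj (\<A> i) (x i)) i \<otimes>\<^bsub>\<A> i\<^esub> x i) i)) \<longlongrightarrow> \<omega> (adj A a \<otimes>\<^bsub>A\<^esub> a)) \<alpha>"
    by (rule rep_limit[OF _ rep_mult[OF _ a rep_adj[OF a x] x]]) (use a in auto)
  then have "((\<lambda>i. Re (\<rho> i ((\<lambda>i\<in>I. (\<lambda>i\<in>I. adj (\<A> i) (x i)) i \<otimes>\<^bsub>\<A> i\<^esub> x i) i))) \<longlongrightarrow> Re (\<omega> (adj A a \<otimes>\<^bsub>A\<^esub> a))) \<alpha>"
    by (rule tendsto_Re)
  moreover have "Re (\<omega> (adj A a \<otimes>\<^bsub>A\<^esub> a)) < e\<^sup>2"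
  proof -
    have "Re (\<omega> (adj A a \<otimes>\<^bsub>A\<^esub> a)) \<le> (cnorm A a)\<^sup>2"
      using A.pf_square_le[OF \<omega>_state(1) a] \<omega>_state(2) by simp
    also have "\<dots> < e\<^sup>2" using e A.cnorm_nonneg[OF a] by (intro power_strict_mono) auto
    finally show ?thesis .
  qed
  ultimately have "\<forall>\<^sub>F i in \<alpha>. Re (\<rho> i ((\<lambda>i\<in>I. (\<lambda>i\<in>I. adj (\<A> i) (x i)) i \<otimes>\<^bsub>\<A> i\<^esub> x i) i)) < e\<^sup>2"
    by (rule order_tendstoD)
  then show ?thesis using eventually_I
  proof eventually_elim
    case (elim i)
    interpret B: unital_cstar_algebra "\<A> i" by (rule alg[OF elim(2)])
    have "(N i (x i))\<^sup>2 < e\<^sup>2"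
      using elim B.norm2_power2[OF tr[OF elim(2)] rep_carrier[OF a x elim(2)]] by simp
    then show ?case using e0 by (simp add: power_less_imp_less_base)
  qed
qed

text \<open>
  Replacing the entries of a self-adjoint lift by elements with finite spectrum at distance
  less than \<open>1 / (k i + 1)\<close>, where \<open>k i \<rightarrow> \<infinity>\<close> along the ultrafilter, does not change the class of the
  family. This is where real rank zero enters.
\<close>

lemma finite_spectrum_lift:
  assumes rr0: "\<And>i. i \<in> I \<Longrightarrow> real_rank_zero (\<A> i)"
    and a: "a \<in> carrier A" "adj A a = a"
  shows "\<exists>y\<in>\<pi> a. \<forall>i\<in>I. self_adjoint (\<A> i) (y i) \<and> finite (spectrum (\<A> i) (y i))"
proof -
  obtain x0 where x0: "x0 \<in> \<pi> a" using rep_exists a by blast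
  define x where "x = (\<lambda>i\<in>I. (1/2) \<odot>\<^bsub>\<A> i\<^esub> (\<lambda>i\<in>I. x0 i \<oplus>\<^bsub>\<A> i\<^esub> (\<lambda>i\<in>I. adj (\<A> i) (x0 i)) i) i)"
  have "x \<in> \<pi> ((1/2) \<odot>\<^bsub>A\<^esub> (a \<oplus>\<^bsub>A\<^esub> adj A a))"
    unfolding x_def using a(1) x0 by (intro rep_smult rep_add rep_adj) auto
  also have "(1/2) \<odot>\<^bsub>A\<^esub> (a \<oplus>\<^bsub>A\<^esub> adj A a) = a"
    using a A.smult_add_left[of a "1/2" "1/2"] by (simp add: A.smult_add_right)
  finally have x: "x \<in> \<pi> a" .
  have x_sa: "self_adjoint (\<A> i) (x i)" if i: "i \<in> I" for i
  proof -
    interpret B: unital_cstar_algebra "\<A> i" by (rule alg[OF i])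
    show ?thesis using i rep_carrier[OF a(1) x0 i]
      by (simp add: self_adjoint_def x_def B.adj_simps B.a_comm)
  qed
  have "\<exists>k :: 'i \<Rightarrow> nat. (\<forall>\<^sub>F i in \<alpha>. True) \<and> (\<forall>m. \<forall>\<^sub>F i in \<alpha>. m \<le> k i)"
    by (rule nontrivial_ultrafilter_diagonal[OF uf]) simp
  then obtain k :: "'i \<Rightarrow> nat" where k: "\<And>m. \<forall>\<^sub>F i in \<alpha>. m \<le> k i" by auto
  have "\<exists>y. self_adjoint (\<A> i) y \<and> finite (spectrum (\<A> i) y) \<and>
      cnorm (\<A> i) (x i \<ominus>\<^bsub>\<A> i\<^esub> y) < 1 / (real (k i) + 1)" if i: "i \<in> I" for i
  proof -
    have "(0::real) < 1 / (real (k i) + 1)" by simp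
    then show ?thesis using rr0[OF i] x_sa[OF i] unfolding real_rank_zero_def by blast
  qed
  then obtain y0 where y0: "\<And>i. i \<in> I \<Longrightarrow> self_adjoint (\<A> i) (y0 i) \<and> finite (spectrum (\<A> i) (y0 i)) \<and>
      cnorm (\<A> i) (x i \<ominus>\<^bsub>\<A> i\<^esub> y0 i) < 1 / (real (k i) + 1)" by metis
  define y where "y = (\<lambda>i\<in>I. y0 i)"
  have y: "self_adjoint (\<A> i) (y i)" "finite (spectrum (\<A> i) (y i))" "y i \<in> carrier (\<A> i)"
    "cnorm (\<A> i) (x i \<ominus>\<^bsub>\<A> i\<^esub> y i) < 1 / (real (k i) + 1)" if "i \<in> I" for i
    using y0[OF that] that by (auto simp: y_def self_adjoint_def)
  obtain B where B: "\<And>i. i \<in> I \<Longrightarrow> cnorm (\<A> i) (x i) \<le> B"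
    using rep_Bdd[OF a(1) x] unfolding carrier_Bdd by blast
  have yP: "y \<in> carrier Bdd"
    unfolding y_def
  proof (rule restrict_in_Bdd[where B = "B + 1"])
    fix i assume i: "i \<in> I"
    interpret B: unital_cstar_algebra "\<A> i" by (rule alg[OF i])
    have cl: "x i \<in> carrier (\<A> i)" "y0 i \<in> carrier (\<A> i)"
      using rep_carrier[OF a(1) x i] y0[OF i] by (auto simp: self_adjoint_def)
    show "y0 i \<in> carrier (\<A> i)" by fact
    have "cnorm (\<A> i) (y0 i \<ominus>\<^bsub>\<A> i\<^esub> x i) \<le> 1"
    proof -
      have "1 / (real (k i) + 1) \<le> 1" by simp
      then show ?thesis using y0[OF i] B.cnorm_diff_commute[OF cl] by linarith
    qed
    then have "cnorm (\<A> i) ((y0 i \<ominus>\<^bsub>\<A> i\<^esub> x i) \<oplus>\<^bsub>\<A> i\<^esub> x i) \<le> B + 1"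
      using B.cnorm_triangle[of "y0 i \<ominus>\<^bsub>\<A> i\<^esub> x i" "x i"] cl B[OF i] by simp
    also have "(y0 i \<ominus>\<^bsub>\<A> i\<^esub> x i) \<oplus>\<^bsub>\<A> i\<^esub> x i = y0 i" using cl by (simp add: a_minus_def B.a_assoc B.l_neg)
    finally show "cnorm (\<A> i) (y0 i) \<le> B + 1" .
  qed
  have "x \<doteq> y"
    unfolding close_def
  proof (rule tendstoI)
    fix e :: real assume e: "e > 0"
    obtain m :: nat where m: "1 / e < real m" using reals_Archimedean2 by blast
    show "\<forall>\<^sub>F i in \<alpha>. dist (N i (x i \<ominus>\<^bsub>\<A> i\<^esub> y i)) 0 < e"
      using k[of m] eventually_I
    proof eventually_elim
      case (elim i)
      interpret B: unital_cstar_algebra "\<A> i" by (rule alg[OF elim(2)])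
      have cl: "x i \<ominus>\<^bsub>\<A> i\<^esub> y i \<in> carrier (\<A> i)" using rep_carrier[OF a(1) x elim(2)] y(3)[OF elim(2)] by simp
      have "1 / e < real (k i) + 1" using m elim(1) by linarith
      then have "1 / (real (k i) + 1) < e" using e by (simp add: field_simps)
      then have "N i (x i \<ominus>\<^bsub>\<A> i\<^esub> y i) < e"
        using B.norm2_le_cnorm[OF tr[OF elim(2)] cl] y(4)[OF elim(2)] by linarith
      then show ?case using B.norm2_nonneg[OF tr[OF elim(2)] cl] by simp
    qed
  qed
  then have "y \<in> \<pi> a" by (intro rep_cong[OF a(1) x yP] close_sym[OF rep_Bdd[OF a(1) x] yP])
  then show ?thesis using y(1,2) by blast
qed

end

section \<open>Lifting\<close>

lemma real_coefficient_approximation: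
  assumes f: "continuous_on UNIV (f :: real \<Rightarrow> real)" and e: "e > 0"
  shows "\<exists>p q. (\<forall>t. poly p (complex_of_real t) = complex_of_real (q t)) \<and>
    (\<forall>t. \<bar>t\<bar> \<le> T \<longrightarrow> \<bar>q t - f t\<bar> \<le> e)"
proof -
  obtain q where q: "real_polynomial_function q" "\<And>t. t \<in> {-T..T} \<Longrightarrow> \<bar>f t - q t\<bar> < e"
    using Stone_Weierstrass_real_polynomial_function[of "{-T..T}" f e] continuous_on_subset[OF f subset_UNIV] e
    by blast
  obtain a n where an: "q = (\<lambda>x. \<Sum>i\<le>n. a i * x ^ i)"
    using q(1) unfolding real_polynomial_function_iff_sum by blast
  show ?thesis
  proof (rule exI[of _ "\<Sum>i\<le>n. Polynomial.monom (complex_of_real (a i)) i"], rule exI[of _ q],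
      intro conjI allI impI)
    show "poly (\<Sum>i\<le>n. Polynomial.monom (complex_of_real (a i)) i) (complex_of_real t) = complex_of_real (q t)" for t
      by (simp add: an poly_sum poly_monom)
    show "\<bar>q t - f t\<bar> \<le> e" if tT: "\<bar>t\<bar> \<le> T" for t
    proof -
      have "t \<in> {-T..T}" using tT by (simp add: abs_le_iff)
      from q(2)[OF this] show ?thesis by linarith
    qed
  qed
qed

context unital_cstar_algebra
begin

context
  fixes y :: 'a and \<Lambda> and \<Phi> :: "(real \<Rightarrow> complex) \<Rightarrow> 'a" and \<rho>
  assumes sc: "spectral_calculus A y \<Lambda> \<Phi>" and ts: "tracial_state A \<rho>"
begin

lemma trace_spectral_sum:
  assumes b: "b \<in> carrier A"
  shows "\<rho> (b \<otimes> \<Phi> f) = (\<Sum>l\<in>\<Lambda>. f l * \<rho> (b \<otimes> \<Phi> (\<lambda>t. of_bool (t = l))))"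
  by (rule spectral_calculus_functional_sum[OF sc, of "\<lambda>x. \<rho> (b \<otimes> x)"])
    (use b in \<open>simp_all add: A.r_distr smult_simps pf_add[OF ts_pf[OF ts]] pf_smult[OF ts_pf[OF ts]]\<close>)

lemma spectral_projection:
  fixes l :: real
  defines "q \<equiv> \<Phi> (\<lambda>t. of_bool (t = l))"
  shows "q \<in> carrier A" "adj A q = q" "q \<otimes> q = q" "\<Phi> f \<otimes> q = f l \<odot> q"
proof -
  show "q \<in> carrier A" unfolding q_def by (rule sc_closed[OF sc])
  show "adj A q = q" unfolding q_def sc_adj[OF sc, symmetric] by (rule sc_cong[OF sc]) simp
  show "q \<otimes> q = q" unfolding q_def sc_mult[OF sc, symmetric] by (rule sc_cong[OF sc]) simp
  show "\<Phi> f \<otimes> q = f l \<odot> q"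
    unfolding q_def sc_mult[OF sc, symmetric] sc_smult[OF sc, symmetric] by (rule sc_cong[OF sc]) simp
qed

lemma trace_projection:
  fixes l :: real
  defines "q \<equiv> \<Phi> (\<lambda>t. of_bool (t = l))"
  assumes w: "w \<in> carrier A"
  shows "\<rho> ((adj A w \<otimes> w) \<otimes> q) = \<rho> (adj A (w \<otimes> q) \<otimes> (w \<otimes> q))"
proof -
  note q = spectral_projection[where l = l, folded q_def]
  have "adj A (w \<otimes> q) \<otimes> (w \<otimes> q) = q \<otimes> ((adj A w \<otimes> w) \<otimes> q)"
    using w q(1,2) by (simp add: adj_mult A.m_assoc)
  then have "\<rho> (adj A (w \<otimes> q) \<otimes> (w \<otimes> q)) = \<rho> (((adj A w \<otimes> w) \<otimes> q) \<otimes> q)"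
    using ts_commute[OF ts, of q "(adj A w \<otimes> w) \<otimes> q"] w q(1) by simp
  also have "((adj A w \<otimes> w) \<otimes> q) \<otimes> q = (adj A w \<otimes> w) \<otimes> q"
    using A.m_assoc[of "adj A w \<otimes> w" q q] w q(1,3) by simp
  finally show ?thesis by simp
qed

lemma trace_projection_nonneg:
  "w \<in> carrier A \<Longrightarrow> 0 \<le> Re (\<rho> ((adj A w \<otimes> w) \<otimes> \<Phi> (\<lambda>t. of_bool (t = l))))"
  using trace_projection[of w l] pf_square_Re(1)[OF ts_pf[OF ts]] sc_closed[OF sc] by simp

text \<open>
  On each spectral projection \<open>q\<close> the element \<open>\<Phi> f\<close> is the scalar \<open>f l\<close>. By the trace
  property the squared trace norm of \<open>\<Phi> f - x\<close> is the sum of its compressions to the \<open>q\<close>.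
\<close>

lemma norm2_diff_spectral_sum:
  assumes x: "x \<in> carrier A"
  shows "(norm2 A \<rho> (\<Phi> f \<ominus> x))\<^sup>2 =
    (\<Sum>l\<in>\<Lambda>. Re (\<rho> ((adj A (x \<ominus> f l \<odot> \<one>) \<otimes> (x \<ominus> f l \<odot> \<one>)) \<otimes> \<Phi> (\<lambda>t. of_bool (t = l)))))"
proof -
  define z where "z = \<Phi> f \<ominus> x"
  have z: "z \<in> carrier A" using x sc_closed[OF sc] by (simp add: z_def)
  have "(norm2 A \<rho> z)\<^sup>2 = Re (\<rho> ((adj A z \<otimes> z) \<otimes> \<Phi> (\<lambda>t. 1)))"
    using z by (simp add: norm2_power2[OF ts] sc_one[OF sc])
  also have "\<dots> = (\<Sum>l\<in>\<Lambda>. Re (\<rho> ((adj A z \<otimes> z) \<otimes> \<Phi> (\<lambda>t. of_bool (t = l)))))"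
    using z by (subst trace_spectral_sum) auto
  also have "\<dots> = (\<Sum>l\<in>\<Lambda>. Re (\<rho> ((adj A (x \<ominus> f l \<odot> \<one>) \<otimes> (x \<ominus> f l \<odot> \<one>)) \<otimes> \<Phi> (\<lambda>t. of_bool (t = l)))))"
  proof (rule sum.cong[OF refl])
    fix l assume "l \<in> \<Lambda>"
    define q where "q = \<Phi> (\<lambda>t. of_bool (t = l))"
    define w where "w = x \<ominus> f l \<odot> \<one>"
    note q = spectral_projection[where l = l, folded q_def]
    have w: "w \<in> carrier A" using x by (simp add: w_def)
    have "z \<otimes> q = f l \<odot> q \<ominus> x \<otimes> q"
      using q(1) x sc_closed[OF sc] by (simp add: z_def a_minus_def A.l_distr A.l_minus q(4))
    also have "\<dots> = \<ominus> (w \<otimes> q)"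
      using q(1) x by (simp add: w_def smult_simps A.ring_simprules)
    finally have zq: "z \<otimes> q = \<ominus> (w \<otimes> q)" .
    have "\<rho> ((adj A z \<otimes> z) \<otimes> q) = \<rho> (adj A (w \<otimes> q) \<otimes> (w \<otimes> q))"
      unfolding trace_projection[OF z, of l, folded q_def] zq
      using w q(1) by (simp add: adj_uminus A.l_minus A.r_minus)
    also have "\<dots> = \<rho> ((adj A w \<otimes> w) \<otimes> q)" unfolding trace_projection[OF w, of l, folded q_def] ..
    finally show "Re (\<rho> ((adj A z \<otimes> z) \<otimes> \<Phi> (\<lambda>t. of_bool (t = l)))) =
        Re (\<rho> ((adj A (x \<ominus> f l \<odot> \<one>) \<otimes> (x \<ominus> f l \<odot> \<one>)) \<otimes> \<Phi> (\<lambda>t. of_bool (t = l))))"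
      by (simp add: q_def w_def)
  qed
  finally show ?thesis by (simp add: z_def)
qed

end

end

context commutative_state
begin

lemma character_poly_eval:
  assumes \<kappa>: "\<kappa> \<in> K" and x: "x \<in> carrier A"
  shows "\<kappa> (poly_eval A p x) = poly p (\<kappa> x)"
proof (induction p)
  case 0
  show ?case using pf_zero[OF character_pf[OF \<kappa>]] x by simp
next
  case (pCons c p)
  then show ?case using x \<kappa> by (simp add: poly_eval_pCons character_simps poly_eval_closed[OF x])
qed

end

locale commutative_lifting = tracial_ultraproduct_hom A I \<alpha> \<A> \<rho> \<pi>
  for A :: "'a cstar" and I :: "'i set" and \<alpha> :: "'i filter"
    and \<A> :: "'i \<Rightarrow> 'b cstar" and \<rho> :: "'i \<Rightarrow> 'b \<Rightarrow> complex" and \<pi> :: "'a \<Rightarrow> ('i \<Rightarrow> 'b) set" +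
  assumes comm: "cring A" and sep: "separable_cstar A"
    and rr0: "\<And>i. i \<in> I \<Longrightarrow> real_rank_zero (\<A> i)"
begin

sublocale S: commutative_state A \<omega>
  by (rule commutative_state.intro[OF A commutative_state_axioms.intro[OF comm sep \<omega>_state]])

text \<open>
  On the spectrum of a lift \<open>y i\<close> of the separating element \<open>s\<close>, a spectral value is sent to
  the character of a finite net with the nearest index. The error in trace norm is
  an integral of \<open>\<Sum>l. D l * tent n l\<close> over the spectrum of \<open>y i\<close>; after replacing the tents
  by polynomials it converges along the ultrafilter to the integral over the characters.
\<close>

lemma approximate_lift:
  fixes a :: "nat \<Rightarrow> 'a"
  assumes a: "\<And>j. a j \<in> carrier A" and x: "\<And>j. x j \<in> \<pi> (a j)" and e: "e > 0"
  shows "\<exists>\<psi>. (\<forall>i\<in>I. unital_star_hom A (\<A> i) (\<psi> i) \<and> (\<forall>b\<in>carrier A. cnorm (\<A> i) (\<psi> i b) \<le> cnorm A b)) \<and>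
    (\<forall>\<^sub>F i in \<alpha>. \<forall>j<r. N i (\<psi> i (a j) \<ominus>\<^bsub>\<A> i\<^esub> x j i) < e)"
proof -
  \<comment> \<open>The limit of the squared errors will be at most \<open>3 b\<close>.\<close>
  define b where "b = e\<^sup>2 / 6"
  have b: "b > 0" "3 * b < e\<^sup>2" using e by (auto simp: b_def)
  have "b / 2 > 0" using b by simp
  obtain n \<xi> where net': "(n::nat) > 0 \<and> (\<forall>l. \<xi> l \<in> S.K) \<and>
      (\<forall>\<kappa>\<in>S.K. \<exists>l<n. (\<Sum>j<r. (cmod (\<kappa> (a j) - \<xi> l (a j)))\<^sup>2) \<le> b / 2)"
    using S.finite_net[of r a "b / 2", OF a \<open>b / 2 > 0\<close>] by (elim exE) (rule that)
  then have n: "n > 0" ..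
  have \<xi>: "\<xi> l \<in> S.K" for l using net'[THEN conjunct2, THEN conjunct1] ..
  note net = net'[THEN conjunct2, THEN conjunct2, THEN bspec]
  define E where "E j l = a j \<ominus>\<^bsub>A\<^esub> \<xi> l (a j) \<odot>\<^bsub>A\<^esub> \<one>\<^bsub>A\<^esub>" for j l
  define d where "d j l = adj A (E j l) \<otimes>\<^bsub>A\<^esub> E j l" for j l
  have E: "E j l \<in> carrier A" for j l using a by (simp add: E_def)
  have d: "d j l \<in> carrier A" for j l using E by (simp add: d_def)
  have \<kappa>d: "\<kappa> (d j l) = complex_of_real ((cmod (\<kappa> (a j) - \<xi> l (a j)))\<^sup>2)" if "\<kappa> \<in> S.K" for \<kappa> j l
  proof -
    have "\<kappa> (E j l) = \<kappa> (a j) - \<xi> l (a j)" using a that by (simp add: E_def S.character_simps)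
    then show ?thesis unfolding complex_norm_square
      using E that by (simp add: d_def S.character_simps mult.commute)
  qed
  define D where "D l \<kappa> = (\<Sum>j<r. (cmod (\<kappa> (a j) - \<xi> l (a j)))\<^sup>2)" for l \<kappa>
  have da: "S.approximable (\<lambda>\<kappa>. (cmod (\<kappa> (a j) - \<xi> l (a j)))\<^sup>2)" for j l
    by (rule S.approximable_element[OF d[of j l]], rule \<kappa>d)
  have D: "S.approximable (D l)" for l
    unfolding D_def by (intro S.approximable_sum da) simp
  have D0: "0 \<le> D l \<kappa>" for l \<kappa> unfolding D_def by (intro sum_nonneg) simp
  have cover: "\<exists>l<n. D l \<kappa> \<le> b / 2" if "\<kappa> \<in> S.K" for \<kappa> using net[OF that] by (simp add: D_def)
  have b2: "b / 2 < b" using b by simp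
  obtain s where s: "s \<in> carrier A" "adj A s = s"
    and sep_s: "S.mean (\<lambda>\<kappa>. \<Sum>l<n. D l \<kappa> * tent n l (Re (\<kappa> s))) \<le> 2 * b"
    using S.separating_element[of D n "b / 2" b, OF D D0 cover b2 n] .
  obtain y where y: "y \<in> \<pi> s"
    and y_fin: "\<forall>i\<in>I. self_adjoint (\<A> i) (y i) \<and> finite (spectrum (\<A> i) (y i))"
    using finite_spectrum_lift[OF rr0 s] by blast
  have "\<exists>\<Lambda> \<Phi>. spectral_calculus (\<A> i) (y i) \<Lambda> \<Phi>" if "i \<in> I" for i
    using unital_cstar_algebra.finite_spectrum_calculus[OF alg[OF that]] bspec[OF y_fin that] by blast
  then obtain \<Lambda> \<Phi> where sc: "\<And>i. i \<in> I \<Longrightarrow> spectral_calculus (\<A> i) (y i) (\<Lambda> i) (\<Phi> i)" by metis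
  define \<psi> where "\<psi> i c = \<Phi> i (\<lambda>t. \<xi> (nearest n t) c)" for i c
  have \<psi>_hom: "unital_star_hom A (\<A> i) (\<psi> i)" if i: "i \<in> I" for i
  proof -
    interpret B: unital_cstar_algebra "\<A> i" by (rule alg[OF i])
    note scs = B.sc_add[OF sc[OF i]] B.sc_mult[OF sc[OF i]] B.sc_smult[OF sc[OF i]]
      B.sc_adj[OF sc[OF i]] B.sc_one[OF sc[OF i]]
    have "\<psi> i \<in> ring_hom A (\<A> i)"
    proof (rule ring_hom_memI)
      fix u v assume u: "u \<in> carrier A"
      show "\<psi> i u \<in> carrier (\<A> i)" unfolding \<psi>_def by (rule B.sc_closed[OF sc[OF i]])
      assume v: "v \<in> carrier A"
      show "\<psi> i (u \<otimes>\<^bsub>A\<^esub> v) = \<psi> i u \<otimes>\<^bsub>\<A> i\<^esub> \<psi> i v"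
        unfolding \<psi>_def scs[symmetric] using u v \<xi> by (simp add: S.character_simps)
      show "\<psi> i (u \<oplus>\<^bsub>A\<^esub> v) = \<psi> i u \<oplus>\<^bsub>\<A> i\<^esub> \<psi> i v"
        unfolding \<psi>_def scs[symmetric] using u v \<xi> by (simp add: S.character_simps)
    next
      show "\<psi> i \<one>\<^bsub>A\<^esub> = \<one>\<^bsub>\<A> i\<^esub>" unfolding \<psi>_def scs(5)[symmetric] using \<xi> by (simp add: S.character_simps)
    qed
    moreover have "\<psi> i (c \<odot>\<^bsub>A\<^esub> u) = c \<odot>\<^bsub>\<A> i\<^esub> \<psi> i u" if "u \<in> carrier A" for c u
      unfolding \<psi>_def scs(3)[symmetric] using that \<xi> by (simp add: S.character_simps)
    moreover have "\<psi> i (adj A u) = adj (\<A> i) (\<psi> i u)" if "u \<in> carrier A" for u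
      unfolding \<psi>_def scs(4)[symmetric] using that \<xi> by (simp add: S.character_simps)
    ultimately show ?thesis by (simp add: unital_star_hom_def)
  qed
  have \<psi>_norm: "cnorm (\<A> i) (\<psi> i c) \<le> cnorm A c" if i: "i \<in> I" and c: "c \<in> carrier A" for i c
  proof -
    interpret B: unital_cstar_algebra "\<A> i" by (rule alg[OF i])
    show ?thesis unfolding \<psi>_def
      by (rule B.spectral_calculus_cnorm_le[OF sc[OF i]])
        (use S.character_cmod_le[OF \<xi> c] A.cnorm_nonneg[OF c] in auto)
  qed
  obtain T0 where T0: "\<And>i. i \<in> I \<Longrightarrow> cnorm (\<A> i) (y i) \<le> T0"
    using rep_Bdd[OF s(1) y] unfolding carrier_Bdd by blast
  define T where "T = max T0 (cnorm A s)"
  define R where "R = (\<Sum>l<n. \<Sum>j<r. (cnorm A (E j l))\<^sup>2) + 1"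
  have R: "R > 0" unfolding R_def by (intro add_nonneg_pos sum_nonneg) auto
  define \<eta> where "\<eta> = b / (2 * R)"
  have \<eta>: "\<eta> > 0" using b R by (simp add: \<eta>_def)
  have "\<exists>p q. (\<forall>t. poly p (complex_of_real t) = complex_of_real (q t)) \<and>
      (\<forall>t. \<bar>t\<bar> \<le> T \<longrightarrow> \<bar>q t - tent n l t\<bar> \<le> \<eta>)" for l
    by (rule real_coefficient_approximation[OF continuous_on_tent[of n l] \<eta>])
  then obtain p q where pq: "\<forall>l. (\<forall>t. poly (p l) (complex_of_real t) = complex_of_real (q l t)) \<and>
      (\<forall>t. \<bar>t\<bar> \<le> T \<longrightarrow> \<bar>q l t - tent n l t\<bar> \<le> \<eta>)" by metis
  define P where "P l = p l + [:complex_of_real \<eta>:]" for l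
  define g where "g l t = q l t + \<eta>" for l t
  have Pg: "poly (P l) (complex_of_real t) = complex_of_real (g l t)" for l t
    using pq by (simp add: P_def g_def)
  have g: "tent n l t \<le> g l t" "g l t \<le> tent n l t + 2 * \<eta>" if "\<bar>t\<bar> \<le> T" for l t
  proof -
    have "\<bar>q l t - tent n l t\<bar> \<le> \<eta>" using pq that by blast
    then show "tent n l t \<le> g l t" "g l t \<le> tent n l t + 2 * \<eta>" by (auto simp: g_def)
  qed
  \<comment> \<open>The error for the index \<open>i\<close>, with the indicator functions replaced by polynomials.\<close>
  define dl where "dl j l i = adj (\<A> i) (x j i \<ominus>\<^bsub>\<A> i\<^esub> \<xi> l (a j) \<odot>\<^bsub>\<A> i\<^esub> \<one>\<^bsub>\<A> i\<^esub>) \<otimes>\<^bsub>\<A> i\<^esub>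
      (x j i \<ominus>\<^bsub>\<A> i\<^esub> \<xi> l (a j) \<odot>\<^bsub>\<A> i\<^esub> \<one>\<^bsub>\<A> i\<^esub>)" for j l i
  define u where "u i = (\<Sum>l<n. \<Sum>j<r. Re (\<rho> i (dl j l i \<otimes>\<^bsub>\<A> i\<^esub> poly_eval (\<A> i) (P l) (y i))))" for i
  define U where "U = (\<Sum>l<n. \<Sum>j<r. Re (\<omega> (d j l \<otimes>\<^bsub>A\<^esub> poly_eval A (P l) s)))"
  have "((\<lambda>i. \<rho> i (dl j l i \<otimes>\<^bsub>\<A> i\<^esub> poly_eval (\<A> i) (P l) (y i))) \<longlongrightarrow> \<omega> (d j l \<otimes>\<^bsub>A\<^esub> poly_eval A (P l) s)) \<alpha>"
    for j l
  proof -
    define x' where "x' = (\<lambda>i\<in>I. x j i \<ominus>\<^bsub>\<A> i\<^esub> (\<lambda>i\<in>I. \<xi> l (a j) \<odot>\<^bsub>\<A> i\<^esub> (\<lambda>i\<in>I. \<one>\<^bsub>\<A> i\<^esub>) i) i)"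
    have x': "x' \<in> \<pi> (E j l)" unfolding x'_def E_def
      using a by (intro rep_diff rep_smult rep_one x) auto
    define z where "z = (\<lambda>i\<in>I. (\<lambda>i\<in>I. (\<lambda>i\<in>I. adj (\<A> i) (x' i)) i \<otimes>\<^bsub>\<A> i\<^esub> x' i) i \<otimes>\<^bsub>\<A> i\<^esub>
        (\<lambda>i\<in>I. poly_eval (\<A> i) (P l) (y i)) i)"
    have z: "z \<in> \<pi> (d j l \<otimes>\<^bsub>A\<^esub> poly_eval A (P l) s)"
      unfolding z_def d_def using E s(1)
      by (intro rep_mult rep_adj rep_poly_eval x' y) auto
    have "((\<lambda>i. \<rho> i (z i)) \<longlongrightarrow> \<omega> (d j l \<otimes>\<^bsub>A\<^esub> poly_eval A (P l) s)) \<alpha>"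
      using d s(1) by (intro rep_limit z) auto
    then show ?thesis
      by (rule Lim_transform_eventually) (rule eventuallyI, simp add: z_def x'_def dl_def)
  qed
  then have "(u \<longlongrightarrow> U) \<alpha>" unfolding u_def U_def by (intro tendsto_sum tendsto_Re)
  moreover have "U < e\<^sup>2"
  proof -
    define F where "F j l \<kappa> = (cmod (\<kappa> (a j) - \<xi> l (a j)))\<^sup>2 * g l (Re (\<kappa> s))" for j l \<kappa>
    have \<kappa>s: "\<bar>Re (\<kappa> s)\<bar> \<le> T" if "\<kappa> \<in> S.K" for \<kappa>
      using S.character_cmod_le[OF that s(1)] abs_Re_le_cmod[of "\<kappa> s"] by (simp add: T_def)
    have \<kappa>F: "\<kappa> (d j l \<otimes>\<^bsub>A\<^esub> poly_eval A (P l) s) = complex_of_real (F j l \<kappa>)" if \<kappa>: "\<kappa> \<in> S.K" for j l \<kappa>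
    proof -
      have "\<kappa> (poly_eval A (P l) s) = complex_of_real (g l (Re (\<kappa> s)))"
        using S.character_poly_eval[OF \<kappa> s(1)] S.character_sa[OF \<kappa> s] Pg by metis
      then show ?thesis
        using \<kappa>d[OF \<kappa>] S.character_mult[OF \<kappa> d A.poly_eval_closed[OF s(1)]] by (simp add: F_def)
    qed
    have dP: "d j l \<otimes>\<^bsub>A\<^esub> poly_eval A (P l) s \<in> carrier A" for j l using d s(1) by auto
    have Fa: "S.approximable (F j l)" for j l by (rule S.approximable_element[OF dP[of j l]], rule \<kappa>F)
    have "S.mean (F j l) = Re (\<omega> (d j l \<otimes>\<^bsub>A\<^esub> poly_eval A (P l) s))" for j l
      by (rule S.mean_eq[OF dP[of j l]]) (simp add: \<kappa>F)
    then have "U = (\<Sum>l<n. S.mean (\<lambda>\<kappa>. \<Sum>j<r. F j l \<kappa>))"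
      unfolding U_def using Fa by (simp add: S.mean_sum)
    also have "\<dots> = S.mean (\<lambda>\<kappa>. \<Sum>l<n. \<Sum>j<r. F j l \<kappa>)"
      using Fa by (simp add: S.mean_sum S.approximable_sum)
    also have "\<dots> \<le> S.mean (\<lambda>\<kappa>. (\<Sum>l<n. D l \<kappa> * tent n l (Re (\<kappa> s))) + b)"
    proof (rule S.mean_mono)
      show "S.approximable (\<lambda>\<kappa>. \<Sum>l<n. \<Sum>j<r. F j l \<kappa>)" using Fa by (intro S.approximable_sum) auto
      have "S.approximable (\<lambda>\<kappa>. Re (\<kappa> s))"
        by (rule S.approximable_element[OF s(1)]) (use S.character_sa s in auto)
      note ta = S.approximable_continuous[OF this continuous_on_tent]
      show "S.approximable (\<lambda>\<kappa>. (\<Sum>l<n. D l \<kappa> * tent n l (Re (\<kappa> s))) + b)"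
        by (intro S.approximable_intros D ta) simp
      fix \<kappa> assume \<kappa>: "\<kappa> \<in> S.K"
      have cE: "(cmod (\<kappa> (a j) - \<xi> l (a j)))\<^sup>2 \<le> (cnorm A (E j l))\<^sup>2" for j l
      proof -
        have "\<kappa> (E j l) = \<kappa> (a j) - \<xi> l (a j)" using a \<kappa> by (simp add: E_def S.character_simps)
        then show ?thesis using S.character_cmod_le[OF \<kappa> E, of j l] by (simp add: power_mono)
      qed
      have "(\<Sum>l<n. \<Sum>j<r. F j l \<kappa>) \<le>
          (\<Sum>l<n. \<Sum>j<r. (cmod (\<kappa> (a j) - \<xi> l (a j)))\<^sup>2 * (tent n l (Re (\<kappa> s)) + 2 * \<eta>))"
        unfolding F_def by (intro sum_mono mult_left_mono g \<kappa>s[OF \<kappa>]) auto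
      also have "\<dots> = (\<Sum>l<n. D l \<kappa> * tent n l (Re (\<kappa> s))) + (\<Sum>l<n. \<Sum>j<r. (cmod (\<kappa> (a j) - \<xi> l (a j)))\<^sup>2) * (2 * \<eta>)"
        unfolding D_def by (simp add: distrib_left sum.distrib sum_distrib_right)
      also have "(\<Sum>l<n. \<Sum>j<r. (cmod (\<kappa> (a j) - \<xi> l (a j)))\<^sup>2) * (2 * \<eta>) \<le> R * (2 * \<eta>)"
      proof (rule mult_right_mono)
        have "(\<Sum>l<n. \<Sum>j<r. (cmod (\<kappa> (a j) - \<xi> l (a j)))\<^sup>2) \<le> (\<Sum>l<n. \<Sum>j<r. (cnorm A (E j l))\<^sup>2)"
          by (intro sum_mono cE)
        then show "(\<Sum>l<n. \<Sum>j<r. (cmod (\<kappa> (a j) - \<xi> l (a j)))\<^sup>2) \<le> R" by (simp add: R_def)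
      qed (use \<eta> in simp)
      also have "R * (2 * \<eta>) = b" using R by (simp add: \<eta>_def)
      finally show "(\<Sum>l<n. \<Sum>j<r. F j l \<kappa>) \<le> (\<Sum>l<n. D l \<kappa> * tent n l (Re (\<kappa> s))) + b" by simp
    qed
    also have "\<dots> = S.mean (\<lambda>\<kappa>. \<Sum>l<n. D l \<kappa> * tent n l (Re (\<kappa> s))) + b"
    proof -
      have "S.approximable (\<lambda>\<kappa>. Re (\<kappa> s))"
        by (rule S.approximable_element[OF s(1)]) (use S.character_sa s in auto)
      note ta = S.approximable_continuous[OF this continuous_on_tent]
      have "S.approximable (\<lambda>\<kappa>. \<Sum>l<n. D l \<kappa> * tent n l (Re (\<kappa> s)))"
        by (intro S.approximable_intros D ta) simp
      then show ?thesis by (simp add: S.mean_add S.approximable_const S.mean_const)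
    qed
    also have "\<dots> \<le> 3 * b" using sep_s by simp
    finally show ?thesis using b by simp
  qed
  ultimately have "\<forall>\<^sub>F i in \<alpha>. u i < e\<^sup>2" by (rule order_tendstoD)
  then have "\<forall>\<^sub>F i in \<alpha>. \<forall>j<r. N i (\<psi> i (a j) \<ominus>\<^bsub>\<A> i\<^esub> x j i) < e"
    using eventually_I
  proof eventually_elim
    case (elim i)
    note i = elim(2)
    interpret B: unital_cstar_algebra "\<A> i" by (rule alg[OF i])
    define m where "m j l t = Re (\<rho> i (dl j l i \<otimes>\<^bsub>\<A> i\<^esub> \<Phi> i (\<lambda>v. of_bool (v = t))))" for j l t
    have xi: "x j i \<in> carrier (\<A> i)" for j using rep_carrier[OF a x i] .
    have dli: "dl j l i \<in> carrier (\<A> i)" for j l using xi by (simp add: dl_def)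
    have m0: "m j l t \<ge> 0" for j l t
      unfolding m_def dl_def using B.trace_projection_nonneg[OF sc[OF i] tr[OF i]] xi by simp
    have err: "(N i (\<psi> i (a j) \<ominus>\<^bsub>\<A> i\<^esub> x j i))\<^sup>2 = (\<Sum>t\<in>\<Lambda> i. m j (nearest n t) t)" for j
      unfolding \<psi>_def m_def dl_def by (rule B.norm2_diff_spectral_sum[OF sc[OF i] tr[OF i] xi])
    have summand: "Re (\<rho> i (dl j l i \<otimes>\<^bsub>\<A> i\<^esub> poly_eval (\<A> i) (P l) (y i))) = (\<Sum>t\<in>\<Lambda> i. g l t * m j l t)" for j l
    proof -
      have "\<rho> i (dl j l i \<otimes>\<^bsub>\<A> i\<^esub> poly_eval (\<A> i) (P l) (y i)) =
          (\<Sum>t\<in>\<Lambda> i. complex_of_real (g l t) * \<rho> i (dl j l i \<otimes>\<^bsub>\<A> i\<^esub> \<Phi> i (\<lambda>v. of_bool (v = t))))"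
        unfolding B.sc_poly[OF sc[OF i], symmetric] Pg by (rule B.trace_spectral_sum[OF sc[OF i] tr[OF i] dli])
      then show ?thesis by (simp add: m_def)
    qed
    \<comment> \<open>The term \<open>l = nearest n t\<close> alone dominates, since its coefficient is at least \<open>1\<close>.\<close>
    have le: "m j (nearest n t) t \<le> (\<Sum>l<n. g l t * m j l t)" if t: "t \<in> \<Lambda> i" for j t
    proof -
      have "\<bar>t\<bar> \<le> T" using B.sc_bound[OF sc[OF i] t] T0[OF i] by (simp add: T_def)
      note gt = g[OF this]
      have "1 * m j (nearest n t) t \<le> g (nearest n t) t * m j (nearest n t) t"
        using gt(1)[of "nearest n t"] tent_nearest[OF n, of t] m0 by (intro mult_right_mono) auto
      also have "\<dots> \<le> (\<Sum>l<n. g l t * m j l t)"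
      proof (rule member_le_sum[of "nearest n t" "{..<n}" "\<lambda>l. g l t * m j l t"])
        show "0 \<le> g l t * m j l t" for l
          using gt(1)[of l] tent_bounds(1)[of n l t] m0 by (intro mult_nonneg_nonneg) auto
      qed (use nearest_less[OF n] in auto)
      finally show ?thesis by simp
    qed
    have "(\<Sum>j<r. (N i (\<psi> i (a j) \<ominus>\<^bsub>\<A> i\<^esub> x j i))\<^sup>2) \<le> (\<Sum>j<r. \<Sum>t\<in>\<Lambda> i. \<Sum>l<n. g l t * m j l t)"
      unfolding err by (intro sum_mono le)
    also have "\<dots> = (\<Sum>j<r. \<Sum>l<n. \<Sum>t\<in>\<Lambda> i. g l t * m j l t)"
      by (intro sum.cong refl sum.swap)
    also have "\<dots> = (\<Sum>l<n. \<Sum>j<r. \<Sum>t\<in>\<Lambda> i. g l t * m j l t)" by (rule sum.swap)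
    also have "\<dots> = u i" unfolding u_def summand ..
    finally have tot: "(\<Sum>j<r. (N i (\<psi> i (a j) \<ominus>\<^bsub>\<A> i\<^esub> x j i))\<^sup>2) < e\<^sup>2" using elim(1) by simp
    show ?case
    proof (intro allI impI)
      fix j assume j: "j < r"
      have "(N i (\<psi> i (a j) \<ominus>\<^bsub>\<A> i\<^esub> x j i))\<^sup>2 \<le> (\<Sum>j<r. (N i (\<psi> i (a j) \<ominus>\<^bsub>\<A> i\<^esub> x j i))\<^sup>2)"
        using j by (intro member_le_sum) auto
      then have "(N i (\<psi> i (a j) \<ominus>\<^bsub>\<A> i\<^esub> x j i))\<^sup>2 < e\<^sup>2" using tot by simp
      then show "N i (\<psi> i (a j) \<ominus>\<^bsub>\<A> i\<^esub> x j i) < e" using e by (simp add: power_less_imp_less_base)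
    qed
  qed
  then show ?thesis using \<psi>_hom \<psi>_norm by (intro exI[of _ \<psi>] conjI ballI)
qed

text \<open>
  For each \<open>n\<close> there is a family of homomorphisms that is good on \<open>a 0, \<dots>, a n\<close> up to
  \<open>1 / (n + 1)\<close>; the index \<open>i\<close> uses the family number \<open>k i\<close>, with \<open>k i \<rightarrow> \<infinity>\<close>. All maps being
  contractions in the trace norm, convergence on the dense sequence suffices.
\<close>

theorem approximately_liftable: "approximately_liftable A I \<alpha> \<A> \<rho> \<pi>"
proof -
  obtain a where "(\<forall>n::nat. a n \<in> carrier A) \<and> (\<forall>z\<in>carrier A. \<forall>e>0. \<exists>n. cnorm A (z \<ominus>\<^bsub>A\<^esub> a n) < e)"
    using A.dense_sequence[OF sep] ..
  then have a: "a n \<in> carrier A" and dense: "\<lbrakk>z \<in> carrier A; e > 0\<rbrakk> \<Longrightarrow> \<exists>n. cnorm A (z \<ominus>\<^bsub>A\<^esub> a n) < e"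
    for n z e by auto
  have "\<forall>j. \<exists>x. x \<in> \<pi> (a j)" using rep_exists[OF a] by (intro allI)
  from choice[OF this] obtain x where "\<forall>j. x j \<in> \<pi> (a j)" ..
  then have x: "x j \<in> \<pi> (a j)" for j ..
  define good where "good n \<psi> \<longleftrightarrow> (\<forall>i\<in>I. unital_star_hom A (\<A> i) (\<psi> i) \<and>
      (\<forall>b\<in>carrier A. cnorm (\<A> i) (\<psi> i b) \<le> cnorm A b)) \<and>
    (\<forall>\<^sub>F i in \<alpha>. \<forall>j<Suc n. N i (\<psi> i (a j) \<ominus>\<^bsub>\<A> i\<^esub> x j i) < 1 / (real n + 1))" for n \<psi>
  have "\<forall>n. \<exists>\<psi>. good n \<psi>"
    unfolding good_def by (intro allI approximate_lift[OF a x]) simp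
  from choice[OF this] obtain \<psi> where good: "\<forall>n. good n (\<psi> n)" ..
  have \<psi>: "\<forall>i\<in>I. unital_star_hom A (\<A> i) (\<psi> n i) \<and> (\<forall>b\<in>carrier A. cnorm (\<A> i) (\<psi> n i b) \<le> cnorm A b)" for n
    using spec[OF good, of n] unfolding good_def by (elim conjE)
  have ev: "\<forall>\<^sub>F i in \<alpha>. \<forall>j<Suc n. N i (\<psi> n i (a j) \<ominus>\<^bsub>\<A> i\<^esub> x j i) < 1 / (real n + 1)" for n
    using spec[OF good, of n] unfolding good_def by (elim conjE)
  obtain k where k': "(\<forall>\<^sub>F i in \<alpha>. \<forall>j<Suc (k i). N i (\<psi> (k i) i (a j) \<ominus>\<^bsub>\<A> i\<^esub> x j i) < 1 / (real (k i) + 1)) \<and>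
      (\<forall>m. \<forall>\<^sub>F i in \<alpha>. m \<le> k i)"
    using nontrivial_ultrafilter_diagonal[of I \<alpha>
        "\<lambda>n i. \<forall>j<Suc n. N i (\<psi> n i (a j) \<ominus>\<^bsub>\<A> i\<^esub> x j i) < 1 / (real n + 1)", OF uf ev]
    by (elim exE) (rule that)
  note k = conjunct1[OF k'] and k_inf = conjunct2[OF k']
  define \<phi> where "\<phi> i = \<psi> (k i) i" for i
  have \<phi>_hom: "unital_star_hom A (\<A> i) (\<phi> i)"
    and \<phi>_norm: "b \<in> carrier A \<Longrightarrow> cnorm (\<A> i) (\<phi> i b) \<le> cnorm A b" if "i \<in> I" for i b
    using bspec[OF \<psi>[of "k i"] that] by (simp_all add: \<phi>_def)
  have \<phi>_closed: "\<phi> i b \<in> carrier (\<A> i)" if "i \<in> I" "b \<in> carrier A" for i b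
    using \<phi>_hom[OF that(1)] that(2) by (auto simp: unital_star_hom_def ring_hom_closed)
  have \<phi>_diff: "\<phi> i (b \<ominus>\<^bsub>A\<^esub> c) = \<phi> i b \<ominus>\<^bsub>\<A> i\<^esub> \<phi> i c"
    if i: "i \<in> I" and b: "b \<in> carrier A" and c: "c \<in> carrier A" for i b c
  proof -
    interpret B: unital_cstar_algebra "\<A> i" by (rule alg[OF i])
    have h: "\<phi> i \<in> ring_hom A (\<A> i)" and "\<phi> i ((-1) \<odot>\<^bsub>A\<^esub> c) = (-1) \<odot>\<^bsub>\<A> i\<^esub> \<phi> i c"
      using \<phi>_hom[OF i] c unfolding unital_star_hom_def by blast+
    then have "\<phi> i (b \<oplus>\<^bsub>A\<^esub> (-1) \<odot>\<^bsub>A\<^esub> c) = \<phi> i b \<oplus>\<^bsub>\<A> i\<^esub> (-1) \<odot>\<^bsub>\<A> i\<^esub> \<phi> i c"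
      using ring_hom_add[OF h b A.smult_closed'[OF c]] by simp
    then show ?thesis
      using b c \<phi>_closed[OF i c] by (simp add: a_minus_def A.minus_eq_smult B.minus_eq_smult)
  qed
  have lift: "\<pi> b = Null +>\<^bsub>Bdd\<^esub> (\<lambda>i\<in>I. \<phi> i b)" if b: "b \<in> carrier A" for b
  proof -
    obtain z where z: "z \<in> \<pi> b" using rep_exists[OF b] by blast
    have fP: "(\<lambda>i\<in>I. \<phi> i b) \<in> carrier Bdd"
      by (rule restrict_in_Bdd[OF \<phi>_closed[OF _ b] \<phi>_norm[OF _ b]])
    have "(\<lambda>i\<in>I. \<phi> i b) \<doteq> z"
      unfolding close_def
    proof (rule tendstoI)
      fix e :: real assume e: "e > 0"
      then have "e / 3 > 0" by simp
      then obtain j where j: "cnorm A (b \<ominus>\<^bsub>A\<^esub> a j) < e / 3" using dense[OF b] by blast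
      obtain m0 :: nat where m0: "3 / e < real m0" using reals_Archimedean2 by blast
      define m where "m = max m0 j"
      have "(\<lambda>i\<in>I. x j i \<ominus>\<^bsub>\<A> i\<^esub> z i) \<in> \<pi> (a j \<ominus>\<^bsub>A\<^esub> b)" by (rule rep_diff[OF a b x z])
      then have third: "\<forall>\<^sub>F i in \<alpha>. N i ((\<lambda>i\<in>I. x j i \<ominus>\<^bsub>\<A> i\<^esub> z i) i) < e / 3"
      proof (rule rep_norm2_eventually_less[rotated])
        show "cnorm A (a j \<ominus>\<^bsub>A\<^esub> b) < e / 3" using j A.cnorm_diff_commute[OF a b, of j] by simp
        show "a j \<ominus>\<^bsub>A\<^esub> b \<in> carrier A" using a b by simp
      qed
      show "\<forall>\<^sub>F i in \<alpha>. dist (N i ((\<lambda>i\<in>I. \<phi> i b) i \<ominus>\<^bsub>\<A> i\<^esub> z i)) 0 < e"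
        using third k spec[OF k_inf, of m] eventually_I
      proof eventually_elim
        case (elim i)
        note i = elim(4)
        interpret B: unital_cstar_algebra "\<A> i" by (rule alg[OF i])
        note n2 = B.norm2_diff_triangle[OF tr[OF i]]
        have cl: "\<phi> i b \<in> carrier (\<A> i)" "\<phi> i (a j) \<in> carrier (\<A> i)" "x j i \<in> carrier (\<A> i)" "z i \<in> carrier (\<A> i)"
          using \<phi>_closed[OF i] a b rep_carrier[OF a x i] rep_carrier[OF b z i] by auto
        have "N i (\<phi> i b \<ominus>\<^bsub>\<A> i\<^esub> \<phi> i (a j)) \<le> cnorm (\<A> i) (\<phi> i b \<ominus>\<^bsub>\<A> i\<^esub> \<phi> i (a j))"
          using cl by (intro B.norm2_le_cnorm[OF tr[OF i]]) auto
        also have "\<dots> \<le> cnorm A (b \<ominus>\<^bsub>A\<^esub> a j)"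
          unfolding \<phi>_diff[OF i b a, symmetric] using a b by (intro \<phi>_norm[OF i]) auto
        finally have 1: "N i (\<phi> i b \<ominus>\<^bsub>\<A> i\<^esub> \<phi> i (a j)) < e / 3" using j by linarith
        have "3 / e < real (k i) + 1" using m0 elim(3) by (simp add: m_def)
        then have "1 / (real (k i) + 1) < e / 3" using e by (simp add: field_simps)
        moreover have "N i (\<phi> i (a j) \<ominus>\<^bsub>\<A> i\<^esub> x j i) < 1 / (real (k i) + 1)"
        proof -
          have "j < Suc (k i)" using elim(3) by (simp add: m_def)
          then show ?thesis using elim(2) unfolding \<phi>_def by blast
        qed
        ultimately have 2: "N i (\<phi> i (a j) \<ominus>\<^bsub>\<A> i\<^esub> x j i) < e / 3" by linarith
        have 3: "N i (x j i \<ominus>\<^bsub>\<A> i\<^esub> z i) < e / 3" using elim(1) unfolding restrict_apply'[OF i] .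
        have "N i (\<phi> i b \<ominus>\<^bsub>\<A> i\<^esub> z i) < e"
          using n2[OF cl(1,2,4)] n2[OF cl(2,3,4)] 1 2 3 by linarith
        moreover have "0 \<le> N i (\<phi> i b \<ominus>\<^bsub>\<A> i\<^esub> z i)" using cl by (intro B.norm2_nonneg[OF tr[OF i]]) auto
        ultimately show ?case unfolding restrict_apply'[OF i] dist_real_def by simp
      qed
    qed
    then have "(\<lambda>i\<in>I. \<phi> i b) \<in> \<pi> b" by (rule rep_cong[OF b z fP])
    then show ?thesis by (rule rep_eq[OF b])
  qed
  show ?thesis
    unfolding approximately_liftable_def
  proof (intro exI[of _ I] exI[of _ \<phi>] conjI ballI)
    show "\<forall>\<^sub>F i in \<alpha>. i \<in> I" by (rule eventually_I)
    show "unital_star_hom A (\<A> i) (\<phi> i)" if "i \<in> I" for i by (rule \<phi>_hom[OF that])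
    fix b assume b: "b \<in> carrier A"
    have "restrict (\<lambda>i. if i \<in> I then \<phi> i b else \<zero>\<^bsub>\<A> i\<^esub>) I = (\<lambda>i\<in>I. \<phi> i b)" by (rule restrict_ext) simp
    then show "\<pi> b = ultraproduct_coset I \<alpha> \<A> \<rho> (\<lambda>i. if i \<in> I then \<phi> i b else \<zero>\<^bsub>\<A> i\<^esub>)"
      using lift[OF b] by (simp add: ultraproduct_coset_def)
  qed simp
qed

end

theorem theorem2p5:
  fixes \<C> :: "'b cstar set" and A :: "'a cstar"
  assumes "\<forall>B\<in>\<C>. unital_cstar_algebra B"
    and "\<forall>B\<in>\<C>. \<forall>B'. unital_cstar_algebra B' \<and> cstar_isomorphic B B' \<longrightarrow> B' \<in> \<C>"
    and "\<forall>B\<in>\<C>. real_rank_zero B"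
    and "unital_cstar_algebra A"
    and "separable_cstar A"
    and "cring A"
  shows "tracially_stable TYPE('i) \<C> A"
  unfolding tracially_stable_def
proof (intro allI impI)
  fix I :: "'i set" and \<alpha> \<A> \<rho> \<pi>
  assume uf: "nontrivial_ultrafilter_on I \<alpha>"
    and fam: "\<forall>i\<in>I. \<A> i \<in> \<C> \<and> tracial_state (\<A> i) (\<rho> i)"
    and hom: "unital_star_hom A (tracial_ultraproduct I \<alpha> \<A> \<rho>) \<pi>"
  have inC: "\<A> i \<in> \<C>" and tr: "tracial_state (\<A> i) (\<rho> i)" if "i \<in> I" for i
    using bspec[OF fam that] by simp_all
  interpret commutative_lifting A I \<alpha> \<A> \<rho> \<pi>
    by (intro commutative_lifting.intro tracial_ultraproduct_hom.intro commutative_lifting_axioms.intro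
        assms(4-6) uf hom tr bspec[OF assms(1)] bspec[OF assms(3)] inC)
  show "approximately_liftable A I \<alpha> \<A> \<rho> \<pi>" by (rule approximately_liftable)
qed

end
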